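(* Let $L,d>0$, $E_1>E_2>0$, $0<\nu<\frac12$, let $\mathcal K$ and $\kappa$ be as in the context, and assume $E=(\kappa+1-\nu^2)\mathcal K$. For $\ell>0$ put $\Omega=(0,L)\times(-\ell,\ell)$ and let $$0<\lambda_1^\ell\le\lambda_2^\ell\le\dots\le\lambda_m^\ell\le\dots$$ be the eigenvalues, each repeated as many times as its multiplicity, of the problem $$\begin{cases} \frac{d^3\mathcal K}{12}\left(\Delta^2u+\kappa\frac{\partial^4u}{\partial x^4}\right)=\lambda u & \text{in }\Omega,\\ u(0,y)=u_{xx}(0,y)=u(L,y)=u_{xx}(L,y)=0 & \text{for }y\in(-\ell,\ell),\\ u_{yy}(x,\pm\ell)+\nu u_{xx}(x,\pm\ell)=0 & \text{for }x\in(0,L),\\ u_{yyy}(x,\pm\ell)+(2-\nu)u_{xxy}(x,\pm\ell)=0 & \text{for }x\in(0,L). \end{cases}$$ Let $$\lambda_m^0=\frac{Ed^3\pi^4m^4}{12L^4},\qquad m\ge1,$$ be the eigenvalues of the beam problem $\frac{Ed^3}{12}\psi''''=\lambda\psi$ in $(0,L)$, $\psi(0)=\psi(L)=\psi''(0)=\psi''(L)=0$. Then for any $m\ge1$ we have $\lambda_m^\ell\to\lambda_m^0$ as $\ell\to0$.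
   Context: The parameters $L,d,E_1,E_2,\nu$ are fixed, independent of $\ell$. With $\nu=\nu_{12}$ and $\nu_{21}=\nu_{12}E_2/E_1$, $$\mathcal K=\frac{E_2}{1-\nu_{12}\nu_{21}},\qquad\kappa=\frac{E_1-E_2}{E_2}>0.$$ The eigenvalues of the plate problem are understood in the weak sense: $\lambda$ is an eigenvalue if there is $u\not\equiv0$ in $H^2_*(\Omega)=\{w\in H^2(\Omega):w=0\text{ on }\{0,L\}\times(-\ell,\ell)\}$ with $$\frac{d^3\mathcal K}{12}\int_\Omega\left[\nu\Delta u\Delta v+(1-\nu)D^2u:D^2v+\kappa\,u_{xx}v_{xx}\right]dx\,dy=\lambda\int_\Omega uv\,dx\,dy\quad\text{for all }v\in H^2_*(\Omega),$$ where $D^2u:D^2v=u_{xx}v_{xx}+2u_{xy}v_{xy}+u_{yy}v_{yy}$. They form an increasing sequence of positive numbers diverging to $+\infty$. *)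

theory Defs
  imports "HOL-Analysis.Analysis"
begin

section \<open>Smooth test functions, weak derivatives, Sobolev spaces\<close>

primrec Ck :: "nat \<Rightarrow> ('a::euclidean_space \<Rightarrow> real) \<Rightarrow> bool" where
  "Ck 0 f \<longleftrightarrow> continuous_on UNIV f"
| "Ck (Suc k) f \<longleftrightarrow> f differentiable_on UNIV \<and>
     (\<forall>b\<in>Basis. Ck k (\<lambda>x. frechet_derivative f (at x) b))"

definition test_functions :: "'a::euclidean_space set \<Rightarrow> ('a \<Rightarrow> real) set" where
  "test_functions \<Omega> = {\<phi>. (\<forall>k. Ck k \<phi>) \<and> compact (closure {x. \<phi> x \<noteq> 0})
     \<and> closure {x. \<phi> x \<noteq> 0} \<subseteq> \<Omega>}"

text \<open>Elements of \<open>L2 \<Omega>\<close> and of the Sobolev spaces below are functions, not classes; everything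
  defined from them depends only on their values almost everywhere in \<open>\<Omega>\<close>.\<close>

definition L2 :: "'a::euclidean_space set \<Rightarrow> ('a \<Rightarrow> real) set" where
  "L2 \<Omega> = {f. set_borel_measurable lborel \<Omega> f \<and> set_integrable lborel \<Omega> (\<lambda>x. (f x)\<^sup>2)}"

definition has_weak_partial ::
  "'a::euclidean_space set \<Rightarrow> 'a \<Rightarrow> ('a \<Rightarrow> real) \<Rightarrow> ('a \<Rightarrow> real) \<Rightarrow> bool" where
  "has_weak_partial \<Omega> b u g \<longleftrightarrow> (\<forall>\<phi>\<in>test_functions \<Omega>.
     (LINT x:\<Omega>|lborel. u x * frechet_derivative \<phi> (at x) b) = - (LINT x:\<Omega>|lborel. g x * \<phi> x))"

text \<open>\<open>sobolev_H k \<Omega>\<close> is \<open>H\<^sup>k(\<Omega>) = W\<^sup>k\<^sup>,\<^sup>2(\<Omega>)\<close>: all weak derivatives of order at most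
  \<open>k\<close>, obtained by iterating first-order ones, exist in \<open>L\<^sup>2(\<Omega>)\<close>.\<close>

primrec sobolev_H :: "nat \<Rightarrow> 'a::euclidean_space set \<Rightarrow> ('a \<Rightarrow> real) set" where
  "sobolev_H 0 \<Omega> = L2 \<Omega>"
| "sobolev_H (Suc k) \<Omega> =
     {u \<in> L2 \<Omega>. \<forall>b\<in>Basis. \<exists>g\<in>sobolev_H k \<Omega>. has_weak_partial \<Omega> b u g}"

text \<open>A representative of the weak derivative, which is unique up to a null set of \<open>\<Omega>\<close>.\<close>

definition weak_partial :: "'a::euclidean_space set \<Rightarrow> 'a \<Rightarrow> ('a \<Rightarrow> real) \<Rightarrow> ('a \<Rightarrow> real)" where
  "weak_partial \<Omega> b u = (SOME g. g \<in> L2 \<Omega> \<and> has_weak_partial \<Omega> b u g)"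

section \<open>The partially hinged plate\<close>

definition plate :: "real \<Rightarrow> real \<Rightarrow> (real \<times> real) set" where
  "plate L l = {0<..<L} \<times> {-l<..<l}"

text \<open>Boundary values on the hinged edges are pointwise values of the continuous representative,
  which exists because \<open>H\<^sup>2(\<Omega>)\<close> embeds into \<open>C(closure \<Omega>)\<close> for a rectangle \<open>\<Omega>\<close>.\<close>

definition H2_star :: "real \<Rightarrow> real \<Rightarrow> (real \<times> real \<Rightarrow> real) set" where
  "H2_star L l = {w \<in> sobolev_H 2 (plate L l).
     \<exists>w'. continuous_on (closure (plate L l)) w' \<and>
          (AE x in lborel. x \<in> plate L l \<longrightarrow> w' x = w x) \<and>
          (\<forall>x \<in> {0, L} \<times> {-l<..<l}. w' x = 0)}"

definition w_xx :: "(real \<times> real) set \<Rightarrow> (real \<times> real \<Rightarrow> real) \<Rightarrow> (real \<times> real \<Rightarrow> real)" where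
  "w_xx \<Omega> u = weak_partial \<Omega> (1, 0) (weak_partial \<Omega> (1, 0) u)"

definition w_xy :: "(real \<times> real) set \<Rightarrow> (real \<times> real \<Rightarrow> real) \<Rightarrow> (real \<times> real \<Rightarrow> real)" where
  "w_xy \<Omega> u = weak_partial \<Omega> (0, 1) (weak_partial \<Omega> (1, 0) u)"

definition w_yy :: "(real \<times> real) set \<Rightarrow> (real \<times> real \<Rightarrow> real) \<Rightarrow> (real \<times> real \<Rightarrow> real)" where
  "w_yy \<Omega> u = weak_partial \<Omega> (0, 1) (weak_partial \<Omega> (0, 1) u)"

definition laplace :: "(real \<times> real) set \<Rightarrow> (real \<times> real \<Rightarrow> real) \<Rightarrow> (real \<times> real \<Rightarrow> real)" where
  "laplace \<Omega> u = (\<lambda>p. w_xx \<Omega> u p + w_yy \<Omega> u p)"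

definition hessian_prod ::
  "(real \<times> real) set \<Rightarrow> (real \<times> real \<Rightarrow> real) \<Rightarrow> (real \<times> real \<Rightarrow> real) \<Rightarrow> (real \<times> real \<Rightarrow> real)" where
  "hessian_prod \<Omega> u v =
     (\<lambda>p. w_xx \<Omega> u p * w_xx \<Omega> v p + 2 * w_xy \<Omega> u p * w_xy \<Omega> v p + w_yy \<Omega> u p * w_yy \<Omega> v p)"

text \<open>Orthotropic constants, with \<open>\<nu> = \<nu>\<^sub>1\<^sub>2\<close>.\<close>

definition nu21 :: "real \<Rightarrow> real \<Rightarrow> real \<Rightarrow> real" where
  "nu21 E1 E2 \<nu> = \<nu> * E2 / E1"

definition stiffness :: "real \<Rightarrow> real \<Rightarrow> real \<Rightarrow> real" where
  "stiffness E1 E2 \<nu> = E2 / (1 - \<nu> * nu21 E1 E2 \<nu>)"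

definition anisotropy :: "real \<Rightarrow> real \<Rightarrow> real" where
  "anisotropy E1 E2 = (E1 - E2) / E2"

definition plate_form ::
  "real \<Rightarrow> real \<Rightarrow> real \<Rightarrow> real \<Rightarrow> (real \<times> real) set \<Rightarrow>
   (real \<times> real \<Rightarrow> real) \<Rightarrow> (real \<times> real \<Rightarrow> real) \<Rightarrow> real" where
  "plate_form d K \<nu> \<kappa> \<Omega> u v = d^3 * K / 12 *
     (LINT p:\<Omega>|lborel. \<nu> * laplace \<Omega> u p * laplace \<Omega> v p
        + (1 - \<nu>) * hessian_prod \<Omega> u v p + \<kappa> * w_xx \<Omega> u p * w_xx \<Omega> v p)"

definition plate_eigenspace ::
  "real \<Rightarrow> real \<Rightarrow> real \<Rightarrow> real \<Rightarrow> real \<Rightarrow> real \<Rightarrow> real \<Rightarrow> (real \<times> real \<Rightarrow> real) set" where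
  "plate_eigenspace L d K \<nu> \<kappa> l \<mu> = {u \<in> H2_star L l. \<forall>v \<in> H2_star L l.
     plate_form d K \<nu> \<kappa> (plate L l) u v = \<mu> * (LINT p:plate L l|lborel. u p * v p)}"

definition plate_eigenvalue ::
  "real \<Rightarrow> real \<Rightarrow> real \<Rightarrow> real \<Rightarrow> real \<Rightarrow> real \<Rightarrow> real \<Rightarrow> bool" where
  "plate_eigenvalue L d K \<nu> \<kappa> l \<mu> \<longleftrightarrow> (\<exists>u \<in> plate_eigenspace L d K \<nu> \<kappa> l \<mu>.
     \<not> (AE p in lborel. p \<in> plate L l \<longrightarrow> u p = 0))"

text \<open>\<open>V\<close>, modulo equality almost everywhere in \<open>\<Omega>\<close>, has a basis of \<open>n\<close> elements.\<close>

definition has_dim_ae :: "'a::euclidean_space set \<Rightarrow> ('a \<Rightarrow> real) set \<Rightarrow> nat \<Rightarrow> bool" where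
  "has_dim_ae \<Omega> V n \<longleftrightarrow> (\<exists>b :: nat \<Rightarrow> 'a \<Rightarrow> real.
     (\<forall>i<n. b i \<in> V) \<and>
     (\<forall>c :: nat \<Rightarrow> real. (AE x in lborel. x \<in> \<Omega> \<longrightarrow> (\<Sum>i<n. c i * b i x) = 0) \<longrightarrow> (\<forall>i<n. c i = 0)) \<and>
     (\<forall>u\<in>V. \<exists>c :: nat \<Rightarrow> real. AE x in lborel. x \<in> \<Omega> \<longrightarrow> u x = (\<Sum>i<n. c i * b i x)))"

text \<open>\<open>lam 1 \<le> lam 2 \<le> \<dots>\<close> lists all the eigenvalues, each repeated according to its
  multiplicity; indices start at 1 and \<open>lam 0\<close> is irrelevant.\<close>

definition plate_eigenvalue_sequence ::
  "real \<Rightarrow> real \<Rightarrow> real \<Rightarrow> real \<Rightarrow> real \<Rightarrow> real \<Rightarrow> (nat \<Rightarrow> real) \<Rightarrow> bool" where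
  "plate_eigenvalue_sequence L d K \<nu> \<kappa> l lam \<longleftrightarrow>
     0 < lam 1 \<and> (\<forall>m\<ge>1. lam m \<le> lam (Suc m)) \<and>
     lam ` {1..} = {\<mu>. plate_eigenvalue L d K \<nu> \<kappa> l \<mu>} \<and>
     (\<forall>\<mu>. plate_eigenvalue L d K \<nu> \<kappa> l \<mu> \<longrightarrow>
        finite {m. 1 \<le> m \<and> lam m = \<mu>} \<and>
        has_dim_ae (plate L l) (plate_eigenspace L d K \<nu> \<kappa> l \<mu>) (card {m. 1 \<le> m \<and> lam m = \<mu>}))"

end

theory Submission
  imports Defs
begin

text \<open>Why the eigenvalues converge. Write \<open>D = d\<^sup>3 K / 12\<close> and \<open>a\<^sub>k = k\<pi> / L\<close>; the limit is
  \<open>\<Lambda>\<^sub>m = D (\<kappa> + 1 - \<nu>\<^sup>2) a\<^sub>m\<^sup>4\<close>. The energy density of \<open>u\<close> is, up to the factor \<open>D\<close>,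
  \<open>(\<kappa> + 1 - \<nu>\<^sup>2) u\<^sub>x\<^sub>x\<^sup>2 + (u\<^sub>y\<^sub>y + \<nu> u\<^sub>x\<^sub>x)\<^sup>2 + 2 (1 - \<nu>) u\<^sub>x\<^sub>y\<^sup>2\<close>.
  In a thin plate the last term forbids variation across the width, and the middle one relaxes to
  zero, since the free edges let the plate curve across its width by \<open>u\<^sub>y\<^sub>y = - \<nu> u\<^sub>x\<^sub>x\<close> up to
  lower order. What remains is a beam.

  Lower bound. Expand \<open>u\<close> in the modes \<open>sin (k\<pi>x/L) cos (j\<pi>(y+l)/2l)\<close>, which are complete by the
  Stone-Weierstrass theorem. The Fourier coefficients of \<open>u\<^sub>x\<^sub>x\<close> and \<open>u\<^sub>x\<^sub>y\<close> are multiples of those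
  of \<open>u\<close>, so Bessel's inequality gives the energy at least \<open>\<Lambda>\<^sub>m\<close> times the squared norm of \<open>u\<close> as
  soon as \<open>l\<close> is small and \<open>u\<close> is orthogonal to the modes \<open>(k, 0)\<close> with \<open>k < m\<close>
  (\<open>plate_form_lower_bound\<close>). The span of the first \<open>m\<close> eigenfunctions contains such a \<open>u \<noteq> 0\<close>, and its
  energy is at most the \<open>m\<close>-th eigenvalue times its squared norm; hence that eigenvalue is at least
  \<open>\<Lambda>\<^sub>m\<close> (\<open>eigenvalue_lower_bound\<close>).

  Upper bound. For each \<open>k \<le> m\<close> the problem has an explicit solution \<open>sin (k\<pi>x/L) \<phi>(y)\<close>, with \<open>\<phi>\<close> a sum
  of two hyperbolic cosines. The boundary conditions reduce to one scalar equation, which the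
  intermediate value theorem solves for small \<open>l\<close> with an eigenvalue as near to \<open>\<Lambda>\<^sub>k\<close> as desired
  (\<open>plate_eigenvalue_near\<close>). These are \<open>m\<close> distinct eigenvalues, and the sequence lists
  all eigenvalues in increasing order, so its \<open>m\<close>-th entry is at most the largest of them.

  Both halves integrate by parts against functions that have only weak derivatives. All the smooth
  functions needed are products \<open>g(x) h(y)\<close>, so one-dimensional cutoffs suffice to reduce this to
  the definition of weak derivatives; the boundary terms are examined as the cutoffs are removed.\<close>

section \<open>Calculus of the classes Ck\<close>

lemma Ck_Suc_iff:
  fixes f :: "'a::euclidean_space \<Rightarrow> real"
  assumes "\<And>x. (f has_derivative f' x) (at x)"
  shows "Ck (Suc k) f \<longleftrightarrow> (\<forall>b\<in>Basis. Ck k (\<lambda>x. f' x b))"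
proof -
  have "frechet_derivative f (at x) = f' x" for x
    using frechet_derivative_at[OF assms] by simp
  moreover have "f differentiable_on UNIV"
    using assms by (auto simp: differentiable_on_def differentiable_def intro: has_derivative_at_withinI)
  ultimately show ?thesis by simp
qed

lemma Ck_Suc_has_derivative:
  assumes "Ck (Suc k) f"
  shows "(f has_derivative frechet_derivative f (at x)) (at x)"
  using assms by (auto simp: differentiable_on_def frechet_derivative_works[symmetric])

lemma Ck_Suc_real_iff:
  fixes f :: "real \<Rightarrow> real"
  assumes "\<And>x. (f has_real_derivative f' x) (at x)"
  shows "Ck (Suc k) f \<longleftrightarrow> Ck k f'"
  using Ck_Suc_iff[of f "\<lambda>x h. f' x * h" k] assms by (simp add: has_field_derivative_def)

lemma Ck_SucD: "Ck (Suc k) f \<Longrightarrow> Ck k f"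
proof (induction k arbitrary: f)
  case 0
  then show ?case by (auto intro: differentiable_imp_continuous_on)
next
  case (Suc k)
  then show ?case by auto
qed

lemma Ck_continuous: "Ck k f \<Longrightarrow> continuous_on UNIV f"
proof (induction k)
  case (Suc k)
  then show ?case using Ck_SucD by blast
qed simp

lemma Ck_const [simp]: "Ck k (\<lambda>x. c)"
proof (induction k arbitrary: c)
  case (Suc k)
  have *: "\<And>x. ((\<lambda>x. c) has_derivative (\<lambda>h. 0)) (at x)" by simp
  show ?case unfolding Ck_Suc_iff[OF *] using Suc by simp
qed simp

lemma Ck_add: "Ck k f \<Longrightarrow> Ck k g \<Longrightarrow> Ck k (\<lambda>x. f x + g x)"
proof (induction k arbitrary: f g)
  case 0
  then show ?case by (auto intro: continuous_intros)
next
  case (Suc k)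
  have *: "\<And>x. ((\<lambda>x. f x + g x) has_derivative
      (\<lambda>h. frechet_derivative f (at x) h + frechet_derivative g (at x) h)) (at x)"
    using Suc.prems by (intro has_derivative_add Ck_Suc_has_derivative)
  show ?case unfolding Ck_Suc_iff[OF *] using Suc by simp
qed

lemma Ck_mult: "Ck k f \<Longrightarrow> Ck k g \<Longrightarrow> Ck k (\<lambda>x. f x * g x)"
proof (induction k arbitrary: f g)
  case 0
  then show ?case by (auto intro: continuous_intros)
next
  case (Suc k)
  have *: "\<And>x. ((\<lambda>x. f x * g x) has_derivative
      (\<lambda>h. f x * frechet_derivative g (at x) h + frechet_derivative f (at x) h * g x)) (at x)"
    using Suc.prems by (intro has_derivative_mult Ck_Suc_has_derivative)
  have "Ck k f" "Ck k g" using Suc.prems Ck_SucD by blast+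
  then show ?case unfolding Ck_Suc_iff[OF *]
    using Suc by (intro ballI Ck_add Suc.IH) auto
qed

lemma Ck_inverse:
  assumes "\<And>x. f x \<noteq> 0"
  shows "Ck k f \<Longrightarrow> Ck k (\<lambda>x. inverse (f x))"
proof (induction k)
  case 0
  then show ?case using assms by (auto intro: continuous_intros)
next
  case (Suc k)
  have *: "((\<lambda>x. inverse (f x)) has_derivative
      (\<lambda>h. - (inverse (f x) * frechet_derivative f (at x) h * inverse (f x)))) (at x)" for x
    using Suc.prems assms by (intro Deriv.has_derivative_inverse Ck_Suc_has_derivative)
  have **: "Ck k (\<lambda>x. inverse (f x))" using Suc Ck_SucD by blast
  have "Ck k (\<lambda>x. (-1) * ((inverse (f x) * frechet_derivative f (at x) b) * inverse (f x)))"
    if "b \<in> Basis" for b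
    using Suc.prems that by (intro Ck_mult ** Ck_const) auto
  then show ?case unfolding Ck_Suc_iff[OF *] by simp
qed

lemma Ck_compose_affine:
  fixes f :: "real \<Rightarrow> real" and l :: "'a::euclidean_space \<Rightarrow> real"
  assumes "bounded_linear l"
  shows "Ck k f \<Longrightarrow> Ck k (\<lambda>p. f (l p + c))"
proof (induction k arbitrary: f)
  case 0
  have "continuous_on UNIV (\<lambda>p. l p + c)"
    by (intro continuous_intros linear_continuous_on assms)
  then show ?case using 0 continuous_on_compose2[of UNIV f UNIV "\<lambda>p. l p + c"] by auto
next
  case (Suc k)
  have f: "(f has_derivative (\<lambda>h. deriv f x * h)) (at x)" for x
  proof -
    have "f differentiable at x"
      using Suc.prems by (simp add: differentiable_on_def)
    then show ?thesis
      using real_differentiable_def DERIV_imp_deriv has_field_derivative_def by fastforce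
  qed
  have l: "((\<lambda>p. l p + c) has_derivative l) (at p)" for p
    using bounded_linear_imp_has_derivative[OF assms] has_derivative_add_const by blast
  have *: "((\<lambda>p. f (l p + c)) has_derivative (\<lambda>h. deriv f (l p + c) * l h)) (at p)" for p
    using has_derivative_compose[OF l f] .
  have "Ck k (deriv f)" using Suc.prems unfolding Ck_Suc_iff[OF f] by simp
  then show ?case unfolding Ck_Suc_iff[OF *] using Suc.IH by (auto intro!: Ck_mult)
qed

section \<open>Smooth functions of one variable\<close>

definition smooth :: "(real \<Rightarrow> real) \<Rightarrow> bool" where
  "smooth f \<longleftrightarrow> (\<forall>k. Ck k f)"

text \<open>Smoothness is coinductive: a family closed under differentiation consists of smooth functions.\<close>

lemma smooth_coinduct:
  assumes "f \<in> S" and "\<And>f. f \<in> S \<Longrightarrow> \<exists>f'\<in>S. \<forall>x. (f has_real_derivative f' x) (at x)"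
  shows "smooth f"
proof -
  have "\<forall>f\<in>S. Ck k f" for k
  proof (induction k)
    case 0
    have "isCont f x" if "f \<in> S" for f x
      using assms(2)[OF that] DERIV_isCont by blast
    then show ?case by (simp add: continuous_at_imp_continuous_on)
  next
    case (Suc k)
    show ?case
    proof
      fix f assume "f \<in> S"
      then obtain f' where "f' \<in> S" and *: "\<And>x. (f has_real_derivative f' x) (at x)"
        using assms(2) by blast
      then show "Ck (Suc k) f" unfolding Ck_Suc_real_iff[OF *] using Suc by blast
    qed
  qed
  then show ?thesis using assms(1) by (simp add: smooth_def)
qed

lemma smooth_has_deriv:
  assumes "smooth f"
  shows "(f has_real_derivative deriv f x) (at x)" and "smooth (deriv f)"
proof -
  show *: "(f has_real_derivative deriv f x) (at x)" for x
  proof -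
    have "Ck 1 f" using assms smooth_def by blast
    then have "f differentiable at x" by (simp add: differentiable_on_def)
    then show ?thesis
      using real_differentiable_def DERIV_imp_deriv by blast
  qed
  show "smooth (deriv f)"
    using assms unfolding smooth_def using Ck_Suc_real_iff[OF *] by blast
qed

lemma smooth_continuous_on: "smooth f \<Longrightarrow> continuous_on S f"
  unfolding smooth_def using Ck_continuous continuous_on_subset by blast

lemma smooth_has_derivI:
  assumes "smooth f" "\<And>x. (f has_real_derivative f' x) (at x)"
  shows "smooth f'"
  using assms Ck_Suc_real_iff[OF assms(2)] unfolding smooth_def by blast

lemma smooth_const [simp]: "smooth (\<lambda>x. c)"
  by (simp add: smooth_def)

lemma smooth_add: "smooth f \<Longrightarrow> smooth g \<Longrightarrow> smooth (\<lambda>x. f x + g x)"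
  by (simp add: smooth_def Ck_add)

lemma smooth_mult: "smooth f \<Longrightarrow> smooth g \<Longrightarrow> smooth (\<lambda>x. f x * g x)"
  by (simp add: smooth_def Ck_mult)

lemma smooth_affine:
  assumes "smooth f"
  shows "smooth (\<lambda>x. f (a * x + c))"
  using assms Ck_compose_affine[OF bounded_linear_mult_right[of a]] by (simp add: smooth_def)

lemma smooth_sin_cos: "smooth (\<lambda>x. A * sin (a * (x - c)) + B * cos (a * (x - c)))"
proof (rule smooth_coinduct)
  show "(\<lambda>x. A * sin (a * (x - c)) + B * cos (a * (x - c)))
     \<in> {(\<lambda>x. A * sin (a * (x - c)) + B * cos (a * (x - c))) |A B. True}" by blast
next
  fix f assume "f \<in> {(\<lambda>x. A * sin (a * (x - c)) + B * cos (a * (x - c))) |A B. True}"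
  then obtain A B where f: "f = (\<lambda>x. A * sin (a * (x - c)) + B * cos (a * (x - c)))" by blast
  have "(f has_real_derivative (- (a * B)) * sin (a * (x - c)) + a * A * cos (a * (x - c))) (at x)" for x
    unfolding f by (auto intro!: derivative_eq_intros)
  then show "\<exists>f'\<in>{(\<lambda>x. A * sin (a * (x - c)) + B * cos (a * (x - c))) |A B. True}.
      \<forall>x. (f has_real_derivative f' x) (at x)"
    by (intro bexI[of _ "\<lambda>x. (- (a * B)) * sin (a * (x - c)) + a * A * cos (a * (x - c))"]) blast+
qed

lemma smooth_sin: "smooth (\<lambda>x. sin (a * (x - c)))"
  using smooth_sin_cos[of 1 a c 0] by simp

lemma smooth_cos: "smooth (\<lambda>x. cos (a * (x - c)))"
  using smooth_sin_cos[of 0 a c 1] by simp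

lemma smooth_cosh: "smooth (\<lambda>x::real. cosh (a * x))"
proof (rule smooth_coinduct)
  show "(\<lambda>x. cosh (a * x)) \<in> (\<lambda>(A, B) x. A * sinh (a * x) + B * cosh (a * x)) ` UNIV"
    by (rule image_eqI[of _ _ "(0, 1)"]) auto
next
  fix f assume "f \<in> (\<lambda>(A, B) x. A * sinh (a * x) + B * cosh (a * x)) ` UNIV"
  then obtain A B where f: "f = (\<lambda>x. A * sinh (a * x) + B * cosh (a * x))" by auto
  have "(f has_real_derivative a * B * sinh (a * x) + a * A * cosh (a * x)) (at x)" for x
    unfolding f by (auto intro!: derivative_eq_intros)
  then show "\<exists>f'\<in>(\<lambda>(A, B) x. A * sinh (a * x) + B * cosh (a * x)) ` UNIV.
      \<forall>x. (f has_real_derivative f' x) (at x)"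
    by (intro bexI[of _ "\<lambda>x. a * B * sinh (a * x) + a * A * cosh (a * x)"])
       (auto intro!: image_eqI[of _ _ "(a * B, a * A)"])
qed

section \<open>Smooth cutoffs\<close>

text \<open>The functions \<open>x\<^sup>-\<^sup>n exp (-1/x)\<close>, extended by zero. The derivative of each is a combination of
  the next two, so smoothness of all of them follows by one induction.\<close>

definition flat :: "nat \<Rightarrow> real \<Rightarrow> real" where
  "flat n x = (if x > 0 then (1 / x) ^ n * exp (- (1 / x)) else 0)"

lemma flat_tendsto_0: "(flat n \<longlongrightarrow> 0) (at 0)"
proof -
  have "((\<lambda>x. x ^ n / exp x) \<longlongrightarrow> (0::real)) at_top"
    by (rule tendsto_power_div_exp_0)
  then have "((\<lambda>x::real. inverse x ^ n / exp (inverse x)) \<longlongrightarrow> 0) (at_right 0)"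
    using filterlim_compose filterlim_inverse_at_top_right by blast
  moreover have "\<forall>\<^sub>F x in at_right 0. inverse x ^ n / exp (inverse x) = flat n x"
    using eventually_at_right_less[of 0]
    by eventually_elim (simp add: flat_def exp_minus divide_inverse power_inverse)
  ultimately have r: "(flat n \<longlongrightarrow> 0) (at_right 0)"
    by (rule Lim_transform_eventually)
  have "\<forall>\<^sub>F x in at_left 0. 0 = flat n x"
    unfolding eventually_at_filter by (simp add: flat_def)
  then have "(flat n \<longlongrightarrow> 0) (at_left 0)"
    by (rule Lim_transform_eventually[OF tendsto_const])
  with r show ?thesis by (simp add: filterlim_at_split)
qed

lemma flat_deriv:
  "(flat n has_real_derivative flat (n + 2) x + (- real n) * flat (n + 1) x) (at x)"
proof (cases "x = 0")
  case True
  have "((\<lambda>h. (flat n h - flat n 0) / (h - 0)) \<longlongrightarrow> 0) (at 0)"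
  proof -
    have "(\<lambda>h. (flat n h - flat n 0) / (h - 0)) = flat (Suc n)"
      by (auto simp: flat_def fun_eq_iff field_simps)
    then show ?thesis using flat_tendsto_0 by simp
  qed
  then show ?thesis using True by (simp add: has_field_derivative_iff flat_def)
next
  case False
  show ?thesis
  proof (cases "x > 0")
    case True
    have "((\<lambda>x. (1 / x) ^ n * exp (- (1 / x))) has_real_derivative
        flat (n + 2) x + (- real n) * flat (n + 1) x) (at x)"
    proof (rule DERIV_cong)
      show "((\<lambda>x. (1 / x) ^ n * exp (- (1 / x))) has_real_derivative
          (of_nat n * ((- 1 / x\<^sup>2) * (1 / x) ^ (n - 1))) * exp (- (1 / x))
          + (1 / x) ^ n * (exp (- (1 / x)) * (1 / x\<^sup>2))) (at x)"
        using True by (auto intro!: derivative_eq_intros simp: power2_eq_square)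
    next
      show "(of_nat n * ((- 1 / x\<^sup>2) * (1 / x) ^ (n - 1))) * exp (- (1 / x))
          + (1 / x) ^ n * (exp (- (1 / x)) * (1 / x\<^sup>2)) = flat (n + 2) x + (- real n) * flat (n + 1) x"
        using True by (cases n) (simp_all add: flat_def power2_eq_square, simp add: divide_simps algebra_simps)
    qed
    then show ?thesis
      by (rule has_field_derivative_transform_within_open[where S="{0<..}"])
        (use True in \<open>auto simp: flat_def\<close>)
  next
    case neg: False
    then have "x < 0" using False by simp
    have "((\<lambda>x. 0) has_real_derivative flat (n + 2) x + (- real n) * flat (n + 1) x) (at x)"
      using \<open>x < 0\<close> by (simp add: flat_def)
    then show ?thesis
      by (rule has_field_derivative_transform_within_open[where S="{..<0}"])
        (use \<open>x < 0\<close> in \<open>auto simp: flat_def\<close>)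
  qed
qed

lemma smooth_flat: "smooth (flat n)"
proof -
  have "Ck k (flat n)" for k n
  proof (induction k arbitrary: n)
    case 0
    have "isCont (flat n) x" for x using flat_deriv DERIV_isCont by blast
    then show ?case by (simp add: continuous_at_imp_continuous_on)
  next
    case (Suc k)
    show ?case unfolding Ck_Suc_real_iff[OF flat_deriv]
      by (intro Ck_add Ck_mult Ck_const Suc)
  qed
  then show ?thesis by (simp add: smooth_def)
qed

text \<open>A smooth transition from \<open>0\<close> to \<open>1\<close> that takes place between \<open>1\<close> and \<open>2\<close>. Starting at \<open>1\<close>
  rather than \<open>0\<close> makes the rescaled cutoffs below vanish near the end points.\<close>

definition step :: "real \<Rightarrow> real" where
  "step x = flat 0 (x - 1) / (flat 0 (x - 1) + flat 0 (2 - x))"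

lemma flat_0_nonneg: "flat 0 x \<ge> 0" "flat 0 x > 0 \<longleftrightarrow> x > 0"
  by (auto simp: flat_def)

lemma step_denominator_pos: "flat 0 (x - 1) + flat 0 (2 - x) > 0"
proof (cases "x > 1")
  case True
  then show ?thesis using flat_0_nonneg(1)[of "2 - x"] flat_0_nonneg(2)[of "x - 1"] by linarith
next
  case False
  then show ?thesis using flat_0_nonneg(1)[of "x - 1"] flat_0_nonneg(2)[of "2 - x"] by linarith
qed

lemma smooth_step: "smooth step"
proof -
  have 1: "smooth (\<lambda>x. flat 0 (x - 1))"
    using smooth_affine[OF smooth_flat[of 0], of 1 "-1"] by simp
  have 2: "smooth (\<lambda>x. flat 0 (2 - x))"
    using smooth_affine[OF smooth_flat[of 0], of "-1" 2] by (simp add: algebra_simps)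
  have "smooth (\<lambda>x. inverse (flat 0 (x - 1) + flat 0 (2 - x)))"
    unfolding smooth_def
  proof (intro allI Ck_inverse)
    show "flat 0 (x - 1) + flat 0 (2 - x) \<noteq> 0" for x
      using step_denominator_pos[of x] by simp
    show "Ck k (\<lambda>x. flat 0 (x - 1) + flat 0 (2 - x))" for k
      using smooth_add[OF 1 2] by (simp add: smooth_def)
  qed
  with 1 have "smooth (\<lambda>x. flat 0 (x - 1) * inverse (flat 0 (x - 1) + flat 0 (2 - x)))"
    by (rule smooth_mult)
  then show ?thesis unfolding step_def[abs_def] by (simp add: divide_inverse)
qed

lemma step_bounds: "0 \<le> step x" "step x \<le> 1"
  using step_denominator_pos[of x] flat_0_nonneg(1)[of "x - 1"] flat_0_nonneg(1)[of "2 - x"]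
  unfolding step_def by (simp_all add: divide_simps)

lemma step_eq_0: "x \<le> 1 \<Longrightarrow> step x = 0"
  by (simp add: step_def flat_def)

lemma step_eq_1: "x \<ge> 2 \<Longrightarrow> step x = 1"
  by (simp add: step_def flat_def)

lemma deriv_step_eq_0:
  assumes "x < 1 \<or> x > 2" shows "deriv step x = 0"
proof -
  have "(step has_real_derivative 0) (at x)"
  proof (cases "x < 1")
    case True
    show ?thesis
      by (rule has_field_derivative_transform_within_open[of "\<lambda>x. 0" 0 x "{..<1}"])
        (use True in \<open>auto simp: step_eq_0\<close>)
  next
    case False
    show ?thesis
      by (rule has_field_derivative_transform_within_open[of "\<lambda>x. 1" 0 x "{2<..}"])
        (use assms False in \<open>auto simp: step_eq_1\<close>)
  qed
  then show ?thesis by (rule DERIV_imp_deriv)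
qed

lemma deriv_step_bounded: obtains S where "S > 0" "\<And>x. \<bar>deriv step x\<bar> \<le> S"
proof -
  have "compact (deriv step ` {1..2})"
    by (intro compact_continuous_image smooth_continuous_on smooth_has_deriv(2) smooth_step) auto
  then obtain S where S: "S > 0" "\<forall>y\<in>deriv step ` {1..2}. norm y \<le> S"
    using compact_imp_bounded bounded_pos by blast
  have "\<bar>deriv step x\<bar> \<le> S" for x
    using S deriv_step_eq_0[of x] by (cases "x < 1 \<or> x > 2") auto
  then show ?thesis using S that by blast
qed

definition cut :: "real \<Rightarrow> real \<Rightarrow> nat \<Rightarrow> real \<Rightarrow> real" where
  "cut a b n x = step (real n * (x - a)) * step (real n * (b - x))"

lemma smooth_cut: "smooth (cut a b n)"
proof -
  have "smooth (\<lambda>x. step (real n * x + (- real n * a)) * step (- real n * x + real n * b))"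
    by (intro smooth_mult smooth_affine smooth_step)
  then show ?thesis by (simp add: cut_def[abs_def] algebra_simps)
qed

lemma cut_bounds: "0 \<le> cut a b n x" "cut a b n x \<le> 1"
  using step_bounds by (auto simp: cut_def intro: mult_le_one)

lemma cut_eq_0:
  assumes "n > 0" "x \<le> a + 1 / real n \<or> b - 1 / real n \<le> x" shows "cut a b n x = 0"
proof -
  have "real n * (x - a) \<le> 1 \<or> real n * (b - x) \<le> 1"
    using assms by (auto simp: field_simps)
  then show ?thesis by (auto simp: cut_def step_eq_0)
qed

lemma cut_eq_0_outside: "x \<notin> {a<..<b} \<Longrightarrow> cut a b n x = 0"
proof -
  assume "x \<notin> {a<..<b}"
  then have "real n * (x - a) \<le> 0 \<or> real n * (b - x) \<le> 0"
    by (auto simp: mult_le_0_iff)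
  then show ?thesis by (auto simp: cut_def step_eq_0)
qed

lemma deriv_cut:
  "(cut a b n has_real_derivative real n * deriv step (real n * (x - a)) * step (real n * (b - x))
     - step (real n * (x - a)) * (real n * deriv step (real n * (b - x)))) (at x)"
proof -
  have 1: "((\<lambda>x. step (real n * (x - a))) has_real_derivative deriv step (real n * (x - a)) * real n) (at x)"
    by (rule DERIV_chain2[OF smooth_has_deriv(1)[OF smooth_step]]) (auto intro!: derivative_eq_intros)
  have 2: "((\<lambda>x. step (real n * (b - x))) has_real_derivative deriv step (real n * (b - x)) * (- real n)) (at x)"
    by (rule DERIV_chain2[OF smooth_has_deriv(1)[OF smooth_step]]) (auto intro!: derivative_eq_intros)
  show ?thesis unfolding cut_def[abs_def]
    by (rule DERIV_mult[OF 1 2, THEN DERIV_cong]) (simp add: algebra_simps)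
qed

text \<open>The derivative of the cutoff lives within \<open>2 / n\<close> of the end points and has size \<open>n\<close> there, so
  its integral stays bounded.\<close>

lemma deriv_cut_eq_0:
  assumes "n > 0" "a + 2 / real n < x" "x < b - 2 / real n"
  shows "deriv (cut a b n) x = 0"
proof -
  have "real n * (x - a) > 2" "real n * (b - x) > 2"
    using assms by (auto simp: field_simps)
  then show ?thesis using DERIV_imp_deriv[OF deriv_cut[of a b n x]] by (simp add: deriv_step_eq_0)
qed

lemma deriv_cut_le:
  assumes "\<And>x. \<bar>deriv step x\<bar> \<le> S"
  shows "\<bar>deriv (cut a b n) x\<bar> \<le> 2 * real n * S"
proof -
  have S: "S \<ge> 0" using assms[of 0] by simp
  have *: "\<bar>deriv step y * step z\<bar> \<le> S" for y z
    using mult_mono[OF assms[of y], of "step z" 1] step_bounds[of z] S by (simp add: abs_mult)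
  have "deriv (cut a b n) x = real n * (deriv step (real n * (x - a)) * step (real n * (b - x)))
      - real n * (deriv step (real n * (b - x)) * step (real n * (x - a)))"
    using DERIV_imp_deriv[OF deriv_cut[of a b n x]] by (simp add: algebra_simps)
  also have "\<bar>\<dots>\<bar> \<le> real n * S + real n * S"
    by (intro order_trans[OF abs_triangle_ineq4] add_mono)
       (simp_all add: abs_mult[of "real n"] mult_left_mono * del: abs_mult)
  finally show ?thesis by (simp add: mult_ac)
qed

lemma cut_eventually_eq_1:
  assumes "x \<in> {a<..<b}"
  shows "\<forall>\<^sub>F n in sequentially. cut a b n x = 1 \<and> deriv (cut a b n) x = 0"
proof -
  have "(\<lambda>n. 2 / real n) \<longlonglongrightarrow> 0" by (rule lim_const_over_n)
  then have "\<forall>\<^sub>F n in sequentially. 2 / real n < min (x - a) (b - x)"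
    using assms by (intro order_tendstoD(2)[of _ 0]) auto
  then show ?thesis using eventually_gt_at_top[of 0]
  proof eventually_elim
    case (elim n)
    then have "real n * (x - a) \<ge> 2" "real n * (b - x) \<ge> 2"
      by (auto simp: field_simps)
    then show ?case using elim deriv_cut_eq_0[of n a x b] by (auto simp: cut_def step_eq_1)
  qed
qed

section \<open>The inner product of square integrable functions\<close>

definition ip :: "'a::euclidean_space set \<Rightarrow> ('a \<Rightarrow> real) \<Rightarrow> ('a \<Rightarrow> real) \<Rightarrow> real" where
  "ip \<Omega> u v = (LINT x:\<Omega>|lborel. u x * v x)"

lemma L2_mult_integrable:
  assumes "u \<in> L2 \<Omega>" "v \<in> L2 \<Omega>"
  shows "set_integrable lborel \<Omega> (\<lambda>x. u x * v x)"
  unfolding set_integrable_def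
proof (rule Bochner_Integration.integrable_bound)
  show "integrable lborel (\<lambda>x. indicator \<Omega> x *\<^sub>R (u x)\<^sup>2 + indicator \<Omega> x *\<^sub>R (v x)\<^sup>2)"
    using assms by (auto simp: L2_def set_integrable_def)
  have "(\<lambda>x. (indicator \<Omega> x *\<^sub>R u x) * (indicator \<Omega> x *\<^sub>R v x)) \<in> borel_measurable lborel"
    using assms by (intro borel_measurable_times) (auto simp: L2_def set_borel_measurable_def)
  then show "(\<lambda>x. indicator \<Omega> x *\<^sub>R (u x * v x)) \<in> borel_measurable lborel"
    by (rule measurable_cong[THEN iffD1, rotated]) (auto simp: indicator_def)
  have "\<bar>u x * v x\<bar> \<le> (u x)\<^sup>2 + (v x)\<^sup>2" for x
  proof -
    have "0 \<le> \<bar>u x\<bar> * \<bar>v x\<bar>" by simp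
    then show ?thesis
      using sum_squares_bound[of "\<bar>u x\<bar>" "\<bar>v x\<bar>"] unfolding abs_mult power2_abs by linarith
  qed
  then show "AE x in lborel. norm (indicator \<Omega> x *\<^sub>R (u x * v x))
      \<le> norm (indicator \<Omega> x *\<^sub>R (u x)\<^sup>2 + indicator \<Omega> x *\<^sub>R (v x)\<^sup>2)"
    by (auto simp: indicator_def)
qed

lemma L2_lin:
  assumes "u \<in> L2 \<Omega>" "v \<in> L2 \<Omega>"
  shows "(\<lambda>x. a * u x + b * v x) \<in> L2 \<Omega>"
proof -
  have "(\<lambda>x. a * (indicator \<Omega> x *\<^sub>R u x) + b * (indicator \<Omega> x *\<^sub>R v x)) \<in> borel_measurable lborel"
    using assms by (intro borel_measurable_add borel_measurable_times)
      (auto simp: L2_def set_borel_measurable_def)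
  then have 1: "set_borel_measurable lborel \<Omega> (\<lambda>x. a * u x + b * v x)"
    unfolding set_borel_measurable_def
    by (rule measurable_cong[THEN iffD1, rotated]) (auto simp: indicator_def)
  have "set_integrable lborel \<Omega> (\<lambda>x. a\<^sup>2 * (u x)\<^sup>2 + 2 * a * b * (u x * v x) + b\<^sup>2 * (v x)\<^sup>2)"
    using assms L2_mult_integrable[OF assms]
    by (intro set_integral_add(1) set_integrable_mult_right) (auto simp: L2_def)
  also have "(\<lambda>x. a\<^sup>2 * (u x)\<^sup>2 + 2 * a * b * (u x * v x) + b\<^sup>2 * (v x)\<^sup>2)
      = (\<lambda>x. (a * u x + b * v x)\<^sup>2)"
    by (auto simp: power2_eq_square algebra_simps)
  finally show ?thesis using 1 by (simp add: L2_def)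
qed

lemma L2_zero: "(\<lambda>x. 0) \<in> L2 \<Omega>"
  by (simp add: L2_def set_borel_measurable_def set_integrable_def)

lemma L2_sum:
  assumes "finite F" "\<And>i. i \<in> F \<Longrightarrow> u i \<in> L2 \<Omega>"
  shows "(\<lambda>x. \<Sum>i\<in>F. c i * u i x) \<in> L2 \<Omega>"
  using assms
proof (induction F)
  case (insert j F)
  then show ?case using L2_lin[of "u j" \<Omega> "\<lambda>x. \<Sum>i\<in>F. c i * u i x" "c j" 1] by simp
qed (simp add: L2_zero)

lemma L2_mult_bounded:
  assumes u: "u \<in> L2 \<Omega>" and g: "g \<in> borel_measurable borel" and "\<And>x. x \<in> \<Omega> \<Longrightarrow> \<bar>g x\<bar> \<le> C"
  shows "(\<lambda>x. u x * g x) \<in> L2 \<Omega>"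
proof -
  have "(\<lambda>x. (indicator \<Omega> x *\<^sub>R u x) * g x) \<in> borel_measurable lborel"
    using u g by (intro borel_measurable_times) (auto simp: L2_def set_borel_measurable_def)
  then have 1: "set_borel_measurable lborel \<Omega> (\<lambda>x. u x * g x)"
    by (simp add: set_borel_measurable_def mult_ac)
  have "integrable lborel (\<lambda>x. indicator \<Omega> x *\<^sub>R (u x * g x)\<^sup>2)"
  proof (rule Bochner_Integration.integrable_bound)
    show "integrable lborel (\<lambda>x. C\<^sup>2 * (indicator \<Omega> x *\<^sub>R (u x)\<^sup>2))"
      using u by (auto simp: L2_def set_integrable_def)
    have "(\<lambda>x. (indicator \<Omega> x *\<^sub>R (u x * g x))\<^sup>2) \<in> borel_measurable lborel"
      using 1 by (intro borel_measurable_power) (simp add: set_borel_measurable_def)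
    then show "(\<lambda>x. indicator \<Omega> x *\<^sub>R (u x * g x)\<^sup>2) \<in> borel_measurable lborel"
      by (rule measurable_cong[THEN iffD1, rotated]) (auto simp: indicator_def)
    have "(u x * g x)\<^sup>2 \<le> C\<^sup>2 * (u x)\<^sup>2" if "x \<in> \<Omega>" for x
      using assms(3)[OF that] abs_le_square_iff[of "g x" C]
      by (auto simp: power_mult_distrib mult.commute intro!: mult_right_mono)
    then show "AE x in lborel. norm (indicator \<Omega> x *\<^sub>R (u x * g x)\<^sup>2)
        \<le> norm (C\<^sup>2 * (indicator \<Omega> x *\<^sub>R (u x)\<^sup>2))"
      by (auto simp: indicator_def)
  qed
  with 1 show ?thesis by (simp add: L2_def set_integrable_def)
qed

lemma L2_one: "\<Omega> \<in> sets borel \<Longrightarrow> emeasure lborel \<Omega> < \<infinity> \<Longrightarrow> (\<lambda>x. 1) \<in> L2 \<Omega>"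
  by (simp add: L2_def set_borel_measurable_def set_integrable_def integrable_real_indicator)

lemma L2_bounded:
  assumes "\<Omega> \<in> sets borel" "emeasure lborel \<Omega> < \<infinity>"
    and "g \<in> borel_measurable borel" "\<And>x. x \<in> \<Omega> \<Longrightarrow> \<bar>g x\<bar> \<le> C"
  shows "g \<in> L2 \<Omega>"
  using L2_mult_bounded[OF L2_one[OF assms(1,2)] assms(3,4)] by simp

lemma L2_integrable:
  assumes "\<Omega> \<in> sets borel" "emeasure lborel \<Omega> < \<infinity>" "u \<in> L2 \<Omega>"
  shows "set_integrable lborel \<Omega> u"
  using L2_mult_integrable[OF assms(3) L2_one[OF assms(1,2)]] by simp

lemma ip_commute: "ip \<Omega> u v = ip \<Omega> v u"
  by (simp add: ip_def mult.commute)

lemma ip_nonneg: "0 \<le> ip \<Omega> u u"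
  unfolding ip_def set_lebesgue_integral_def by (intro Bochner_Integration.integral_nonneg) (auto simp: indicator_def)

lemma ip_lin:
  assumes "u \<in> L2 \<Omega>" "v \<in> L2 \<Omega>" "w \<in> L2 \<Omega>"
  shows "ip \<Omega> (\<lambda>x. a * u x + b * v x) w = a * ip \<Omega> u w + b * ip \<Omega> v w"
proof -
  have "ip \<Omega> (\<lambda>x. a * u x + b * v x) w = (LINT x:\<Omega>|lborel. a * (u x * w x) + b * (v x * w x))"
    by (simp add: ip_def algebra_simps)
  also have "\<dots> = a * ip \<Omega> u w + b * ip \<Omega> v w"
    unfolding ip_def using assms by (simp add: set_integral_add L2_mult_integrable)
  finally show ?thesis .
qed

lemma ip_sum:
  assumes "finite F" "\<And>i. i \<in> F \<Longrightarrow> u i \<in> L2 \<Omega>" "w \<in> L2 \<Omega>"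
  shows "ip \<Omega> (\<lambda>x. \<Sum>i\<in>F. c i * u i x) w = (\<Sum>i\<in>F. c i * ip \<Omega> (u i) w)"
  using assms(1,2)
proof (induction F)
  case (insert j F)
  have "ip \<Omega> (\<lambda>x. c j * u j x + 1 * (\<Sum>i\<in>F. c i * u i x)) w
      = c j * ip \<Omega> (u j) w + 1 * ip \<Omega> (\<lambda>x. \<Sum>i\<in>F. c i * u i x) w"
    using insert assms(3) by (intro ip_lin L2_sum) auto
  then show ?case using insert by simp
qed (simp add: ip_def set_lebesgue_integral_def)

lemma ip_cong_AE:
  assumes "u \<in> L2 \<Omega>" "u' \<in> L2 \<Omega>" "w \<in> L2 \<Omega>" "w' \<in> L2 \<Omega>"
    and "AE x in lborel. x \<in> \<Omega> \<longrightarrow> u x = u' x" "AE x in lborel. x \<in> \<Omega> \<longrightarrow> w x = w' x"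
  shows "ip \<Omega> u w = ip \<Omega> u' w'"
  unfolding ip_def set_lebesgue_integral_def
proof (rule integral_cong_AE)
  show "(\<lambda>x. indicator \<Omega> x *\<^sub>R (u x * w x)) \<in> borel_measurable lborel"
    "(\<lambda>x. indicator \<Omega> x *\<^sub>R (u' x * w' x)) \<in> borel_measurable lborel"
    using L2_mult_integrable[OF assms(1,3)] L2_mult_integrable[OF assms(2,4)]
    by (auto simp: set_integrable_def dest: borel_measurable_integrable)
  show "AE x in lborel. indicator \<Omega> x *\<^sub>R (u x * w x) = indicator \<Omega> x *\<^sub>R (u' x * w' x)"
    using assms(5,6) by eventually_elim (auto simp: indicator_def)
qed

lemma ip_self_eq_0:
  assumes "u \<in> L2 \<Omega>" "ip \<Omega> u u = 0"
  shows "AE x in lborel. x \<in> \<Omega> \<longrightarrow> u x = 0"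
proof -
  have "integrable lborel (\<lambda>x. indicator \<Omega> x *\<^sub>R (u x * u x))"
    using L2_mult_integrable[OF assms(1,1)] by (simp add: set_integrable_def)
  then have "AE x in lborel. indicator \<Omega> x *\<^sub>R (u x * u x) = 0"
    using assms(2) integral_nonneg_eq_0_iff_AE[of lborel "\<lambda>x. indicator \<Omega> x *\<^sub>R (u x * u x)"]
    by (auto simp: ip_def set_lebesgue_integral_def indicator_def)
  then show ?thesis by eventually_elim (auto simp: indicator_def)
qed

text \<open>Dominated convergence in the form in which most limits below are taken: the second factor
  converges pointwise and boundedly.\<close>

lemma ip_tendsto:
  assumes "\<Omega> \<in> sets borel" "emeasure lborel \<Omega> < \<infinity>" and u: "u \<in> L2 \<Omega>"
    and g: "\<And>n::nat. g n \<in> borel_measurable borel" "h \<in> borel_measurable borel"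
    and bound: "\<And>n x. x \<in> \<Omega> \<Longrightarrow> \<bar>g n x\<bar> \<le> C"
    and lim: "\<And>x. x \<in> \<Omega> \<Longrightarrow> (\<lambda>n. g n x) \<longlonglongrightarrow> h x"
  shows "(\<lambda>n. ip \<Omega> u (g n)) \<longlonglongrightarrow> ip \<Omega> u h"
  unfolding ip_def set_lebesgue_integral_def
proof (rule integral_dominated_convergence)
  have m: "(\<lambda>x. indicator \<Omega> x *\<^sub>R (u x * v x)) \<in> borel_measurable lborel"
    if "v \<in> borel_measurable borel" for v
  proof -
    have "(\<lambda>x. (indicator \<Omega> x *\<^sub>R u x) * v x) \<in> borel_measurable lborel"
      using u that by (intro borel_measurable_times) (auto simp: L2_def set_borel_measurable_def)
    then show ?thesis by (simp add: mult_ac)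
  qed
  show "(\<lambda>x. indicator \<Omega> x *\<^sub>R (u x * h x)) \<in> borel_measurable lborel"
    "\<And>n. (\<lambda>x. indicator \<Omega> x *\<^sub>R (u x * g n x)) \<in> borel_measurable lborel"
    using m g by auto
  show "integrable lborel (\<lambda>x. C * norm (indicator \<Omega> x *\<^sub>R u x))"
    using L2_integrable[OF assms(1,2) u] unfolding set_integrable_def
    by (intro integrable_mult_right integrable_norm)
  show "AE x in lborel. (\<lambda>n. indicator \<Omega> x *\<^sub>R (u x * g n x)) \<longlonglongrightarrow> indicator \<Omega> x *\<^sub>R (u x * h x)"
    using lim by (intro AE_I2) (auto simp: indicator_def intro!: tendsto_intros)
  show "AE x in lborel. norm (indicator \<Omega> x *\<^sub>R (u x * g n x)) \<le> C * norm (indicator \<Omega> x *\<^sub>R u x)" for n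
  proof (rule AE_I2)
    fix x
    have "\<bar>u x\<bar> * \<bar>g n x\<bar> \<le> C * \<bar>u x\<bar>" if "x \<in> \<Omega>"
      using mult_right_mono[OF bound[OF that], of "\<bar>u x\<bar>" n] by (simp add: mult.commute)
    then show "norm (indicator \<Omega> x *\<^sub>R (u x * g n x)) \<le> C * norm (indicator \<Omega> x *\<^sub>R u x)"
      by (auto simp: indicator_def abs_mult)
  qed
qed

section \<open>Weak derivatives on a rectangle\<close>

lemma Basis_real_prod: "Basis = {(1::real, 0::real), (0, 1)}"
  by (auto simp: Basis_prod_def)

lemma tensor_has_derivative:
  assumes "smooth f" "smooth g"
  shows "((\<lambda>p::real\<times>real. f (fst p) * g (snd p)) has_derivative
    (\<lambda>h. deriv f (fst p) * g (snd p) * fst h + f (fst p) * deriv g (snd p) * snd h)) (at p)"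
proof -
  have f: "((\<lambda>p. f (fst p)) has_derivative (\<lambda>h. deriv f (fst p) * fst h)) (at p)"
    by (rule has_derivative_compose[OF has_derivative_fst[OF has_derivative_ident]])
      (use smooth_has_deriv(1)[OF assms(1)] in \<open>auto simp: has_field_derivative_def\<close>)
  have g: "((\<lambda>p. g (snd p)) has_derivative (\<lambda>h. deriv g (snd p) * snd h)) (at p)"
    by (rule has_derivative_compose[OF has_derivative_snd[OF has_derivative_ident]])
      (use smooth_has_deriv(1)[OF assms(2)] in \<open>auto simp: has_field_derivative_def\<close>)
  show ?thesis
    by (rule has_derivative_eq_rhs[OF has_derivative_mult[OF f g]]) (auto simp: algebra_simps)
qed

lemma tensor_partial:
  assumes "smooth f" "smooth g"
  shows "frechet_derivative (\<lambda>p. f (fst p) * g (snd p)) (at p) (1, 0) = deriv f (fst p) * g (snd p)"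
    and "frechet_derivative (\<lambda>p. f (fst p) * g (snd p)) (at p) (0, 1) = f (fst p) * deriv g (snd p)"
  unfolding frechet_derivative_at[OF tensor_has_derivative[OF assms, of p], symmetric] by simp_all

lemma Ck_tensor:
  assumes "smooth f" "smooth g"
  shows "Ck k (\<lambda>p::real\<times>real. f (fst p) * g (snd p))"
  using assms Ck_compose_affine[OF bounded_linear_fst, of k f 0] Ck_compose_affine[OF bounded_linear_snd, of k g 0]
  by (intro Ck_mult) (auto simp: smooth_def)

text \<open>The support is enclosed in a compact subinterval, so that products are test functions.\<close>

definition supported_in :: "(real \<Rightarrow> real) \<Rightarrow> real \<Rightarrow> real \<Rightarrow> bool" where
  "supported_in f a b \<longleftrightarrow> (\<exists>a' b'. {a'..b'} \<subseteq> {a<..<b} \<and> (\<forall>x. x \<notin> {a'..b'} \<longrightarrow> f x = 0))"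

lemma supported_in_mono: "supported_in f a' b' \<Longrightarrow> {a'<..<b'} \<subseteq> {a<..<b} \<Longrightarrow> supported_in f a b"
  unfolding supported_in_def by (meson order_trans)

lemma supported_in_cut:
  assumes "n > 0"
  shows "supported_in (\<lambda>x. g x * cut a b n x) a b"
  unfolding supported_in_def
proof (intro exI conjI allI impI)
  have "1 / real n > 0" using assms by simp
  then show "{a + 1 / real n..b - 1 / real n} \<subseteq> {a<..<b}"
    unfolding subset_iff atLeastAtMost_iff greaterThanLessThan_iff by (intro allI impI; linarith)
  show "g x * cut a b n x = 0" if "x \<notin> {a + 1 / real n..b - 1 / real n}" for x
    using that cut_eq_0[OF assms, of x a b] by auto
qed

lemma compact_subset: "compact K \<Longrightarrow> closed A \<Longrightarrow> A \<subseteq> K \<Longrightarrow> compact A"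
  by (metis compact_Int_closed inf.absorb_iff2)

lemma tensor_test_function:
  assumes "smooth f" "smooth g" "supported_in f a b" "supported_in g c d"
  shows "(\<lambda>p. f (fst p) * g (snd p)) \<in> test_functions ({a<..<b} \<times> {c<..<d})"
proof -
  obtain a' b' where f: "{a'..b'} \<subseteq> {a<..<b}" "\<And>x. x \<notin> {a'..b'} \<Longrightarrow> f x = 0"
    using assms(3) unfolding supported_in_def by blast
  obtain c' d' where g: "{c'..d'} \<subseteq> {c<..<d}" "\<And>x. x \<notin> {c'..d'} \<Longrightarrow> g x = 0"
    using assms(4) unfolding supported_in_def by blast
  have K: "compact ({a'..b'} \<times> {c'..d'})" by (intro compact_Times compact_Icc)
  have sub: "closure {p. f (fst p) * g (snd p) \<noteq> 0} \<subseteq> {a'..b'} \<times> {c'..d'}"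
  proof (intro closure_minimal compact_imp_closed K subsetI)
    fix p assume "p \<in> {p. f (fst p) * g (snd p) \<noteq> 0}"
    then have "f (fst p) \<noteq> 0" "g (snd p) \<noteq> 0" by auto
    then show "p \<in> {a'..b'} \<times> {c'..d'}" unfolding mem_Times_iff using f(2) g(2) by blast
  qed
  then have "compact (closure {p. f (fst p) * g (snd p) \<noteq> 0})"
    using K compact_subset closed_closure by blast
  moreover have "closure {p. f (fst p) * g (snd p) \<noteq> 0} \<subseteq> {a<..<b} \<times> {c<..<d}"
    using sub f(1) g(1) by blast
  ultimately show ?thesis using Ck_tensor[OF assms(1,2)] unfolding test_functions_def by auto
qed

lemma rectangle_measure:
  "{a<..<b} \<times> {c<..<d} \<in> sets (borel :: (real\<times>real) measure)"
  "emeasure lborel ({a<..<b} \<times> {c<..<d} :: (real\<times>real) set) < \<infinity>"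
proof -
  have *: "{a<..<b} \<times> {c<..<d} = box (a, c) (b, d)"
    by (auto simp: mem_box Basis_real_prod)
  show "{a<..<b} \<times> {c<..<d} \<in> sets (borel :: (real\<times>real) measure)"
    "emeasure lborel ({a<..<b} \<times> {c<..<d} :: (real\<times>real) set) < \<infinity>"
    unfolding * using emeasure_lborel_box_finite by auto
qed

lemma smooth_measurable: "smooth f \<Longrightarrow> f \<in> borel_measurable borel"
  using smooth_continuous_on borel_measurable_continuous_onI by blast

lemma tensor_measurable:
  assumes "f \<in> borel_measurable borel" "g \<in> borel_measurable borel"
  shows "(\<lambda>p. f (fst p) * g (snd p) :: real) \<in> borel_measurable (borel :: (real\<times>real) measure)"
  using assms by (intro borel_measurable_times measurable_compose[OF _ assms(1)] measurable_compose[OF _ assms(2)])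
    (auto simp: borel_prod[symmetric])

text \<open>The fundamental lemma of the calculus of variations. Cutoffs of a smaller rectangle converge
  boundedly to its indicator function, so that the integral over each open box vanishes; open
  boxes are stable under intersection and generate the Borel sets.\<close>

lemma test_functions_separate_L2:
  fixes a b c d :: real
  defines "\<Omega> \<equiv> {a<..<b} \<times> {c<..<d}"
  assumes h: "h \<in> L2 \<Omega>" and 0: "\<And>\<phi>. \<phi> \<in> test_functions \<Omega> \<Longrightarrow> ip \<Omega> h \<phi> = 0"
  shows "AE x in lborel. x \<in> \<Omega> \<longrightarrow> h x = 0"
proof -
  have \<Omega>: "\<Omega> \<in> sets borel" "emeasure lborel \<Omega> < \<infinity>"
    unfolding \<Omega>_def by (rule rectangle_measure)+
  define f where "f x = indicator \<Omega> x *\<^sub>R h x" for x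
  have f: "integrable lborel f"
    using L2_integrable[OF \<Omega> h] by (simp add: set_integrable_def f_def[abs_def])
  have box: "(LINT x:box u v|lborel. f x) = 0" for u v
  proof -
    define a' b' c' d' where "a' = max a (fst u)" and "b' = min b (fst v)"
      and "c' = max c (snd u)" and "d' = min d (snd v)"
    define \<phi> where "\<phi> n p = (1 * cut a' b' (Suc n) (fst p)) * (1 * cut c' d' (Suc n) (snd p))" for n p
    have int: "\<Omega> \<inter> box u v = {a'<..<b'} \<times> {c'<..<d'}"
      unfolding \<Omega>_def by (cases u; cases v) (auto simp: mem_box Basis_real_prod a'_def b'_def c'_def d'_def)
    have "\<phi> n \<in> test_functions \<Omega>" for n
      unfolding \<phi>_def \<Omega>_def
    proof (rule tensor_test_function)
      show "smooth (\<lambda>x. 1 * cut a' b' (Suc n) x)" "smooth (\<lambda>x. 1 * cut c' d' (Suc n) x)"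
        using smooth_cut by simp_all
      show "supported_in (\<lambda>x. 1 * cut a' b' (Suc n) x) a b"
        by (rule supported_in_mono[OF supported_in_cut]) (auto simp: a'_def b'_def)
      show "supported_in (\<lambda>x. 1 * cut c' d' (Suc n) x) c d"
        by (rule supported_in_mono[OF supported_in_cut]) (auto simp: c'_def d'_def)
    qed
    then have "(\<lambda>n. ip \<Omega> h (\<phi> n)) = (\<lambda>n. 0)" using 0 by blast
    moreover have "(\<lambda>n. ip \<Omega> h (\<phi> n)) \<longlonglongrightarrow> ip \<Omega> h (indicator (box u v))"
    proof (rule ip_tendsto[OF \<Omega> h, where C=1])
      show "\<phi> n \<in> borel_measurable borel" for n
        unfolding \<phi>_def[abs_def] using smooth_cut by (intro tensor_measurable) (simp_all add: smooth_measurable)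
      show "\<bar>\<phi> n x\<bar> \<le> 1" for n x
        by (auto simp: \<phi>_def abs_mult cut_bounds intro!: mult_le_one)
      fix p assume p: "p \<in> \<Omega>"
      show "(\<lambda>n. \<phi> n p) \<longlonglongrightarrow> indicator (box u v) p"
      proof (cases "p \<in> box u v")
        case True
        then have "p \<in> {a'<..<b'} \<times> {c'<..<d'}" using p int by blast
        then have "fst p \<in> {a'<..<b'}" "snd p \<in> {c'<..<d'}" by (auto simp: mem_Times_iff)
        then have "\<forall>\<^sub>F n in sequentially. cut a' b' n (fst p) = 1"
          "\<forall>\<^sub>F n in sequentially. cut c' d' n (snd p) = 1"
          using cut_eventually_eq_1[of "fst p" a' b'] cut_eventually_eq_1[of "snd p" c' d']
          by (simp_all add: eventually_conj_iff)
        then have "\<forall>\<^sub>F n in sequentially. cut a' b' (Suc n) (fst p) = 1"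
          "\<forall>\<^sub>F n in sequentially. cut c' d' (Suc n) (snd p) = 1"
          by (simp_all add: eventually_sequentially_Suc[where P="\<lambda>n. cut a' b' n (fst p) = 1"]
              eventually_sequentially_Suc[where P="\<lambda>n. cut c' d' n (snd p) = 1"])
        then have "\<forall>\<^sub>F n in sequentially. indicator (box u v) p = \<phi> n p"
          by eventually_elim (use True in \<open>simp add: \<phi>_def\<close>)
        then show ?thesis by (rule Lim_transform_eventually[OF tendsto_const])
      next
        case False
        then have "p \<notin> {a'<..<b'} \<times> {c'<..<d'}" using int by blast
        then have "\<phi> n p = 0" for n
          using cut_eq_0_outside[of "fst p" a' b' "Suc n"] cut_eq_0_outside[of "snd p" c' d' "Suc n"]
          unfolding \<phi>_def mem_Times_iff by fastforce
        then show ?thesis using False by simp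
      qed
    qed auto
    ultimately have "ip \<Omega> h (indicator (box u v)) = 0"
      by (simp add: LIMSEQ_const_iff)
    then show ?thesis
      by (simp add: ip_def set_lebesgue_integral_def f_def mult_ac)
  qed
  have all: "(LINT x|lborel. f x) = 0"
  proof -
    have "(LINT x:box (a, c) (b, d)|lborel. f x) = (LINT x|lborel. f x)"
      unfolding set_lebesgue_integral_def
      by (intro Bochner_Integration.integral_cong refl)
        (auto simp: f_def \<Omega>_def indicator_def mem_box Basis_real_prod mem_Times_iff)
    then show ?thesis using box by simp
  qed
  have borel: "(LINT x:A|lborel. f x) = 0" if "A \<in> sets borel" for A
  proof -
    have si: "set_integrable lborel A f" if "A \<in> sets borel" for A
      using f integrable_mult_indicator[of A lborel f] that by (simp add: set_integrable_def)
    have *: "Int_stable (range (\<lambda>(a, b). box a b :: (real\<times>real) set))"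
      by (auto simp: Int_stable_def box_Int_box)
    have gen: "sets borel = sigma_sets UNIV (range (\<lambda>(a, b). box a b :: (real\<times>real) set))"
      by (subst borel_eq_box) simp
    have A: "A \<in> sigma_sets UNIV (range (\<lambda>(a, b). box a b :: (real\<times>real) set))"
      using that gen by simp
    have sub: "range (\<lambda>(a, b). box a b :: (real\<times>real) set) \<subseteq> Pow UNIV"
      by simp
    from * sub A show ?thesis
    proof (induction rule: sigma_sets_induct_disjoint)
      case (basic A)
      then show ?case using box by auto
    next
      case (compl A)
      have "A \<in> sets borel" using compl(1) gen by simp
      then have "(LINT x:A|lborel. f x) + (LINT x:UNIV - A|lborel. f x) = (LINT x:A \<union> (UNIV - A)|lborel. f x)"
        using si by (intro set_integral_Un[symmetric]) auto
      also have "\<dots> = 0" using all by (simp add: set_lebesgue_integral_def)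
      finally show ?case using compl by simp
    next
      case (union A)
      have A: "A i \<in> sets borel" for i using union(2) gen by auto
      have "(LINT x:(\<Union>i. A i)|lborel. f x) = (\<Sum>i. (LINT x:A i|lborel. f x))"
        using A union(1) si by (intro lebesgue_integral_countable_add) (auto simp: disjoint_family_on_def)
      then show ?case using union by simp
    qed (simp add: set_lebesgue_integral_def)
  qed
  have fm: "f \<in> borel_measurable borel" using borel_measurable_integrable[OF f] by simp
  have part: "AE x in lborel. s * f x \<le> 0" for s :: real
  proof -
    define A where "A = {x. s * f x > 0}"
    have "A \<in> sets borel" unfolding A_def using fm by measurable
    then have "(LINT x|lborel. indicator A x *\<^sub>R (s * f x)) = 0"
      "integrable lborel (\<lambda>x. indicator A x *\<^sub>R (s * f x))"
      using borel[of A] f integrable_mult_indicator[of A lborel "\<lambda>x. s * f x"]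
      by (auto simp: set_lebesgue_integral_def mult.left_commute)
    moreover have "indicator A x *\<^sub>R (s * f x) \<ge> 0" for x
      by (auto simp: A_def indicator_def)
    ultimately have "AE x in lborel. indicator A x *\<^sub>R (s * f x) = 0"
      by (subst (asm) integral_nonneg_eq_0_iff_AE) auto
    then show ?thesis by eventually_elim (auto simp: A_def indicator_def split: if_splits)
  qed
  show ?thesis using part[of 1] part[of "-1"]
    by eventually_elim (auto simp: f_def)
qed

lemma test_function_continuous: "\<phi> \<in> test_functions \<Omega> \<Longrightarrow> continuous_on UNIV \<phi>"
  unfolding test_functions_def using Ck_continuous by blast

lemma test_function_bounded:
  assumes "\<phi> \<in> test_functions \<Omega>"
  obtains C where "\<And>x. \<bar>\<phi> x\<bar> \<le> C"
proof -
  let ?K = "closure {x. \<phi> x \<noteq> 0}"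
  have "compact (\<phi> ` ?K)"
    using assms test_function_continuous[OF assms] continuous_on_subset
    by (intro compact_continuous_image) (auto simp: test_functions_def)
  then obtain C where C: "C > 0" "\<forall>y\<in>\<phi> ` ?K. norm y \<le> C"
    using compact_imp_bounded bounded_pos by blast
  have "\<bar>\<phi> x\<bar> \<le> C" for x
    using C closure_subset[of "{x. \<phi> x \<noteq> 0}"] by (cases "\<phi> x = 0") auto
  then show ?thesis using that by blast
qed

lemma test_function_L2:
  assumes "\<Omega> \<in> sets borel" "emeasure lborel \<Omega> < \<infinity>" "\<phi> \<in> test_functions \<Omega>"
  shows "\<phi> \<in> L2 \<Omega>"
proof -
  obtain C where "\<And>x. \<bar>\<phi> x\<bar> \<le> C" using test_function_bounded[OF assms(3)] by blast
  then show ?thesis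
    using assms(1,2) test_function_continuous[OF assms(3)] borel_measurable_continuous_onI
    by (intro L2_bounded) auto
qed

lemma test_function_partial:
  assumes "\<phi> \<in> test_functions \<Omega>" "b \<in> Basis"
  shows "(\<lambda>x. frechet_derivative \<phi> (at x) b) \<in> test_functions \<Omega>"
proof -
  have "closure {x. frechet_derivative \<phi> (at x) b \<noteq> 0} \<subseteq> closure {x. \<phi> x \<noteq> 0}"
  proof (rule closure_minimal)
    have "frechet_derivative \<phi> (at x) b = 0" if "x \<notin> closure {x. \<phi> x \<noteq> 0}" for x
    proof -
      have "(\<phi> has_derivative (\<lambda>h. 0)) (at x)"
        by (rule has_derivative_transform_within_open[of "\<lambda>x. 0" "\<lambda>h. 0" x UNIV "- closure {x. \<phi> x \<noteq> 0}"])
          (use that closure_subset[of "{x. \<phi> x \<noteq> 0}"] in auto)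
      then show ?thesis by (simp add: frechet_derivative_at[symmetric])
    qed
    then show "{x. frechet_derivative \<phi> (at x) b \<noteq> 0} \<subseteq> closure {x. \<phi> x \<noteq> 0}" by auto
  qed simp
  moreover have "Ck k (\<lambda>x. frechet_derivative \<phi> (at x) b)" for k
  proof -
    have "Ck (Suc k) \<phi>" using assms(1) unfolding test_functions_def by blast
    then show ?thesis using assms(2) by simp
  qed
  ultimately show ?thesis
    using assms(1) compact_subset[OF _ closed_closure] unfolding test_functions_def by blast
qed

lemma has_weak_partial_iff:
  "has_weak_partial \<Omega> b u g \<longleftrightarrow>
    (\<forall>\<phi>\<in>test_functions \<Omega>. ip \<Omega> u (\<lambda>x. frechet_derivative \<phi> (at x) b) = - ip \<Omega> g \<phi>)"
  by (simp add: has_weak_partial_def ip_def)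

lemma has_weak_partial_unique:
  fixes a b c d :: real
  defines "\<Omega> \<equiv> {a<..<b} \<times> {c<..<d}"
  assumes "has_weak_partial \<Omega> e u g" "has_weak_partial \<Omega> e u g'" "g \<in> L2 \<Omega>" "g' \<in> L2 \<Omega>"
  shows "AE x in lborel. x \<in> \<Omega> \<longrightarrow> g x = g' x"
proof -
  have "AE x in lborel. x \<in> \<Omega> \<longrightarrow> 1 * g x + (-1) * g' x = 0"
    unfolding \<Omega>_def
  proof (rule test_functions_separate_L2)
    fix \<phi> assume \<phi>: "\<phi> \<in> test_functions ({a<..<b} \<times> {c<..<d})"
    then have "\<phi> \<in> L2 \<Omega>" unfolding \<Omega>_def by (rule test_function_L2[OF rectangle_measure])
    then show "ip ({a<..<b} \<times> {c<..<d}) (\<lambda>x. 1 * g x + (-1) * g' x) \<phi> = 0"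
      using assms(2-5) \<phi> unfolding \<Omega>_def by (subst ip_lin) (simp_all add: has_weak_partial_iff)
  next
    show "(\<lambda>x. 1 * g x + (-1) * g' x) \<in> L2 ({a<..<b} \<times> {c<..<d})"
      using assms(4,5) unfolding \<Omega>_def by (rule L2_lin)
  qed
  then show ?thesis by eventually_elim auto
qed

text \<open>The representative is chosen arbitrarily, so its properties rest on uniqueness.\<close>

lemma weak_partial_spec:
  fixes a b c d :: real
  defines "\<Omega> \<equiv> {a<..<b} \<times> {c<..<d}"
  assumes "has_weak_partial \<Omega> e u g" "g \<in> L2 \<Omega>"
  shows "weak_partial \<Omega> e u \<in> L2 \<Omega>" "has_weak_partial \<Omega> e u (weak_partial \<Omega> e u)"
    "AE x in lborel. x \<in> \<Omega> \<longrightarrow> weak_partial \<Omega> e u x = g x"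
proof -
  have "weak_partial \<Omega> e u \<in> L2 \<Omega> \<and> has_weak_partial \<Omega> e u (weak_partial \<Omega> e u)"
    unfolding weak_partial_def by (rule someI[of _ g]) (use assms in auto)
  then show "weak_partial \<Omega> e u \<in> L2 \<Omega>" "has_weak_partial \<Omega> e u (weak_partial \<Omega> e u)" by auto
  then show "AE x in lborel. x \<in> \<Omega> \<longrightarrow> weak_partial \<Omega> e u x = g x"
    using assms has_weak_partial_unique by (auto simp: \<Omega>_def)
qed

lemma has_weak_partial_cong_AE:
  fixes a b c d :: real
  defines "\<Omega> \<equiv> {a<..<b} \<times> {c<..<d}"
  assumes "has_weak_partial \<Omega> e u g" "e \<in> Basis" "u \<in> L2 \<Omega>" "u' \<in> L2 \<Omega>" "AE x in lborel. x \<in> \<Omega> \<longrightarrow> u x = u' x"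
  shows "has_weak_partial \<Omega> e u' g"
proof -
  have "ip \<Omega> u' (\<lambda>x. frechet_derivative \<phi> (at x) e) = ip \<Omega> u (\<lambda>x. frechet_derivative \<phi> (at x) e)"
    if "\<phi> \<in> test_functions \<Omega>" for \<phi>
  proof -
    have "(\<lambda>x. frechet_derivative \<phi> (at x) e) \<in> L2 \<Omega>"
      using test_function_partial[OF that assms(3)] unfolding \<Omega>_def by (rule test_function_L2[OF rectangle_measure])
    then show ?thesis using assms(4-6) by (intro ip_cong_AE) (auto elim: eventually_mono)
  qed
  then show ?thesis using assms(2) by (simp add: has_weak_partial_iff)
qed

lemma has_weak_partial_lin:
  fixes a b c d :: real
  defines "\<Omega> \<equiv> {a<..<b} \<times> {c<..<d}"
  assumes "has_weak_partial \<Omega> e u g" "has_weak_partial \<Omega> e v h" "e \<in> Basis"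
    "u \<in> L2 \<Omega>" "v \<in> L2 \<Omega>" "g \<in> L2 \<Omega>" "h \<in> L2 \<Omega>"
  shows "has_weak_partial \<Omega> e (\<lambda>x. s * u x + t * v x) (\<lambda>x. s * g x + t * h x)"
  unfolding has_weak_partial_iff
proof
  fix \<phi> assume \<phi>: "\<phi> \<in> test_functions \<Omega>"
  have "\<phi> \<in> L2 \<Omega>" "(\<lambda>x. frechet_derivative \<phi> (at x) e) \<in> L2 \<Omega>"
    using \<phi> test_function_partial[OF \<phi> assms(4)] unfolding \<Omega>_def
    by (auto intro: test_function_L2[OF rectangle_measure])
  then show "ip \<Omega> (\<lambda>x. s * u x + t * v x) (\<lambda>x. frechet_derivative \<phi> (at x) e)
      = - ip \<Omega> (\<lambda>x. s * g x + t * h x) \<phi>"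
    using assms(2,3,5-8) \<phi> by (simp add: ip_lin has_weak_partial_iff)
qed

section \<open>Integration by parts\<close>

lemma integral_deriv_compact_support:
  fixes F :: "real \<Rightarrow> real"
  assumes F: "\<And>x. (F has_real_derivative f x) (at x)" and "continuous_on UNIV f"
    and "a \<le> b" "F a = 0" "F b = 0" "\<And>x. x \<notin> {a..b} \<Longrightarrow> f x = 0"
  shows "(LINT x|lborel. f x) = 0"
proof -
  have "(LINT x|lborel. f x) = (LINT x|lborel. f x * indicator {a..b} x)"
    using assms(6) by (intro Bochner_Integration.integral_cong) (auto simp: indicator_def)
  also have "\<dots> = F b - F a"
    using assms by (intro integral_FTC_Icc_real) (auto simp: continuous_on_eq_continuous_at)
  finally show ?thesis using assms by simp
qed

lemma test_function_eq_0: "\<phi> \<in> test_functions \<Omega> \<Longrightarrow> x \<notin> \<Omega> \<Longrightarrow> \<phi> x = 0"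
  using closure_subset[of "{x. \<phi> x \<noteq> 0}"] by (auto simp: test_functions_def)

lemma test_function_has_derivative:
  "\<phi> \<in> test_functions \<Omega> \<Longrightarrow> (\<phi> has_derivative frechet_derivative \<phi> (at x)) (at x)"
  using Ck_Suc_has_derivative[of 0 \<phi>] by (simp add: test_functions_def del: Ck.simps)

text \<open>Fubini's theorem reduces this to the fundamental theorem of calculus on each line.\<close>

lemma test_function_integral_partial:
  fixes a b c d :: real
  defines "\<Omega> \<equiv> {a<..<b} \<times> {c<..<d}"
  assumes \<phi>: "\<phi> \<in> test_functions \<Omega>" and e: "e \<in> Basis"
  shows "(LINT p:\<Omega>|lborel. frechet_derivative \<phi> (at p) e) = 0"
proof -
  define \<psi> where "\<psi> p = frechet_derivative \<phi> (at p) e" for p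
  have \<psi>: "\<psi> \<in> test_functions \<Omega>"
    unfolding \<psi>_def[abs_def] by (rule test_function_partial[OF \<phi> e])
  have cont: "continuous_on UNIV \<psi>" by (rule test_function_continuous[OF \<psi>])
  have ind: "(\<lambda>p. indicator \<Omega> p *\<^sub>R \<psi> p) = \<psi>"
  proof
    show "indicator \<Omega> p *\<^sub>R \<psi> p = \<psi> p" for p
      using test_function_eq_0[OF \<psi>, of p] by (cases "p \<in> \<Omega>") auto
  qed
  have "set_integrable lborel \<Omega> \<psi>"
    unfolding \<Omega>_def by (intro L2_integrable rectangle_measure test_function_L2 \<psi>[unfolded \<Omega>_def])
  then have int: "integrable (lborel \<Otimes>\<^sub>M lborel) (\<lambda>(x, y). \<psi> (x, y))"
    unfolding set_integrable_def ind lborel_prod by simp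
  have D: "(\<phi> has_derivative frechet_derivative \<phi> (at p)) (at p)" for p
    by (rule test_function_has_derivative[OF \<phi>])
  have scal: "frechet_derivative \<phi> (at p) (h *\<^sub>R v) = frechet_derivative \<phi> (at p) v * h" for p h v
    using linear_scale[OF has_derivative_linear[OF D]] by simp
  have "(LINT p|lborel. \<psi> p) = 0"
  proof (cases "e = (1, 0)")
    case True
    have "(LINT x|lborel. \<psi> (x, y)) = 0" for y
    proof (cases "a \<le> b")
      case ab: True
      show ?thesis
      proof (rule integral_deriv_compact_support[OF _ _ ab])
        show "((\<lambda>x. \<phi> (x, y)) has_real_derivative \<psi> (x, y)) (at x)" for x
          unfolding has_field_derivative_def \<psi>_def True
        proof (rule has_derivative_eq_rhs)
          show "((\<lambda>x. \<phi> (x, y)) has_derivative (\<lambda>h. frechet_derivative \<phi> (at (x, y)) (h, 0))) (at x)"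
            by (rule has_derivative_compose[OF has_derivative_Pair[OF has_derivative_ident has_derivative_const] D])
          show "(\<lambda>h. frechet_derivative \<phi> (at (x, y)) (h, 0)) = (*) (frechet_derivative \<phi> (at (x, y)) (1, 0))"
          proof
            show "frechet_derivative \<phi> (at (x, y)) (h, 0) = frechet_derivative \<phi> (at (x, y)) (1, 0) * h" for h
              using scal[of "(x, y)" h "(1, 0)"] by simp
          qed
        qed
        show "continuous_on UNIV (\<lambda>x. \<psi> (x, y))"
          by (rule continuous_on_compose2[OF cont]) (auto intro: continuous_intros)
      qed (auto simp: test_function_eq_0[OF \<phi>] test_function_eq_0[OF \<psi>] \<Omega>_def)
    next
      case False
      then have "\<psi> (x, y) = 0" for x using test_function_eq_0[OF \<psi>] by (auto simp: \<Omega>_def)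
      then show ?thesis by simp
    qed
    then show ?thesis
      using lborel_pair.integral_snd[of "\<lambda>x y. \<psi> (x, y)", OF int] by (simp add: lborel_prod)
  next
    case False
    then have e: "e = (0, 1)" using e by (auto simp: Basis_real_prod)
    have "(LINT y|lborel. \<psi> (x, y)) = 0" for x
    proof (cases "c \<le> d")
      case cd: True
      show ?thesis
      proof (rule integral_deriv_compact_support[OF _ _ cd])
        show "((\<lambda>y. \<phi> (x, y)) has_real_derivative \<psi> (x, y)) (at y)" for y
          unfolding has_field_derivative_def \<psi>_def e
        proof (rule has_derivative_eq_rhs)
          show "((\<lambda>y. \<phi> (x, y)) has_derivative (\<lambda>h. frechet_derivative \<phi> (at (x, y)) (0, h))) (at y)"
            by (rule has_derivative_compose[OF has_derivative_Pair[OF has_derivative_const has_derivative_ident] D])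
          show "(\<lambda>h. frechet_derivative \<phi> (at (x, y)) (0, h)) = (*) (frechet_derivative \<phi> (at (x, y)) (0, 1))"
          proof
            show "frechet_derivative \<phi> (at (x, y)) (0, h) = frechet_derivative \<phi> (at (x, y)) (0, 1) * h" for h
              using scal[of "(x, y)" h "(0, 1)"] by simp
          qed
        qed
        show "continuous_on UNIV (\<lambda>y. \<psi> (x, y))"
          by (rule continuous_on_compose2[OF cont]) (auto intro: continuous_intros)
      qed (auto simp: test_function_eq_0[OF \<phi>] test_function_eq_0[OF \<psi>] \<Omega>_def)
    next
      case False
      then have "\<psi> (x, y) = 0" for y using test_function_eq_0[OF \<psi>] by (auto simp: \<Omega>_def)
      then show ?thesis by simp
    qed
    then show ?thesis
      using lborel_pair.integral_fst[of "\<lambda>x y. \<psi> (x, y)", OF int] by (simp add: lborel_prod)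
  qed
  then show ?thesis unfolding set_lebesgue_integral_def \<psi>_def[symmetric] ind by simp
qed

lemma continuous_on_rectangle_L2:
  fixes u :: "real \<times> real \<Rightarrow> real"
  assumes "continuous_on UNIV u"
  shows "u \<in> L2 ({a<..<b} \<times> {c<..<d})"
proof -
  have "compact (u ` ({a..b} \<times> {c..d}))"
    by (intro compact_continuous_image continuous_on_subset[OF assms] compact_Times) auto
  then obtain C where C: "\<forall>y\<in>u ` ({a..b} \<times> {c..d}). norm y \<le> C"
    using compact_imp_bounded bounded_pos by blast
  have "\<bar>u x\<bar> \<le> C" if "x \<in> {a<..<b} \<times> {c<..<d}" for x
  proof -
    have "x \<in> {a..b} \<times> {c..d}" using that by auto
    then show ?thesis using C by auto
  qed
  then show ?thesis
    by (rule L2_bounded[OF rectangle_measure borel_measurable_continuous_onI[OF assms]])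
qed

text \<open>The product of a smooth function with a test function is again a test function, whose partial
  derivatives have integral zero.\<close>

lemma smooth_tensor_has_weak_partial:
  fixes a b c d :: real
  defines "\<Omega> \<equiv> {a<..<b} \<times> {c<..<d}"
  assumes "smooth f" "smooth g"
  shows "has_weak_partial \<Omega> (1, 0) (\<lambda>p. f (fst p) * g (snd p)) (\<lambda>p. deriv f (fst p) * g (snd p))"
    and "has_weak_partial \<Omega> (0, 1) (\<lambda>p. f (fst p) * g (snd p)) (\<lambda>p. f (fst p) * deriv g (snd p))"
proof -
  define u where "u p = f (fst p) * g (snd p)" for p
  have uC: "Ck k u" for k
    unfolding u_def by (rule Ck_tensor[OF assms(2,3)])
  have Du: "(u has_derivative frechet_derivative u (at p)) (at p)" for p
    by (rule Ck_Suc_has_derivative[OF uC])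
  have "has_weak_partial \<Omega> e u (\<lambda>p. frechet_derivative u (at p) e)" if e: "e \<in> Basis" for e
    unfolding has_weak_partial_def
  proof
    fix \<phi> assume \<phi>: "\<phi> \<in> test_functions \<Omega>"
    have "Ck k (\<lambda>p. u p * \<phi> p)" for k
      using uC \<phi> by (intro Ck_mult) (auto simp: test_functions_def)
    moreover have "closure {p. u p * \<phi> p \<noteq> 0} \<subseteq> closure {p. \<phi> p \<noteq> 0}"
      by (rule closure_mono) auto
    ultimately have u\<phi>: "(\<lambda>p. u p * \<phi> p) \<in> test_functions \<Omega>"
      using \<phi> compact_subset[OF _ closed_closure] unfolding test_functions_def by blast
    have D\<phi>: "(\<phi> has_derivative frechet_derivative \<phi> (at p)) (at p)" for p
      by (rule test_function_has_derivative[OF \<phi>])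
    have prod: "frechet_derivative (\<lambda>p. u p * \<phi> p) (at p) e
        = u p * frechet_derivative \<phi> (at p) e + frechet_derivative u (at p) e * \<phi> p" for p
      unfolding frechet_derivative_at[OF has_derivative_mult[OF Du D\<phi>], symmetric] ..
    have L2: "u \<in> L2 \<Omega>" "(\<lambda>p. frechet_derivative u (at p) e) \<in> L2 \<Omega>" "\<phi> \<in> L2 \<Omega>"
      "(\<lambda>p. frechet_derivative \<phi> (at p) e) \<in> L2 \<Omega>"
    proof -
      have "continuous_on UNIV (\<lambda>p. frechet_derivative u (at p) e)"
        using uC[of 1] e by simp
      then show "u \<in> L2 \<Omega>" "(\<lambda>p. frechet_derivative u (at p) e) \<in> L2 \<Omega>" "\<phi> \<in> L2 \<Omega>"
        "(\<lambda>p. frechet_derivative \<phi> (at p) e) \<in> L2 \<Omega>"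
        unfolding \<Omega>_def using Ck_continuous[OF uC] test_function_continuous[OF \<phi>]
          test_function_continuous[OF test_function_partial[OF \<phi> e]]
        by (simp_all add: continuous_on_rectangle_L2)
    qed
    have "0 = (LINT p:\<Omega>|lborel. u p * frechet_derivative \<phi> (at p) e + frechet_derivative u (at p) e * \<phi> p)"
      using test_function_integral_partial[OF u\<phi>[unfolded \<Omega>_def] e] by (simp add: prod \<Omega>_def)
    also have "\<dots> = (LINT p:\<Omega>|lborel. u p * frechet_derivative \<phi> (at p) e)
        + (LINT p:\<Omega>|lborel. frechet_derivative u (at p) e * \<phi> p)"
      using L2 by (intro set_integral_add L2_mult_integrable)
    finally show "(LINT p:\<Omega>|lborel. u p * frechet_derivative \<phi> (at p) e)
        = - (LINT p:\<Omega>|lborel. frechet_derivative u (at p) e * \<phi> p)" by simp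
  qed
  from this[of "(1, 0)"] this[of "(0, 1)"] 
  show "has_weak_partial \<Omega> (1, 0) (\<lambda>p. f (fst p) * g (snd p)) (\<lambda>p. deriv f (fst p) * g (snd p))"
    and "has_weak_partial \<Omega> (0, 1) (\<lambda>p. f (fst p) * g (snd p)) (\<lambda>p. f (fst p) * deriv g (snd p))"
    unfolding u_def[abs_def] using tensor_partial[OF assms(2,3)] by (auto simp: Basis_real_prod)
qed

lemma smooth_bounded: 
  assumes "smooth g" obtains C where "C \<ge> 0" "\<And>x. x \<in> {a..b} \<Longrightarrow> \<bar>g x\<bar> \<le> C"
proof -
  have "compact (g ` {a..b})"
    using assms by (intro compact_continuous_image smooth_continuous_on) auto
  then obtain C where "C > 0" "\<forall>y\<in>g ` {a..b}. norm y \<le> C"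
    using compact_imp_bounded bounded_pos by blast
  then show ?thesis using that[of C] by auto
qed

text \<open>The two coordinates of the rectangle play symmetric roles below, so they enter as a pair of
  functions \<open>X\<close>, \<open>Y\<close>, instantiated with the two projections in either order. The
  functions \<open>w\<close> and \<open>z\<close> satisfy \<open>z = \<partial>\<^sub>X w\<close> when tested with products.\<close>

locale weak_derivative_box =
  fixes X Y :: "real \<times> real \<Rightarrow> real" and a b c d :: real and \<Omega> :: "(real \<times> real) set"
    and w z :: "real \<times> real \<Rightarrow> real"
  assumes \<Omega>_eq: "\<Omega> = {p. X p \<in> {a<..<b} \<and> Y p \<in> {c<..<d}}"
    and \<Omega>: "\<Omega> \<in> sets borel" "emeasure lborel \<Omega> < \<infinity>"
    and X: "X \<in> borel_measurable borel" and Y: "Y \<in> borel_measurable borel"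
    and w: "w \<in> L2 \<Omega>" and z: "z \<in> L2 \<Omega>"
    and weak: "\<And>f h. smooth f \<Longrightarrow> smooth h \<Longrightarrow> supported_in f a b \<Longrightarrow> supported_in h c d \<Longrightarrow>
      ip \<Omega> w (\<lambda>p. deriv f (X p) * h (Y p)) = - ip \<Omega> z (\<lambda>p. f (X p) * h (Y p))"
begin

lemma XY_measurable:
  assumes "smooth f" "smooth h"
  shows "(\<lambda>p. f (X p) * h (Y p)) \<in> borel_measurable borel"
  by (intro borel_measurable_times measurable_compose[OF X] measurable_compose[OF Y]
      smooth_measurable assms)

lemma XY_bounded:
  assumes "smooth f" "smooth h"
  obtains C where "\<And>p. p \<in> \<Omega> \<Longrightarrow> \<bar>f (X p) * h (Y p)\<bar> \<le> C"
proof -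
  obtain A where A: "A \<ge> 0" "\<And>x. x \<in> {a..b} \<Longrightarrow> \<bar>f x\<bar> \<le> A"
    using smooth_bounded[OF assms(1)] by blast
  obtain B where B: "B \<ge> 0" "\<And>x. x \<in> {c..d} \<Longrightarrow> \<bar>h x\<bar> \<le> B"
    using smooth_bounded[OF assms(2)] by blast
  have "\<bar>f (X p) * h (Y p)\<bar> \<le> A * B" if "p \<in> \<Omega>" for p
    using that A B by (auto simp: \<Omega>_eq abs_mult intro!: mult_mono)
  then show ?thesis using that by blast
qed

lemma XY_L2:
  assumes "smooth f" "smooth h"
  shows "(\<lambda>p. f (X p) * h (Y p)) \<in> L2 \<Omega>"
  using XY_bounded[OF assms] L2_bounded[OF \<Omega> XY_measurable[OF assms]] by metis

text \<open>Multiplying the factors by cutoffs makes the weak derivative applicable. In the limit the only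
  term that can survive besides the expected ones is the one carrying the derivative of the cutoff
  in the direction \<open>X\<close>; it is a boundary term.\<close>

lemma ibp_boundary_term:
  assumes g: "smooth g" and h: "smooth h"
    and boundary: "(\<lambda>n. ip \<Omega> w (\<lambda>p. (g (X p) * deriv (cut a b n) (X p)) * (h (Y p) * cut c d n (Y p)))) \<longlonglongrightarrow> 0"
  shows "ip \<Omega> w (\<lambda>p. deriv g (X p) * h (Y p)) = - ip \<Omega> z (\<lambda>p. g (X p) * h (Y p))"
proof -
  have dg: "smooth (deriv g)" using smooth_has_deriv[OF g] by blast
  have lim: "(\<lambda>n. ip \<Omega> v (\<lambda>p. (f (X p) * cut a b n (X p)) * (h (Y p) * cut c d n (Y p))))
      \<longlonglongrightarrow> ip \<Omega> v (\<lambda>p. f (X p) * h (Y p))" if v: "v \<in> L2 \<Omega>" and f: "smooth f" for v f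
  proof -
    obtain C where C: "\<And>p. p \<in> \<Omega> \<Longrightarrow> \<bar>f (X p) * h (Y p)\<bar> \<le> C"
      using XY_bounded[OF f h] by blast
    show ?thesis
    proof (rule ip_tendsto[OF \<Omega> v])
      show "(\<lambda>p. (f (X p) * cut a b n (X p)) * (h (Y p) * cut c d n (Y p))) \<in> borel_measurable borel" for n
        using f h smooth_cut by (intro XY_measurable smooth_mult)
      show "(\<lambda>p. f (X p) * h (Y p)) \<in> borel_measurable borel"
        using f h by (rule XY_measurable)
      show "\<bar>(f (X p) * cut a b n (X p)) * (h (Y p) * cut c d n (Y p))\<bar> \<le> C" if "p \<in> \<Omega>" for n p
      proof -
        have "\<bar>(f (X p) * cut a b n (X p)) * (h (Y p) * cut c d n (Y p))\<bar>
            = \<bar>f (X p) * h (Y p)\<bar> * (cut a b n (X p) * cut c d n (Y p))"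
          by (simp add: abs_mult cut_bounds mult_ac)
        also have "\<dots> \<le> \<bar>f (X p) * h (Y p)\<bar> * 1"
          by (intro mult_left_mono mult_le_one) (auto simp: cut_bounds)
        finally show ?thesis using C[OF that] by simp
      qed
      fix p assume "p \<in> \<Omega>"
      then have p: "X p \<in> {a<..<b}" "Y p \<in> {c<..<d}" by (auto simp: \<Omega>_eq)
      have "\<forall>\<^sub>F n in sequentially. f (X p) * h (Y p) = (f (X p) * cut a b n (X p)) * (h (Y p) * cut c d n (Y p))"
        using cut_eventually_eq_1[OF p(1)] cut_eventually_eq_1[OF p(2)] by eventually_elim simp
      then show "(\<lambda>n. (f (X p) * cut a b n (X p)) * (h (Y p) * cut c d n (Y p))) \<longlonglongrightarrow> f (X p) * h (Y p)"
        by (rule Lim_transform_eventually[OF tendsto_const])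
    qed
  qed
  have "\<forall>\<^sub>F n in sequentially. ip \<Omega> w (\<lambda>p. (deriv g (X p) * cut a b n (X p)) * (h (Y p) * cut c d n (Y p)))
        + ip \<Omega> w (\<lambda>p. (g (X p) * deriv (cut a b n) (X p)) * (h (Y p) * cut c d n (Y p)))
      = - ip \<Omega> z (\<lambda>p. (g (X p) * cut a b n (X p)) * (h (Y p) * cut c d n (Y p)))"
    using eventually_gt_at_top[of 0]
  proof eventually_elim
    case (elim n)
    let ?A = "\<lambda>p. (deriv g (X p) * cut a b n (X p)) * (h (Y p) * cut c d n (Y p))"
    let ?B = "\<lambda>p. (g (X p) * deriv (cut a b n) (X p)) * (h (Y p) * cut c d n (Y p))"
    have d: "deriv (\<lambda>x. g x * cut a b n x) x = deriv g x * cut a b n x + g x * deriv (cut a b n) x" for x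
      using DERIV_mult[OF smooth_has_deriv(1)[OF g] smooth_has_deriv(1)[OF smooth_cut]]
      by (intro DERIV_imp_deriv) (simp add: algebra_simps)
    have "?A \<in> L2 \<Omega>" "?B \<in> L2 \<Omega>"
      using smooth_has_deriv(2)[OF smooth_cut] g h dg smooth_cut by (auto intro!: XY_L2 smooth_mult)
    then have "ip \<Omega> w ?A + ip \<Omega> w ?B = ip \<Omega> w (\<lambda>p. ?A p + ?B p)"
      using ip_lin[of ?A \<Omega> ?B w 1 1] w by (simp add: ip_commute[of _ w])
    also have "\<dots> = ip \<Omega> w (\<lambda>p. deriv (\<lambda>x. g x * cut a b n x) (X p) * (h (Y p) * cut c d n (Y p)))"
      by (simp add: d algebra_simps)
    also have "\<dots> = - ip \<Omega> z (\<lambda>p. (g (X p) * cut a b n (X p)) * (h (Y p) * cut c d n (Y p)))"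
      using elim g h by (intro weak smooth_mult smooth_cut supported_in_cut)
    finally show ?case .
  qed
  then have "(\<lambda>n. - ip \<Omega> z (\<lambda>p. (g (X p) * cut a b n (X p)) * (h (Y p) * cut c d n (Y p))))
      \<longlonglongrightarrow> ip \<Omega> w (\<lambda>p. deriv g (X p) * h (Y p)) + 0"
    by (rule Lim_transform_eventually[rotated]) (intro tendsto_add lim w dg boundary)
  moreover have "(\<lambda>n. - ip \<Omega> z (\<lambda>p. (g (X p) * cut a b n (X p)) * (h (Y p) * cut c d n (Y p))))
      \<longlonglongrightarrow> - ip \<Omega> z (\<lambda>p. g (X p) * h (Y p))"
    by (intro tendsto_minus lim z g)
  ultimately show ?thesis using LIMSEQ_unique by fastforce
qed

text \<open>If the smooth factor vanishes at both ends, it is of order \<open>1 / n\<close> in the layers where the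
  derivative of the cutoff has size \<open>n\<close>, and dominated convergence kills the boundary term.\<close>

lemma ibp_vanishing_factor:
  assumes g: "smooth g" and h: "smooth h" and g0: "g a = 0" "g b = 0"
  shows "ip \<Omega> w (\<lambda>p. deriv g (X p) * h (Y p)) = - ip \<Omega> z (\<lambda>p. g (X p) * h (Y p))"
proof (rule ibp_boundary_term[OF g h])
  obtain S where S: "S > 0" "\<And>x. \<bar>deriv step x\<bar> \<le> S" using deriv_step_bounded by blast
  obtain M where M: "M \<ge> 0" "\<And>x. x \<in> {a..b} \<Longrightarrow> \<bar>deriv g x\<bar> \<le> M"
    using smooth_bounded[OF smooth_has_deriv(2)[OF g]] by blast
  obtain H where H: "H \<ge> 0" "\<And>x. x \<in> {c..d} \<Longrightarrow> \<bar>h x\<bar> \<le> H" using smooth_bounded[OF h] by blast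
  have lip: "\<bar>g x - g y\<bar> \<le> M * \<bar>x - y\<bar>" if "x \<in> {a..b}" "y \<in> {a..b}" for x y
    using field_differentiable_bound[of "{a..b}" g "deriv g" M x y] that M(2)
      has_field_derivative_at_within[OF smooth_has_deriv(1)[OF g]] by auto
  have bound: "\<bar>g x * deriv (cut a b n) x\<bar> \<le> 4 * M * S" if x: "x \<in> {a<..<b}" for n x
  proof (cases "n > 0 \<and> (x \<le> a + 2 / real n \<or> b - 2 / real n \<le> x)")
    case True
    then have "\<bar>g x\<bar> \<le> M * (2 / real n)"
    proof
      assume n: "0 < n" and "x \<le> a + 2 / real n \<or> b - 2 / real n \<le> x"
      then show ?thesis
      proof (elim disjE)
        assume "x \<le> a + 2 / real n"
        then have "M * \<bar>x - a\<bar> \<le> M * (2 / real n)" using x M(1) by (intro mult_left_mono) auto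
        then show ?thesis using lip[of x a] x g0 by auto
      next
        assume "b - 2 / real n \<le> x"
        then have "M * \<bar>x - b\<bar> \<le> M * (2 / real n)" using x M(1) by (intro mult_left_mono) auto
        then show ?thesis using lip[of x b] x g0 by auto
      qed
    qed
    then have "\<bar>g x\<bar> * \<bar>deriv (cut a b n) x\<bar> \<le> (M * (2 / real n)) * (2 * real n * S)"
      using deriv_cut_le[OF S(2)] M(1) by (intro mult_mono) auto
    also have "\<dots> = 4 * M * S" using True by simp
    finally show ?thesis by (simp add: abs_mult)
  next
    case False
    then have "deriv (cut a b n) x = 0"
      using deriv_cut_eq_0[of n a x b] deriv_cut_le[OF S(2), of a b n x] by (cases "n = 0") auto
    then show ?thesis using M(1) S(1) by simp
  qed
  have sm: "smooth (deriv (cut a b n))" for n by (rule smooth_has_deriv(2)[OF smooth_cut])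
  have "(\<lambda>n. ip \<Omega> w (\<lambda>p. (g (X p) * deriv (cut a b n) (X p)) * (h (Y p) * cut c d n (Y p)))) \<longlonglongrightarrow> ip \<Omega> w (\<lambda>p. 0)"
  proof (rule ip_tendsto[OF \<Omega> w])
    show "(\<lambda>p. (g (X p) * deriv (cut a b n) (X p)) * (h (Y p) * cut c d n (Y p))) \<in> borel_measurable borel" for n
      using g h smooth_cut sm by (intro XY_measurable smooth_mult)
    show "\<bar>(g (X p) * deriv (cut a b n) (X p)) * (h (Y p) * cut c d n (Y p))\<bar> \<le> (4 * M * S) * (H * 1)"
      if "p \<in> \<Omega>" for n p
      unfolding abs_mult[of "g (X p) * deriv (cut a b n) (X p)"] abs_mult[of "h (Y p)"]
      using that bound[of "X p" n] H cut_bounds[of c d n "Y p"] S(1) M(1)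
      by (intro mult_mono) (auto simp: \<Omega>_eq)
    fix p assume "p \<in> \<Omega>"
    then have p: "X p \<in> {a<..<b}" by (auto simp: \<Omega>_eq)
    have "\<forall>\<^sub>F n in sequentially. 0 = (g (X p) * deriv (cut a b n) (X p)) * (h (Y p) * cut c d n (Y p))"
      using cut_eventually_eq_1[OF p] by eventually_elim simp
    then show "(\<lambda>n. (g (X p) * deriv (cut a b n) (X p)) * (h (Y p) * cut c d n (Y p))) \<longlonglongrightarrow> 0"
      by (rule Lim_transform_eventually[OF tendsto_const])
  qed simp
  then show "(\<lambda>n. ip \<Omega> w (\<lambda>p. (g (X p) * deriv (cut a b n) (X p)) * (h (Y p) * cut c d n (Y p)))) \<longlonglongrightarrow> 0"
    by (simp add: ip_def set_lebesgue_integral_def)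
qed

end

lemma weak_derivative_box_x:
  assumes "has_weak_partial ({a<..<b} \<times> {c<..<d}) (1, 0) w z"
    and "w \<in> L2 ({a<..<b} \<times> {c<..<d})" "z \<in> L2 ({a<..<b} \<times> {c<..<d})"
  shows "weak_derivative_box fst snd a b c d ({a<..<b} \<times> {c<..<d}) w z"
proof
  show "ip ({a<..<b} \<times> {c<..<d}) w (\<lambda>p. deriv f (fst p) * h (snd p))
      = - ip ({a<..<b} \<times> {c<..<d}) z (\<lambda>p. f (fst p) * h (snd p))"
    if "smooth f" "smooth h" "supported_in f a b" "supported_in h c d" for f h
    using bspec[OF assms(1)[unfolded has_weak_partial_iff] tensor_test_function[OF that]]
    by (simp add: tensor_partial[OF that(1,2)])
qed (use assms rectangle_measure in \<open>auto simp: borel_prod[symmetric]\<close>)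

lemma weak_derivative_box_y:
  assumes "has_weak_partial ({a<..<b} \<times> {c<..<d}) (0, 1) w z"
    and "w \<in> L2 ({a<..<b} \<times> {c<..<d})" "z \<in> L2 ({a<..<b} \<times> {c<..<d})"
  shows "weak_derivative_box snd fst c d a b ({a<..<b} \<times> {c<..<d}) w z"
proof
  show "ip ({a<..<b} \<times> {c<..<d}) w (\<lambda>p. deriv f (snd p) * h (fst p))
      = - ip ({a<..<b} \<times> {c<..<d}) z (\<lambda>p. f (snd p) * h (fst p))"
    if "smooth f" "smooth h" "supported_in f c d" "supported_in h a b" for f h
    using bspec[OF assms(1)[unfolded has_weak_partial_iff] tensor_test_function[OF that(2,1,4,3)]]
    unfolding tensor_partial(2)[OF that(2,1)] by (simp add: mult.commute)
qed (use assms rectangle_measure in \<open>auto simp: borel_prod[symmetric]\<close>)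

lemma weak_ibp_x:
  assumes "has_weak_partial ({a<..<b} \<times> {c<..<d}) (1, 0) w z"
    and "w \<in> L2 ({a<..<b} \<times> {c<..<d})" "z \<in> L2 ({a<..<b} \<times> {c<..<d})"
    and "smooth g" "smooth h" "g a = 0" "g b = 0"
  shows "ip ({a<..<b} \<times> {c<..<d}) z (\<lambda>p. g (fst p) * h (snd p))
      = - ip ({a<..<b} \<times> {c<..<d}) w (\<lambda>p. deriv g (fst p) * h (snd p))"
  using weak_derivative_box.ibp_vanishing_factor[OF weak_derivative_box_x[OF assms(1-3)] assms(4-7)] by simp

lemma weak_ibp_y:
  assumes "has_weak_partial ({a<..<b} \<times> {c<..<d}) (0, 1) w z"
    and "w \<in> L2 ({a<..<b} \<times> {c<..<d})" "z \<in> L2 ({a<..<b} \<times> {c<..<d})"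
    and "smooth g" "smooth h" "h c = 0" "h d = 0"
  shows "ip ({a<..<b} \<times> {c<..<d}) z (\<lambda>p. g (fst p) * h (snd p))
      = - ip ({a<..<b} \<times> {c<..<d}) w (\<lambda>p. g (fst p) * deriv h (snd p))"
  using weak_derivative_box.ibp_vanishing_factor[OF weak_derivative_box_y[OF assms(1-3)] assms(5,4,6,7)]
  by (simp add: mult.commute)

text \<open>If instead \<open>w\<close> has a continuous representative that vanishes on the two edges, then
  \<open>w\<close> is uniformly small in the layers where the derivative of the cutoff lives, while that
  derivative is bounded in \<open>L\<^sup>1\<close>.\<close>

lemma weak_ibp_x_zero_trace:
  fixes a b c d :: real
  defines "\<Omega> \<equiv> {a<..<b} \<times> {c<..<d}"
  assumes ab: "a < b" "c < d" and weak: "has_weak_partial \<Omega> (1, 0) w z"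
    and w: "w \<in> L2 \<Omega>" and z: "z \<in> L2 \<Omega>"
    and cont: "continuous_on (closure \<Omega>) w'" and eq: "AE p in lborel. p \<in> \<Omega> \<longrightarrow> w' p = w p"
    and trace: "\<And>p. p \<in> {a, b} \<times> {c<..<d} \<Longrightarrow> w' p = 0"
    and g: "smooth g" and h: "smooth h"
  shows "ip \<Omega> z (\<lambda>p. g (fst p) * h (snd p)) = - ip \<Omega> w (\<lambda>p. deriv g (fst p) * h (snd p))"
proof -
  have box: "weak_derivative_box fst snd a b c d \<Omega> w z"
    unfolding \<Omega>_def using weak_derivative_box_x weak w z by (simp add: \<Omega>_def)
  then interpret weak_derivative_box fst snd a b c d \<Omega> w z .
  have cl: "closure \<Omega> = {a..b} \<times> {c..d}"
    using ab by (simp add: \<Omega>_def closure_Times)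
  have uc: "uniformly_continuous_on (closure \<Omega>) w'"
    using cont by (rule compact_uniformly_continuous) (simp add: cl compact_Times)
  obtain S where S: "S > 0" "\<And>x. \<bar>deriv step x\<bar> \<le> S" using deriv_step_bounded by blast
  obtain C where C: "\<And>p. p \<in> \<Omega> \<Longrightarrow> \<bar>g (fst p) * h (snd p)\<bar> \<le> C" using XY_bounded[OF g h] by blast
  have C0: "C \<ge> 0"
  proof -
    have "((a + b) / 2, (c + d) / 2) \<in> \<Omega>" using ab by (simp add: \<Omega>_def)
    from C[OF this] show ?thesis by linarith
  qed
  define T where "T n p = (g (fst p) * deriv (cut a b n) (fst p)) * (h (snd p) * cut c d n (snd p))" for n p
  have T: "smooth (\<lambda>x. g x * deriv (cut a b n) x)" "smooth (\<lambda>y. h y * cut c d n y)" for n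
    using g h smooth_cut smooth_has_deriv(2)[OF smooth_cut] by (auto intro: smooth_mult)
  have TL2: "T n \<in> L2 \<Omega>" for n
    unfolding T_def[abs_def] by (rule XY_L2[OF T])
  have "(\<lambda>n. ip \<Omega> w (T n)) \<longlonglongrightarrow> 0"
  proof (rule LIMSEQ_I)
    fix r :: real assume r: "r > 0"
    define \<epsilon> where "\<epsilon> = r / (12 * (C * S * (d - c) + 1))"
    have den: "C * S * (d - c) \<ge> 0" using C0 S(1) ab by simp
    have \<epsilon>: "\<epsilon> > 0" unfolding \<epsilon>_def using r den by (intro divide_pos_pos) auto
    obtain \<delta> where \<delta>: "\<delta> > 0" "\<And>p q. p \<in> closure \<Omega> \<Longrightarrow> q \<in> closure \<Omega> \<Longrightarrow> dist q p < \<delta> \<Longrightarrow> dist (w' q) (w' p) < \<epsilon>"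
      using uc \<epsilon> unfolding uniformly_continuous_on_def by metis
    have small: "\<bar>w' p\<bar> \<le> \<epsilon>" if p: "p \<in> \<Omega>" and "fst p < a + \<delta> \<or> b - \<delta> < fst p" for p
    proof -
      have "\<exists>e\<in>{a, b}. dist (fst p) e < \<delta>"
        using that by (auto simp: \<Omega>_def dist_real_def)
      then obtain e where e: "e \<in> {a, b}" "dist (fst p) e < \<delta>" by blast
      have "dist p (e, snd p) < \<delta>" using e by (simp add: dist_prod_def)
      moreover have "(e, snd p) \<in> closure \<Omega>" "p \<in> closure \<Omega>"
        using p e ab unfolding cl by (auto simp: \<Omega>_def)
      ultimately have "dist (w' p) (w' (e, snd p)) < \<epsilon>" using \<delta>(2) by blast
      moreover have "w' (e, snd p) = 0" using p e by (intro trace) (auto simp: \<Omega>_def)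
      ultimately show ?thesis by (simp add: dist_real_def)
    qed
    obtain N :: nat where N': "2 / \<delta> < real N" using reals_Archimedean2 by blast
    have "0 < 2 / \<delta>" using \<delta>(1) by simp
    then have "0 < real N" using N' by linarith
    then have N: "N > 0" "2 / real N < \<delta>" using N' \<delta>(1) by (simp_all add: field_simps)
    have "\<bar>ip \<Omega> w (T n)\<bar> < r" if n: "n \<ge> N" for n
    proof -
      have n0: "n > 0" using N n by simp
      have nd: "2 / real n < \<delta>"
        using N n0 n by (intro le_less_trans[OF _ N(2)] divide_left_mono) auto
      define A B where "A = box (a, c) (a + 3 / real n, d)" and "B = box (b - 3 / real n, c) (b, d)"
      define K where "K = \<epsilon> * (C * (2 * real n * S))"
      have K: "K \<ge> 0" using \<epsilon> C0 S(1) by (simp add: K_def)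
      have bound: "\<bar>w' p * T n p\<bar> \<le> K * (indicator A p + indicator B p)" if p: "p \<in> \<Omega>" for p
      proof (cases "a + 2 / real n < fst p \<and> fst p < b - 2 / real n")
        case True
        then have "T n p = 0" using deriv_cut_eq_0[OF n0] by (simp add: T_def)
        then show ?thesis using K by simp
      next
        case False
        have "2 / real n < 3 / real n" using n0 by (intro divide_strict_right_mono) auto
        then have ind: "1 \<le> indicator A p + (indicator B p :: real)"
          using False p unfolding A_def B_def
          by (cases p) (auto simp: \<Omega>_def indicator_def mem_box Basis_real_prod)
        have "\<bar>w' p\<bar> \<le> \<epsilon>" using False nd by (intro small[OF p]) auto
        moreover have "\<bar>T n p\<bar> \<le> C * (2 * real n * S)"
        proof -
          have "\<bar>T n p\<bar> = \<bar>g (fst p) * h (snd p)\<bar> * (\<bar>deriv (cut a b n) (fst p)\<bar> * cut c d n (snd p))"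
            by (simp add: T_def abs_mult cut_bounds mult_ac)
          also have "\<dots> \<le> C * ((2 * real n * S) * 1)"
            using C[OF p] C0 S(1) by (intro mult_mono deriv_cut_le S cut_bounds) (auto simp: cut_bounds)
          finally show ?thesis by simp
        qed
        ultimately have "\<bar>w' p * T n p\<bar> \<le> K"
          unfolding abs_mult K_def using \<epsilon> by (intro mult_mono) auto
        also have "K \<le> K * (indicator A p + indicator B p)" using mult_left_mono[OF ind K] by simp
        finally show ?thesis .
      qed
      have meas: "measure lborel A = 3 / real n * (d - c)" "measure lborel B = 3 / real n * (d - c)"
        using ab n0 by (auto simp: A_def B_def measure_lborel_box_eq Basis_real_prod)
      have fin: "emeasure lborel (box u v) < \<infinity>" for u v :: "real \<times> real"
        using emeasure_lborel_box_finite[of u v] by auto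
      have int: "integrable lborel (\<lambda>p. K * (indicator A p + indicator B p))"
        unfolding A_def B_def
        by (intro integrable_mult_right Bochner_Integration.integrable_add integrable_real_indicator fin) auto
      have wT: "integrable lborel (\<lambda>p. indicator \<Omega> p *\<^sub>R (w p * T n p))"
        using L2_mult_integrable[OF w TL2] by (simp add: set_integrable_def)
      have "\<bar>ip \<Omega> w (T n)\<bar> \<le> (LINT p|lborel. \<bar>indicator \<Omega> p *\<^sub>R (w p * T n p)\<bar>)"
        unfolding ip_def set_lebesgue_integral_def by (rule integral_abs_bound)
      also have "\<dots> \<le> (LINT p|lborel. K * (indicator A p + indicator B p))"
      proof (rule integral_mono_AE)
        show "AE p in lborel. \<bar>indicator \<Omega> p *\<^sub>R (w p * T n p)\<bar> \<le> K * (indicator A p + indicator B p)"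
          using eq
        proof eventually_elim
          case (elim p)
          then show ?case using bound[of p] K by (cases "p \<in> \<Omega>") auto
        qed
      qed (use wT int in auto)
      also have "\<dots> = K * (measure lborel A + measure lborel B)"
        unfolding A_def B_def by (subst Bochner_Integration.integral_mult_right_zero,
          subst Bochner_Integration.integral_add) (auto intro!: integrable_real_indicator fin)
      also have "\<dots> = \<epsilon> * (12 * (C * S * (d - c)))"
        using n0 by (simp add: meas K_def)
      also have "\<dots> < \<epsilon> * (12 * (C * S * (d - c) + 1))" using \<epsilon> by simp
      also have "\<dots> = r" using den by (simp add: \<epsilon>_def add_nonneg_eq_0_iff)
      finally show ?thesis .
    qed
    then show "\<exists>N. \<forall>n\<ge>N. norm (ip \<Omega> w (T n) - 0) < r" by auto
  qed
  then have "ip \<Omega> w (\<lambda>p. deriv g (fst p) * h (snd p)) = - ip \<Omega> z (\<lambda>p. g (fst p) * h (snd p))"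
    unfolding T_def[abs_def] by (rule ibp_boundary_term[OF g h])
  then show ?thesis by simp
qed

section \<open>The energy space of the plate\<close>

lemma AE_eq_sym: "AE x in M. x \<in> \<Omega> \<longrightarrow> f x = g x \<Longrightarrow> AE x in M. x \<in> \<Omega> \<longrightarrow> g x = f x"
  by (erule eventually_mono) auto

lemma in_Basis_real_prod: "(1::real, 0::real) \<in> Basis" "(0::real, 1::real) \<in> Basis"
  by (simp_all add: Basis_real_prod)

text \<open>The definition of \<open>sobolev_H 2\<close> provides some first derivative that can be differentiated again;
  by uniqueness the chosen representative can be, too.\<close>

lemma sobolev_H2_weak_partials:
  fixes a b c d :: real
  defines "\<Omega> \<equiv> {a<..<b} \<times> {c<..<d}"
  assumes u: "u \<in> sobolev_H 2 \<Omega>" and e: "e \<in> Basis" "e' \<in> Basis"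
  shows "u \<in> L2 \<Omega>" "weak_partial \<Omega> e u \<in> L2 \<Omega>" "has_weak_partial \<Omega> e u (weak_partial \<Omega> e u)"
    "weak_partial \<Omega> e' (weak_partial \<Omega> e u) \<in> L2 \<Omega>"
    "has_weak_partial \<Omega> e' (weak_partial \<Omega> e u) (weak_partial \<Omega> e' (weak_partial \<Omega> e u))"
proof -
  have u: "u \<in> L2 \<Omega>" "\<forall>b\<in>Basis. \<exists>g\<in>sobolev_H 1 \<Omega>. has_weak_partial \<Omega> b u g"
    using u by (auto simp: numeral_2_eq_2)
  then obtain g where g: "g \<in> sobolev_H 1 \<Omega>" "has_weak_partial \<Omega> e u g" using e by blast
  have gL2: "g \<in> L2 \<Omega>" and "\<exists>k\<in>L2 \<Omega>. has_weak_partial \<Omega> e' g k" using g(1) e by auto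
  then obtain k where k: "k \<in> L2 \<Omega>" "has_weak_partial \<Omega> e' g k" by blast
  show "u \<in> L2 \<Omega>" by fact
  note spec = weak_partial_spec[of a b c d, folded \<Omega>_def]
  show 1: "weak_partial \<Omega> e u \<in> L2 \<Omega>" "has_weak_partial \<Omega> e u (weak_partial \<Omega> e u)"
    using spec[OF g(2) gL2] by auto
  have "has_weak_partial \<Omega> e' (weak_partial \<Omega> e u) k"
    using has_weak_partial_cong_AE[of a b c d, folded \<Omega>_def, OF k(2) e(2) gL2 1(1) AE_eq_sym]
      spec(3)[OF g(2) gL2] by blast
  from spec[OF this k(1)]
  show "weak_partial \<Omega> e' (weak_partial \<Omega> e u) \<in> L2 \<Omega>"
    "has_weak_partial \<Omega> e' (weak_partial \<Omega> e u) (weak_partial \<Omega> e' (weak_partial \<Omega> e u))" by auto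
qed

lemma sobolev_H_subset_L2: "u \<in> sobolev_H k \<Omega> \<Longrightarrow> u \<in> L2 \<Omega>"
  by (cases k) auto

lemma sobolev_H_lin:
  fixes a b c d :: real
  defines "\<Omega> \<equiv> {a<..<b} \<times> {c<..<d}"
  assumes "u \<in> sobolev_H k \<Omega>" "v \<in> sobolev_H k \<Omega>"
  shows "(\<lambda>x. s * u x + t * v x) \<in> sobolev_H k \<Omega>"
  using assms(2,3)
proof (induction k arbitrary: u v)
  case 0
  then show ?case by (simp add: L2_lin)
next
  case (Suc k)
  have "\<exists>g\<in>sobolev_H k \<Omega>. has_weak_partial \<Omega> e (\<lambda>x. s * u x + t * v x) g" if e: "e \<in> Basis" for e
  proof -
    obtain g where g: "g \<in> sobolev_H k \<Omega>" "has_weak_partial \<Omega> e u g"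
      using Suc.prems(1) e unfolding sobolev_H.simps by blast
    obtain h where h: "h \<in> sobolev_H k \<Omega>" "has_weak_partial \<Omega> e v h"
      using Suc.prems(2) e unfolding sobolev_H.simps by blast
    note gh = g h
    have "has_weak_partial \<Omega> e (\<lambda>x. s * u x + t * v x) (\<lambda>x. s * g x + t * h x)"
      using has_weak_partial_lin[of a b c d, folded \<Omega>_def, OF gh(2,4) e] Suc.prems
        sobolev_H_subset_L2[OF g(1)] sobolev_H_subset_L2[OF h(1)] sobolev_H_subset_L2[OF Suc.prems(1)]
        sobolev_H_subset_L2[OF Suc.prems(2)]
      by blast
    then show ?thesis using Suc.IH[OF gh(1,3)] by blast
  qed
  then show ?case using Suc.prems by (auto intro: L2_lin)
qed

lemma weak_partial_lin:
  fixes a b c d :: real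
  defines "\<Omega> \<equiv> {a<..<b} \<times> {c<..<d}"
  assumes "e \<in> Basis" "u \<in> L2 \<Omega>" "v \<in> L2 \<Omega>" "g \<in> L2 \<Omega>" "h \<in> L2 \<Omega>"
    "has_weak_partial \<Omega> e u g" "has_weak_partial \<Omega> e v h"
    "u' \<in> L2 \<Omega>" "AE x in lborel. x \<in> \<Omega> \<longrightarrow> u' x = s * u x + t * v x"
  shows "AE x in lborel. x \<in> \<Omega> \<longrightarrow> weak_partial \<Omega> e u' x = s * g x + t * h x"
proof -
  have "has_weak_partial \<Omega> e (\<lambda>x. s * u x + t * v x) (\<lambda>x. s * g x + t * h x)"
    using has_weak_partial_lin[of a b c d, folded \<Omega>_def] assms by blast
  then have "has_weak_partial \<Omega> e u' (\<lambda>x. s * g x + t * h x)"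
    using has_weak_partial_cong_AE[of a b c d, folded \<Omega>_def, OF _ assms(2) L2_lin[OF assms(3,4)] assms(9)
        AE_eq_sym[OF assms(10)]] by blast
  then show ?thesis
    using weak_partial_spec(3)[of a b c d, folded \<Omega>_def] L2_lin[OF assms(5,6)] by blast
qed

lemma plate_measure: "plate L l \<in> sets borel" "emeasure lborel (plate L l) < \<infinity>"
  unfolding plate_def by (rule rectangle_measure)+

lemma H2_star_L2:
  assumes "u \<in> H2_star L l"
  shows "u \<in> L2 (plate L l)" "weak_partial (plate L l) (1, 0) u \<in> L2 (plate L l)"
    "weak_partial (plate L l) (0, 1) u \<in> L2 (plate L l)"
    "w_xx (plate L l) u \<in> L2 (plate L l)" "w_xy (plate L l) u \<in> L2 (plate L l)"
    "w_yy (plate L l) u \<in> L2 (plate L l)"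
  using assms sobolev_H2_weak_partials[of u 0 L "-l" l] in_Basis_real_prod
  unfolding w_xx_def w_xy_def w_yy_def H2_star_def plate_def by auto

lemma H2_star_weak_partial:
  assumes "u \<in> H2_star L l"
  shows "has_weak_partial (plate L l) (1, 0) u (weak_partial (plate L l) (1, 0) u)"
    "has_weak_partial (plate L l) (0, 1) u (weak_partial (plate L l) (0, 1) u)"
    "has_weak_partial (plate L l) (1, 0) (weak_partial (plate L l) (1, 0) u) (w_xx (plate L l) u)"
    "has_weak_partial (plate L l) (0, 1) (weak_partial (plate L l) (1, 0) u) (w_xy (plate L l) u)"
    "has_weak_partial (plate L l) (0, 1) (weak_partial (plate L l) (0, 1) u) (w_yy (plate L l) u)"
  using assms sobolev_H2_weak_partials[of u 0 L "-l" l] in_Basis_real_prod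
  unfolding w_xx_def w_xy_def w_yy_def H2_star_def plate_def by auto

lemma H2_star_lin:
  assumes "u \<in> H2_star L l" "v \<in> H2_star L l"
  shows "(\<lambda>x. s * u x + t * v x) \<in> H2_star L l"
proof -
  obtain u' where u': "continuous_on (closure (plate L l)) u'" "AE x in lborel. x \<in> plate L l \<longrightarrow> u' x = u x"
    "\<forall>x \<in> {0, L} \<times> {-l<..<l}. u' x = 0" using assms(1) unfolding H2_star_def by blast
  obtain v' where v': "continuous_on (closure (plate L l)) v'" "AE x in lborel. x \<in> plate L l \<longrightarrow> v' x = v x"
    "\<forall>x \<in> {0, L} \<times> {-l<..<l}. v' x = 0" using assms(2) unfolding H2_star_def by blast
  have "continuous_on (closure (plate L l)) (\<lambda>x. s * u' x + t * v' x)"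
    using u' v' by (intro continuous_intros)
  moreover have "AE x in lborel. x \<in> plate L l \<longrightarrow> s * u' x + t * v' x = s * u x + t * v x"
    using u'(2) v'(2) by eventually_elim simp
  moreover have "\<forall>x \<in> {0, L} \<times> {-l<..<l}. s * u' x + t * v' x = 0" using u'(3) v'(3) by auto
  moreover have "(\<lambda>x. s * u x + t * v x) \<in> sobolev_H 2 (plate L l)"
    using assms sobolev_H_lin[of u 2 0 L "-l" l v s t] unfolding H2_star_def plate_def by auto
  ultimately show ?thesis unfolding H2_star_def by blast
qed

lemma second_partials_lin:
  assumes u: "u \<in> H2_star L l" and v: "v \<in> H2_star L l"
  shows "AE x in lborel. x \<in> plate L l \<longrightarrow>
      w_xx (plate L l) (\<lambda>x. s * u x + t * v x) x = s * w_xx (plate L l) u x + t * w_xx (plate L l) v x"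
    "AE x in lborel. x \<in> plate L l \<longrightarrow>
      w_xy (plate L l) (\<lambda>x. s * u x + t * v x) x = s * w_xy (plate L l) u x + t * w_xy (plate L l) v x"
    "AE x in lborel. x \<in> plate L l \<longrightarrow>
      w_yy (plate L l) (\<lambda>x. s * u x + t * v x) x = s * w_yy (plate L l) u x + t * w_yy (plate L l) v x"
proof -
  let ?\<Omega> = "plate L l" and ?w = "\<lambda>x. s * u x + t * v x"
  have w: "?w \<in> H2_star L l" by (rule H2_star_lin[OF u v])
  note lin = weak_partial_lin[where a=0 and b=L and c="-l" and d=l, folded plate_def]
  have x: "AE x in lborel. x \<in> ?\<Omega> \<longrightarrow> weak_partial ?\<Omega> (1, 0) ?w x
      = s * weak_partial ?\<Omega> (1, 0) u x + t * weak_partial ?\<Omega> (1, 0) v x"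
    by (rule lin[where u=u and v=v]) (use H2_star_L2[OF u] H2_star_L2[OF v] H2_star_L2[OF w]
      H2_star_weak_partial[OF u] H2_star_weak_partial[OF v] in_Basis_real_prod in auto)
  have y: "AE x in lborel. x \<in> ?\<Omega> \<longrightarrow> weak_partial ?\<Omega> (0, 1) ?w x
      = s * weak_partial ?\<Omega> (0, 1) u x + t * weak_partial ?\<Omega> (0, 1) v x"
    by (rule lin[where u=u and v=v]) (use H2_star_L2[OF u] H2_star_L2[OF v] H2_star_L2[OF w]
      H2_star_weak_partial[OF u] H2_star_weak_partial[OF v] in_Basis_real_prod in auto)
  show "AE x in lborel. x \<in> ?\<Omega> \<longrightarrow> w_xx ?\<Omega> ?w x = s * w_xx ?\<Omega> u x + t * w_xx ?\<Omega> v x"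
    unfolding w_xx_def[of _ ?w]
    by (rule lin[OF in_Basis_real_prod(1) _ _ _ _ _ _ _ x]) (use H2_star_L2[OF u] H2_star_L2[OF v] H2_star_L2[OF w]
      H2_star_weak_partial[OF u] H2_star_weak_partial[OF v] in auto)
  show "AE x in lborel. x \<in> ?\<Omega> \<longrightarrow> w_xy ?\<Omega> ?w x = s * w_xy ?\<Omega> u x + t * w_xy ?\<Omega> v x"
    unfolding w_xy_def[of _ ?w]
    by (rule lin[OF in_Basis_real_prod(2) _ _ _ _ _ _ _ x]) (use H2_star_L2[OF u] H2_star_L2[OF v] H2_star_L2[OF w]
      H2_star_weak_partial[OF u] H2_star_weak_partial[OF v] in auto)
  show "AE x in lborel. x \<in> ?\<Omega> \<longrightarrow> w_yy ?\<Omega> ?w x = s * w_yy ?\<Omega> u x + t * w_yy ?\<Omega> v x"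
    unfolding w_yy_def[of _ ?w]
    by (rule lin[OF in_Basis_real_prod(2) _ _ _ _ _ _ _ y]) (use H2_star_L2[OF u] H2_star_L2[OF v] H2_star_L2[OF w]
      H2_star_weak_partial[OF u] H2_star_weak_partial[OF v] in auto)
qed

lemma plate_form_eq:
  fixes L l d K \<nu> \<kappa> :: real
  defines "\<Omega> \<equiv> plate L l"
  assumes u: "u \<in> H2_star L l" and v: "v \<in> H2_star L l"
  shows "plate_form d K \<nu> \<kappa> \<Omega> u v = d^3 * K / 12 *
    ((1 + \<kappa>) * ip \<Omega> (w_xx \<Omega> u) (w_xx \<Omega> v) + \<nu> * ip \<Omega> (w_xx \<Omega> u) (w_yy \<Omega> v)
     + \<nu> * ip \<Omega> (w_yy \<Omega> u) (w_xx \<Omega> v) + ip \<Omega> (w_yy \<Omega> u) (w_yy \<Omega> v)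
     + 2 * (1 - \<nu>) * ip \<Omega> (w_xy \<Omega> u) (w_xy \<Omega> v))"
proof -
  note L2 = H2_star_L2[OF u, folded \<Omega>_def] H2_star_L2[OF v, folded \<Omega>_def]
  have i: "set_integrable lborel \<Omega> (\<lambda>p. r * (f p * g p))" if "f \<in> L2 \<Omega>" "g \<in> L2 \<Omega>" for r and f g :: "real \<times> real \<Rightarrow> real"
    using L2_mult_integrable[OF that] by simp
  have "(\<lambda>p. \<nu> * laplace \<Omega> u p * laplace \<Omega> v p
        + (1 - \<nu>) * hessian_prod \<Omega> u v p + \<kappa> * w_xx \<Omega> u p * w_xx \<Omega> v p)
    = (\<lambda>p. (1 + \<kappa>) * (w_xx \<Omega> u p * w_xx \<Omega> v p) + \<nu> * (w_xx \<Omega> u p * w_yy \<Omega> v p)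
        + \<nu> * (w_yy \<Omega> u p * w_xx \<Omega> v p) + 1 * (w_yy \<Omega> u p * w_yy \<Omega> v p)
        + 2 * (1 - \<nu>) * (w_xy \<Omega> u p * w_xy \<Omega> v p))"
    by (rule ext) (simp add: laplace_def hessian_prod_def algebra_simps)
  then show ?thesis
    unfolding plate_form_def ip_def
    using L2 by (simp add: set_integral_add i L2_mult_integrable)
qed

lemma plate_form_commute: "plate_form d K \<nu> \<kappa> \<Omega> u v = plate_form d K \<nu> \<kappa> \<Omega> v u"
  by (simp add: plate_form_def hessian_prod_def mult_ac)

lemma plate_form_lin:
  assumes u: "u \<in> H2_star L l" and v: "v \<in> H2_star L l" and w: "w \<in> H2_star L l"
  shows "plate_form d K \<nu> \<kappa> (plate L l) (\<lambda>x. s * u x + t * v x) w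
    = s * plate_form d K \<nu> \<kappa> (plate L l) u w + t * plate_form d K \<nu> \<kappa> (plate L l) v w"
proof -
  let ?\<Omega> = "plate L l" and ?U = "\<lambda>x. s * u x + t * v x"
  have U: "?U \<in> H2_star L l" by (rule H2_star_lin[OF u v])
  note L2 = H2_star_L2[OF u] H2_star_L2[OF v] H2_star_L2[OF w] H2_star_L2[OF U]
  have *: "ip ?\<Omega> F z = s * ip ?\<Omega> f z + t * ip ?\<Omega> g z"
    if "F \<in> L2 ?\<Omega>" "f \<in> L2 ?\<Omega>" "g \<in> L2 ?\<Omega>" "z \<in> L2 ?\<Omega>"
      "AE x in lborel. x \<in> ?\<Omega> \<longrightarrow> F x = s * f x + t * g x" for F f g z
  proof -
    have "ip ?\<Omega> F z = ip ?\<Omega> (\<lambda>x. s * f x + t * g x) z"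
      using that by (intro ip_cong_AE L2_lin) auto
    then show ?thesis using ip_lin[OF that(2-4)] by simp
  qed
  note sp = second_partials_lin[OF u v, of s t]
  show ?thesis
    unfolding plate_form_eq[OF U w] plate_form_eq[OF u w] plate_form_eq[OF v w]
    using L2 by (simp add: *[OF _ _ _ _ sp(1)] *[OF _ _ _ _ sp(2)] *[OF _ _ _ _ sp(3)] algebra_simps)
qed

section \<open>Integration by parts in the energy space\<close>

text \<open>The first and the last three identities need a smooth factor that vanishes on the two edges
  normal to the direction of differentiation. For the second one the condition \<open>u = 0\<close> on the
  hinged edges does the same job, and the smooth factors are arbitrary.\<close>

lemma H2_star_ibp:
  fixes L l :: real
  defines "\<Omega> \<equiv> plate L l"
  assumes "0 < L" "0 < l" and u: "u \<in> H2_star L l" and g: "smooth g" and h: "smooth h"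
  shows ibp_xx: "g 0 = 0 \<Longrightarrow> g L = 0 \<Longrightarrow> ip \<Omega> (w_xx \<Omega> u) (\<lambda>p. g (fst p) * h (snd p))
      = - ip \<Omega> (weak_partial \<Omega> (1, 0) u) (\<lambda>p. deriv g (fst p) * h (snd p))"
    and ibp_x: "ip \<Omega> (weak_partial \<Omega> (1, 0) u) (\<lambda>p. g (fst p) * h (snd p))
      = - ip \<Omega> u (\<lambda>p. deriv g (fst p) * h (snd p))"
    and ibp_yy: "h (- l) = 0 \<Longrightarrow> h l = 0 \<Longrightarrow> ip \<Omega> (w_yy \<Omega> u) (\<lambda>p. g (fst p) * h (snd p))
      = - ip \<Omega> (weak_partial \<Omega> (0, 1) u) (\<lambda>p. g (fst p) * deriv h (snd p))"
    and ibp_y: "h (- l) = 0 \<Longrightarrow> h l = 0 \<Longrightarrow> ip \<Omega> (weak_partial \<Omega> (0, 1) u) (\<lambda>p. g (fst p) * h (snd p))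
      = - ip \<Omega> u (\<lambda>p. g (fst p) * deriv h (snd p))"
    and ibp_xy: "h (- l) = 0 \<Longrightarrow> h l = 0 \<Longrightarrow> ip \<Omega> (w_xy \<Omega> u) (\<lambda>p. g (fst p) * h (snd p))
      = - ip \<Omega> (weak_partial \<Omega> (1, 0) u) (\<lambda>p. g (fst p) * deriv h (snd p))"
proof -
  note wp = H2_star_weak_partial[OF u] and L2 = H2_star_L2[OF u]
  show "ip \<Omega> (w_xx \<Omega> u) (\<lambda>p. g (fst p) * h (snd p))
      = - ip \<Omega> (weak_partial \<Omega> (1, 0) u) (\<lambda>p. deriv g (fst p) * h (snd p))" if "g 0 = 0" "g L = 0"
    using weak_ibp_x[of 0 L "-l" l, folded plate_def, OF wp(3) L2(2,4) g h that] by (simp add: \<Omega>_def)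
  obtain u' where u': "continuous_on (closure \<Omega>) u'" "AE x in lborel. x \<in> \<Omega> \<longrightarrow> u' x = u x"
    "\<forall>x \<in> {0, L} \<times> {-l<..<l}. u' x = 0" using u unfolding H2_star_def \<Omega>_def by blast
  show "ip \<Omega> (weak_partial \<Omega> (1, 0) u) (\<lambda>p. g (fst p) * h (snd p))
      = - ip \<Omega> u (\<lambda>p. deriv g (fst p) * h (snd p))"
    unfolding \<Omega>_def
    by (rule weak_ibp_x_zero_trace[of 0 L "-l" l, folded plate_def, OF assms(2) _ wp(1) L2(1,2)
          u'(1)[unfolded \<Omega>_def] u'(2)[unfolded \<Omega>_def] _ g h]) (use u'(3) assms(3) in auto)
  show "ip \<Omega> (w_yy \<Omega> u) (\<lambda>p. g (fst p) * h (snd p))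
      = - ip \<Omega> (weak_partial \<Omega> (0, 1) u) (\<lambda>p. g (fst p) * deriv h (snd p))" if "h (- l) = 0" "h l = 0"
    using weak_ibp_y[of 0 L "-l" l, folded plate_def, OF wp(5) L2(3,6) g h that] by (simp add: \<Omega>_def)
  show "ip \<Omega> (weak_partial \<Omega> (0, 1) u) (\<lambda>p. g (fst p) * h (snd p))
      = - ip \<Omega> u (\<lambda>p. g (fst p) * deriv h (snd p))" if "h (- l) = 0" "h l = 0"
    using weak_ibp_y[of 0 L "-l" l, folded plate_def, OF wp(2) L2(1,3) g h that] by (simp add: \<Omega>_def)
  show "ip \<Omega> (w_xy \<Omega> u) (\<lambda>p. g (fst p) * h (snd p))
      = - ip \<Omega> (weak_partial \<Omega> (1, 0) u) (\<lambda>p. g (fst p) * deriv h (snd p))" if "h (- l) = 0" "h l = 0"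
    using weak_ibp_y[of 0 L "-l" l, folded plate_def, OF wp(4) L2(2,5) g h that] by (simp add: \<Omega>_def)
qed

text \<open>The mixed derivative is also the weak \<open>x\<close>-derivative of \<open>u\<^sub>y\<close>, and since
  \<open>u\<^sub>y\<close> vanishes on the hinged edges there is no boundary term at all. For a factor vanishing
  at \<open>y = \<plusminus>l\<close> this follows by moving the derivatives through \<open>u\<close>; cutoffs in \<open>y\<close> do the
  rest.\<close>

lemma ibp_xy_x:
  fixes L l :: real
  defines "\<Omega> \<equiv> plate L l"
  assumes Ll: "0 < L" "0 < l" and u: "u \<in> H2_star L l" and g: "smooth g" and h: "smooth h"
  shows "ip \<Omega> (w_xy \<Omega> u) (\<lambda>p. g (fst p) * h (snd p))
      = - ip \<Omega> (weak_partial \<Omega> (0, 1) u) (\<lambda>p. deriv g (fst p) * h (snd p))"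
proof -
  define hn where "hn n y = h y * cut (-l) l n y" for n y
  have hn: "smooth (hn n)" for n unfolding hn_def using h smooth_cut by (rule smooth_mult)
  have h0: "hn n (-l) = 0" "hn n l = 0" for n by (auto simp: hn_def cut_eq_0_outside)
  have dg: "smooth (deriv g)" using smooth_has_deriv(2)[OF g] .
  note ibp = H2_star_ibp[of L l u, folded \<Omega>_def, OF Ll u]
  have eq: "ip \<Omega> (w_xy \<Omega> u) (\<lambda>p. g (fst p) * hn n (snd p))
      = - ip \<Omega> (weak_partial \<Omega> (0, 1) u) (\<lambda>p. deriv g (fst p) * hn n (snd p))" for n
    using ibp(5)[OF g hn h0] ibp(2)[OF g smooth_has_deriv(2)[OF hn]] ibp(4)[OF dg hn h0] by simp
  have lim: "(\<lambda>n. ip \<Omega> v (\<lambda>p. f (fst p) * hn n (snd p))) \<longlonglongrightarrow> ip \<Omega> v (\<lambda>p. f (fst p) * h (snd p))"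
    if v: "v \<in> L2 \<Omega>" and f: "smooth f" for v f
  proof -
    obtain A where A: "A \<ge> 0" "\<And>x. x \<in> {0..L} \<Longrightarrow> \<bar>f x\<bar> \<le> A" using smooth_bounded[OF f] by blast
    obtain B where B: "B \<ge> 0" "\<And>x. x \<in> {-l..l} \<Longrightarrow> \<bar>h x\<bar> \<le> B" using smooth_bounded[OF h] by blast
    show ?thesis
    proof (rule ip_tendsto[OF plate_measure[of L l, folded \<Omega>_def] v])
      show "\<bar>f (fst p) * hn n (snd p)\<bar> \<le> A * (B * 1)" if "p \<in> \<Omega>" for n p
        unfolding hn_def abs_mult using that A B cut_bounds[of "-l" l n "snd p"]
        by (intro mult_mono) (auto simp: \<Omega>_def plate_def)
      fix p assume "p \<in> \<Omega>"
      then have p: "snd p \<in> {-l<..<l}" by (auto simp: \<Omega>_def plate_def)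
      have "\<forall>\<^sub>F n in sequentially. f (fst p) * h (snd p) = f (fst p) * hn n (snd p)"
        using cut_eventually_eq_1[OF p] by eventually_elim (simp add: hn_def)
      then show "(\<lambda>n. f (fst p) * hn n (snd p)) \<longlonglongrightarrow> f (fst p) * h (snd p)"
        by (rule Lim_transform_eventually[OF tendsto_const])
    qed (use f h hn in \<open>auto intro!: tensor_measurable smooth_measurable\<close>)
  qed
  have "(\<lambda>n. ip \<Omega> (w_xy \<Omega> u) (\<lambda>p. g (fst p) * hn n (snd p)))
      \<longlonglongrightarrow> - ip \<Omega> (weak_partial \<Omega> (0, 1) u) (\<lambda>p. deriv g (fst p) * h (snd p))"
    unfolding eq by (intro tendsto_minus lim dg) (use H2_star_L2[OF u] in \<open>simp add: \<Omega>_def\<close>)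
  moreover have "(\<lambda>n. ip \<Omega> (w_xy \<Omega> u) (\<lambda>p. g (fst p) * hn n (snd p)))
      \<longlonglongrightarrow> ip \<Omega> (w_xy \<Omega> u) (\<lambda>p. g (fst p) * h (snd p))"
    by (intro lim g) (use H2_star_L2[OF u] in \<open>simp add: \<Omega>_def\<close>)
  ultimately show ?thesis by (rule LIMSEQ_unique[rotated])
qed

section \<open>Orthogonal expansions\<close>

lemma ip_expansion:
  fixes u :: "'a::euclidean_space \<Rightarrow> real" and b :: "'i \<Rightarrow> real" and e :: "'i \<Rightarrow> 'a \<Rightarrow> real" and F
  defines "v \<equiv> \<lambda>x. u x - (\<Sum>i\<in>F. b i * e i x)"
  assumes F: "finite F" and e: "\<And>i. i \<in> F \<Longrightarrow> e i \<in> L2 \<Omega>" and u: "u \<in> L2 \<Omega>"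
    and orth: "\<And>i j. i \<in> F \<Longrightarrow> j \<in> F \<Longrightarrow> i \<noteq> j \<Longrightarrow> ip \<Omega> (e i) (e j) = 0"
  shows "v \<in> L2 \<Omega>"
    and "ip \<Omega> v v = ip \<Omega> u u - 2 * (\<Sum>i\<in>F. b i * ip \<Omega> u (e i)) + (\<Sum>i\<in>F. (b i)\<^sup>2 * ip \<Omega> (e i) (e i))"
proof -
  define f where "f x = (\<Sum>i\<in>F. b i * e i x)" for x
  have f: "f \<in> L2 \<Omega>" unfolding f_def[abs_def] by (rule L2_sum[OF F e])
  have v: "v = (\<lambda>x. 1 * u x + (-1) * f x)" by (simp add: v_def f_def)
  show vL2: "v \<in> L2 \<Omega>" unfolding v by (rule L2_lin[OF u f])
  have fw: "ip \<Omega> f w = (\<Sum>i\<in>F. b i * ip \<Omega> (e i) w)" if "w \<in> L2 \<Omega>" for w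
    unfolding f_def[abs_def] by (rule ip_sum[OF F e that])
  have fe: "ip \<Omega> f (e i) = b i * ip \<Omega> (e i) (e i)" if i: "i \<in> F" for i
  proof -
    have "ip \<Omega> f (e i) = (\<Sum>j\<in>F. if j = i then b i * ip \<Omega> (e i) (e i) else 0)"
      unfolding fw[OF e[OF i]] using orth i by (intro sum.cong) auto
    then show ?thesis using F i by simp
  qed
  have ff: "ip \<Omega> f f = (\<Sum>i\<in>F. (b i)\<^sup>2 * ip \<Omega> (e i) (e i))"
    unfolding fw[OF f] by (intro sum.cong refl) (simp add: ip_commute[of \<Omega> "e _" f] fe power2_eq_square)
  have fu: "ip \<Omega> f u = (\<Sum>i\<in>F. b i * ip \<Omega> u (e i))"
    unfolding fw[OF u] by (simp add: ip_commute)
  have vw: "ip \<Omega> v w = ip \<Omega> u w - ip \<Omega> f w" if "w \<in> L2 \<Omega>" for w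
    using ip_lin[OF u f that, of 1 "-1"] by (simp add: v)
  have "ip \<Omega> v v = ip \<Omega> v u - ip \<Omega> v f"
    using vw[OF vL2] ip_commute[of \<Omega> u v] ip_commute[of \<Omega> f v] by simp
  moreover have "ip \<Omega> v u = ip \<Omega> u u - ip \<Omega> f u" by (rule vw[OF u])
  moreover have "ip \<Omega> v f = ip \<Omega> f u - ip \<Omega> f f"
    using vw[OF f] ip_commute[of \<Omega> u f] by simp
  ultimately show "ip \<Omega> v v = ip \<Omega> u u - 2 * (\<Sum>i\<in>F. b i * ip \<Omega> u (e i)) + (\<Sum>i\<in>F. (b i)\<^sup>2 * ip \<Omega> (e i) (e i))"
    using ff fu by simp
qed

lemma bessel_inequality:
  assumes F: "finite F" and e: "\<And>i. i \<in> F \<Longrightarrow> e i \<in> L2 \<Omega>" and u: "u \<in> L2 \<Omega>"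
    and orth: "\<And>i j. i \<in> F \<Longrightarrow> j \<in> F \<Longrightarrow> i \<noteq> j \<Longrightarrow> ip \<Omega> (e i) (e j) = 0"
    and pos: "\<And>i. i \<in> F \<Longrightarrow> ip \<Omega> (e i) (e i) > 0"
  shows "(\<Sum>i\<in>F. (ip \<Omega> u (e i))\<^sup>2 / ip \<Omega> (e i) (e i)) \<le> ip \<Omega> u u"
proof -
  define b where "b i = ip \<Omega> u (e i) / ip \<Omega> (e i) (e i)" for i
  have "0 \<le> ip \<Omega> u u - 2 * (\<Sum>i\<in>F. b i * ip \<Omega> u (e i)) + (\<Sum>i\<in>F. (b i)\<^sup>2 * ip \<Omega> (e i) (e i))"
    using ip_expansion(2)[OF F e u orth, where b=b] ip_nonneg[of \<Omega> "\<lambda>x. u x - (\<Sum>i\<in>F. b i * e i x)"]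
    by simp
  also have "(\<Sum>i\<in>F. (b i)\<^sup>2 * ip \<Omega> (e i) (e i)) = (\<Sum>i\<in>F. (ip \<Omega> u (e i))\<^sup>2 / ip \<Omega> (e i) (e i))"
  proof (rule sum.cong[OF refl])
    fix i assume "i \<in> F"
    from pos[OF this] show "(b i)\<^sup>2 * ip \<Omega> (e i) (e i) = (ip \<Omega> u (e i))\<^sup>2 / ip \<Omega> (e i) (e i)"
      by (simp add: b_def power2_eq_square)
  qed
  also have "(\<Sum>i\<in>F. b i * ip \<Omega> u (e i)) = (\<Sum>i\<in>F. (ip \<Omega> u (e i))\<^sup>2 / ip \<Omega> (e i) (e i))"
    by (simp add: b_def power2_eq_square)
  finally show ?thesis by simp
qed

text \<open>Completing the square shows that no combination of the \<open>e i\<close> is closer to \<open>u\<close> than the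
  orthogonal projection.\<close>

lemma best_approximation:
  assumes F: "finite F" and e: "\<And>i. i \<in> F \<Longrightarrow> e i \<in> L2 \<Omega>" and u: "u \<in> L2 \<Omega>"
    and orth: "\<And>i j. i \<in> F \<Longrightarrow> j \<in> F \<Longrightarrow> i \<noteq> j \<Longrightarrow> ip \<Omega> (e i) (e j) = 0"
    and pos: "\<And>i. i \<in> F \<Longrightarrow> ip \<Omega> (e i) (e i) > 0"
  shows "ip \<Omega> u u \<le> ip \<Omega> (\<lambda>x. u x - (\<Sum>i\<in>F. b i * e i x)) (\<lambda>x. u x - (\<Sum>i\<in>F. b i * e i x))
    + (\<Sum>i\<in>F. (ip \<Omega> u (e i))\<^sup>2 / ip \<Omega> (e i) (e i))"
proof -
  have "2 * (\<Sum>i\<in>F. b i * ip \<Omega> u (e i)) - (\<Sum>i\<in>F. (b i)\<^sup>2 * ip \<Omega> (e i) (e i))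
      = (\<Sum>i\<in>F. 2 * (b i * ip \<Omega> u (e i)) - (b i)\<^sup>2 * ip \<Omega> (e i) (e i))"
    by (simp add: sum_distrib_left sum_subtractf)
  also have "\<dots> \<le> (\<Sum>i\<in>F. (ip \<Omega> u (e i))\<^sup>2 / ip \<Omega> (e i) (e i))"
  proof (rule sum_mono)
    fix i assume "i \<in> F"
    define N A where "N = ip \<Omega> (e i) (e i)" and "A = ip \<Omega> u (e i)"
    have "N > 0" using pos[OF \<open>i \<in> F\<close>] by (simp add: N_def)
    then have "A\<^sup>2 / N - (2 * (b i * A) - (b i)\<^sup>2 * N) = (A - b i * N)\<^sup>2 / N"
      by (simp add: power2_eq_square field_simps)
    also have "\<dots> \<ge> 0" using \<open>N > 0\<close> by simp
    finally show "2 * (b i * ip \<Omega> u (e i)) - (b i)\<^sup>2 * ip \<Omega> (e i) (e i)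
        \<le> (ip \<Omega> u (e i))\<^sup>2 / ip \<Omega> (e i) (e i)" by (simp add: N_def A_def)
  qed
  finally show ?thesis using ip_expansion(2)[OF F e u orth, where b=b] by simp
qed

lemma ip_diff_le:
  assumes u: "u \<in> L2 \<Omega>" and v: "v \<in> L2 \<Omega>" and w: "w \<in> L2 \<Omega>"
  shows "ip \<Omega> (\<lambda>x. u x - w x) (\<lambda>x. u x - w x)
    \<le> 2 * ip \<Omega> (\<lambda>x. u x - v x) (\<lambda>x. u x - v x) + 2 * ip \<Omega> (\<lambda>x. v x - w x) (\<lambda>x. v x - w x)"
proof -
  define f g where "f = (\<lambda>x. u x - v x)" and "g = (\<lambda>x. v x - w x)"
  have f: "f \<in> L2 \<Omega>" and g: "g \<in> L2 \<Omega>"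
    using L2_lin[OF u v, of 1 "-1"] L2_lin[OF v w, of 1 "-1"] by (simp_all add: f_def g_def)
  have *: "ip \<Omega> (\<lambda>x. 1 * f x + t * g x) (\<lambda>x. 1 * f x + t * g x)
      = ip \<Omega> f f + 2 * t * ip \<Omega> f g + t\<^sup>2 * ip \<Omega> g g" for t
  proof -
    let ?h = "\<lambda>x. 1 * f x + t * g x"
    have "ip \<Omega> ?h ?h = 1 * ip \<Omega> f ?h + t * ip \<Omega> g ?h"
      by (rule ip_lin[OF f g L2_lin[OF f g]])
    moreover have "ip \<Omega> f ?h = 1 * ip \<Omega> f f + t * ip \<Omega> g f"
      using ip_lin[OF f g f, of 1 t] by (simp only: ip_commute[of _ f ?h])
    moreover have "ip \<Omega> g ?h = 1 * ip \<Omega> f g + t * ip \<Omega> g g"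
      using ip_lin[OF f g g, of 1 t] by (simp only: ip_commute[of _ g ?h])
    ultimately show ?thesis
      using ip_commute[of \<Omega> g f] by (simp add: power2_eq_square algebra_simps)
  qed
  have "0 \<le> ip \<Omega> (\<lambda>x. 1 * f x + (-1) * g x) (\<lambda>x. 1 * f x + (-1) * g x)" by (rule ip_nonneg)
  then have "2 * ip \<Omega> f g \<le> ip \<Omega> f f + ip \<Omega> g g" unfolding * by simp
  moreover have "(\<lambda>x. u x - w x) = (\<lambda>x. 1 * f x + 1 * g x)" by (simp add: f_def g_def)
  ultimately show ?thesis unfolding f_def[symmetric] g_def[symmetric] by (simp only: *) simp
qed

section \<open>Trigonometric systems on a rectangle\<close>

definition tfreq :: "real \<Rightarrow> real \<Rightarrow> nat \<Rightarrow> real" where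
  "tfreq a b k = real k * pi / (b - a)"

definition tsin :: "real \<Rightarrow> real \<Rightarrow> nat \<Rightarrow> real \<Rightarrow> real" where
  "tsin a b k x = sin (tfreq a b k * (x - a))"

definition tcos :: "real \<Rightarrow> real \<Rightarrow> nat \<Rightarrow> real \<Rightarrow> real" where
  "tcos a b k x = cos (tfreq a b k * (x - a))"

lemma smooth_tsin: "smooth (tsin a b k)" and smooth_tcos: "smooth (tcos a b k)"
  unfolding tsin_def[abs_def] tcos_def[abs_def] by (rule smooth_sin smooth_cos)+

lemma deriv_tsin: "deriv (tsin a b k) = (\<lambda>x. tfreq a b k * tcos a b k x)"
  unfolding tsin_def[abs_def] tcos_def[abs_def]
  by (rule ext, rule DERIV_imp_deriv) (auto intro!: derivative_eq_intros)

lemma deriv_tcos: "deriv (tcos a b k) = (\<lambda>x. - tfreq a b k * tsin a b k x)"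
  unfolding tsin_def[abs_def] tcos_def[abs_def]
  by (rule ext, rule DERIV_imp_deriv) (auto intro!: derivative_eq_intros)

lemma tsin_ends: "tsin a b k a = 0" "a < b \<Longrightarrow> tsin a b k b = 0"
  by (auto simp: tsin_def tfreq_def)

lemma integral_Ioo_FTC:
  fixes f F :: "real \<Rightarrow> real"
  assumes "a \<le> b" "\<And>x. (F has_real_derivative f x) (at x)" "continuous_on UNIV f"
  shows "(LINT x:{a<..<b}|lborel. f x) = F b - F a"
proof -
  have f: "f \<in> borel_measurable borel" using assms(3) by (rule borel_measurable_continuous_onI)
  have "(LINT x:{a<..<b}|lborel. f x) = (LINT x|lborel. f x * indicator {a..b} x)"
    unfolding set_lebesgue_integral_def
  proof (rule integral_cong_AE)
    show "AE x in lborel. indicator {a<..<b} x *\<^sub>R f x = f x * indicator {a..b} x"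
      using AE_lborel_singleton[of a] AE_lborel_singleton[of b]
      by eventually_elim (auto simp: indicator_def)
  qed (use f in measurable)
  also have "\<dots> = F b - F a"
    using assms by (intro integral_FTC_Icc_real) (auto simp: continuous_on_eq_continuous_at)
  finally show ?thesis .
qed

lemma integral_cos_multiple:
  fixes m :: int
  assumes "a < b"
  shows "(LINT x:{a<..<b}|lborel. cos (of_int m * pi / (b - a) * (x - a))) = (if m = 0 then b - a else 0)"
proof (cases "m = 0")
  case True
  then show ?thesis using assms integral_Ioo_FTC[of a b "\<lambda>x. x" "\<lambda>x. 1"] by simp
next
  case False
  define w where "w = of_int m * pi / (b - a)"
  have w: "w \<noteq> 0" using False assms by (simp add: w_def)
  have "(LINT x:{a<..<b}|lborel. cos (w * (x - a))) = sin (w * (b - a)) / w - sin (w * (a - a)) / w"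
    using w assms by (intro integral_Ioo_FTC) (auto intro!: derivative_eq_intros continuous_intros)
  also have "w * (b - a) = of_int m * pi" using assms by (simp add: w_def)
  also have "sin (of_int m * pi) = 0" by (simp add: sin_zero_iff_int2)
  finally show ?thesis using False by (simp add: w_def)
qed

lemma continuous_set_integrable:
  fixes f :: "real \<Rightarrow> real"
  assumes "continuous_on UNIV f" shows "set_integrable lborel {a<..<b} f"
  by (rule set_integrable_subset[OF borel_integrable_atLeastAtMost'[of a b f]])
    (use assms continuous_on_subset in auto)

lemma integral_tsin_tsin:
  assumes "a < b" "k \<noteq> 0"
  shows "(LINT x:{a<..<b}|lborel. tsin a b k x * tsin a b k' x) = (if k = k' then (b - a) / 2 else 0)"
proof -
  let ?c = "\<lambda>m x. cos (of_int m * pi / (b - a) * (x - a))"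
  have 1: "tfreq a b k * (x - a) - tfreq a b k' * (x - a) = of_int (int k - int k') * pi / (b - a) * (x - a)"
    "tfreq a b k * (x - a) + tfreq a b k' * (x - a) = of_int (int k + int k') * pi / (b - a) * (x - a)" for x
    by (simp_all add: tfreq_def algebra_simps diff_divide_distrib add_divide_distrib)
  have "tsin a b k x * tsin a b k' x = ?c (int k - int k') x / 2 - ?c (int k + int k') x / 2" for x
    unfolding tsin_def sin_times_sin 1 by (simp add: diff_divide_distrib)
  then have "(LINT x:{a<..<b}|lborel. tsin a b k x * tsin a b k' x)
      = (LINT x:{a<..<b}|lborel. ?c (int k - int k') x / 2) - (LINT x:{a<..<b}|lborel. ?c (int k + int k') x / 2)"
    by (simp only:) (intro set_integral_diff continuous_set_integrable; use assms in \<open>auto intro!: continuous_intros\<close>)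
  also have "\<dots> = (if k = k' then (b - a) / 2 else 0)"
    unfolding set_integral_divide_zero integral_cos_multiple[OF \<open>a < b\<close>] using assms by auto
  finally show ?thesis .
qed

lemma integral_tcos_tcos:
  assumes "a < b"
  shows "(LINT x:{a<..<b}|lborel. tcos a b k x * tcos a b k' x)
    = (if k = k' then if k = 0 then b - a else (b - a) / 2 else 0)"
proof -
  let ?c = "\<lambda>m x. cos (of_int m * pi / (b - a) * (x - a))"
  have 1: "tfreq a b k * (x - a) - tfreq a b k' * (x - a) = of_int (int k - int k') * pi / (b - a) * (x - a)"
    "tfreq a b k * (x - a) + tfreq a b k' * (x - a) = of_int (int k + int k') * pi / (b - a) * (x - a)" for x
    by (simp_all add: tfreq_def algebra_simps diff_divide_distrib add_divide_distrib)
  have "tcos a b k x * tcos a b k' x = ?c (int k - int k') x / 2 + ?c (int k + int k') x / 2" for x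
    unfolding tcos_def cos_times_cos 1 by (simp add: add_divide_distrib)
  then have "(LINT x:{a<..<b}|lborel. tcos a b k x * tcos a b k' x)
      = (LINT x:{a<..<b}|lborel. ?c (int k - int k') x / 2) + (LINT x:{a<..<b}|lborel. ?c (int k + int k') x / 2)"
    by (simp only:) (intro set_integral_add continuous_set_integrable; use assms in \<open>auto intro!: continuous_intros\<close>)
  also have "\<dots> = (if k = k' then if k = 0 then b - a else (b - a) / 2 else 0)"
    unfolding set_integral_divide_zero integral_cos_multiple[OF \<open>a < b\<close>] using assms by auto
  finally show ?thesis .
qed

lemma ip_tensor:
  assumes "smooth f" "smooth g" "smooth f'" "smooth g'"
  shows "ip ({a<..<b} \<times> {c<..<d}) (\<lambda>p. f (fst p) * g (snd p)) (\<lambda>p. f' (fst p) * g' (snd p))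
    = (LINT x:{a<..<b}|lborel. f x * f' x) * (LINT y:{c<..<d}|lborel. g y * g' y)"
proof -
  let ?F = "\<lambda>x. indicator {a<..<b} x *\<^sub>R (f x * f' x)" and ?G = "\<lambda>y. indicator {c<..<d} y *\<^sub>R (g y * g' y)"
  have eq: "(\<lambda>p. indicator ({a<..<b} \<times> {c<..<d}) p *\<^sub>R ((f (fst p) * g (snd p)) * (f' (fst p) * g' (snd p))))
      = (\<lambda>(x, y). ?F x * ?G y)"
    by (auto simp: fun_eq_iff indicator_def)
  have cont: "continuous_on UNIV (\<lambda>p. r (fst p) * s (snd p))" if "smooth r" "smooth s" for r s
    using Ck_continuous[OF Ck_tensor[OF that]] .
  have "integrable lborel (\<lambda>(x, y). ?F x * ?G y)"
    unfolding eq[symmetric] set_integrable_def[symmetric]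
    by (intro L2_mult_integrable continuous_on_rectangle_L2 cont assms)
  then have "integrable (lborel \<Otimes>\<^sub>M lborel) (\<lambda>(x, y). ?F x * ?G y)" by (simp only: lborel_prod)
  from lborel_pair.integral_fst[OF this]
  show ?thesis unfolding ip_def set_lebesgue_integral_def eq by (simp add: lborel_prod)
qed

text \<open>The modes that vanish on the hinged edges, and the modes of their mixed derivatives.\<close>

definition mode :: "real \<Rightarrow> real \<Rightarrow> nat \<times> nat \<Rightarrow> real \<times> real \<Rightarrow> real" where
  "mode L l i p = tsin 0 L (fst i) (fst p) * tcos (-l) l (snd i) (snd p)"

definition xy_mode :: "real \<Rightarrow> real \<Rightarrow> nat \<times> nat \<Rightarrow> real \<times> real \<Rightarrow> real" where
  "xy_mode L l i p = tcos 0 L (fst i) (fst p) * tsin (-l) l (snd i) (snd p)"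

lemma mode_orthogonal:
  assumes "0 < L" "0 < l" "fst i \<noteq> 0"
  shows "ip (plate L l) (mode L l i) (mode L l j)
    = (if i = j then if snd i = 0 then L * l else L * l / 2 else 0)"
  unfolding plate_def mode_def[abs_def]
  using assms by (subst ip_tensor) (auto simp: smooth_tsin smooth_tcos integral_tsin_tsin integral_tcos_tcos prod_eq_iff)

lemma xy_mode_orthogonal:
  assumes "0 < L" "0 < l" "fst i \<noteq> 0" "snd i \<noteq> 0"
  shows "ip (plate L l) (xy_mode L l i) (xy_mode L l j) = (if i = j then L * l / 2 else 0)"
  unfolding plate_def xy_mode_def[abs_def]
  using assms by (subst ip_tensor) (auto simp: smooth_tsin smooth_tcos integral_tsin_tsin integral_tcos_tcos prod_eq_iff)

lemma tensor_L2_plate: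
  assumes "smooth f" "smooth g" shows "(\<lambda>p. f (fst p) * g (snd p)) \<in> L2 (plate L l)"
  unfolding plate_def by (rule continuous_on_rectangle_L2[OF Ck_continuous[OF Ck_tensor[OF assms]]])

lemma mode_L2: "mode L l i \<in> L2 (plate L l)" "xy_mode L l i \<in> L2 (plate L l)"
  unfolding mode_def[abs_def] xy_mode_def[abs_def]
  by (intro tensor_L2_plate smooth_tsin smooth_tcos)+

lemma ip_scale_right:
  assumes "u \<in> L2 \<Omega>" "v \<in> L2 \<Omega>" shows "ip \<Omega> u (\<lambda>x. r * v x) = r * ip \<Omega> u v"
  using ip_lin[OF assms(2) L2_zero assms(1), of r 0]
  by (simp add: ip_commute[of \<Omega> u v] ip_commute[of \<Omega> u "\<lambda>x. r * v x"])

lemma ip_tensor_scale_x: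
  assumes "z \<in> L2 (plate L l)" "smooth g" "smooth h"
  shows "ip (plate L l) z (\<lambda>p. (r * g (fst p)) * h (snd p)) = r * ip (plate L l) z (\<lambda>p. g (fst p) * h (snd p))"
  using ip_scale_right[OF assms(1) tensor_L2_plate[OF assms(2,3)], of r] by (simp add: mult.assoc)

lemma ip_tensor_scale_y:
  assumes "z \<in> L2 (plate L l)" "smooth g" "smooth h"
  shows "ip (plate L l) z (\<lambda>p. g (fst p) * (r * h (snd p))) = r * ip (plate L l) z (\<lambda>p. g (fst p) * h (snd p))"
  using ip_scale_right[OF assms(1) tensor_L2_plate[OF assms(2,3)], of r] by (simp add: mult.left_commute)

text \<open>All boundary terms vanish: the \<open>x\<close>-factor of a mode and \<open>u\<close> are zero on the hinged edges, and the
  \<open>y\<close>-factor of an \<open>xy_mode\<close> is zero on the free ones.\<close>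

lemma fourier_coefficients:
  fixes L l :: real
  defines "\<Omega> \<equiv> plate L l"
  assumes Ll: "0 < L" "0 < l" and u: "u \<in> H2_star L l"
  shows "ip \<Omega> (w_xx \<Omega> u) (mode L l i) = - (tfreq 0 L (fst i))\<^sup>2 * ip \<Omega> u (mode L l i)"
    and "ip \<Omega> (w_xy \<Omega> u) (xy_mode L l i)
      = - (tfreq 0 L (fst i) * tfreq (-l) l (snd i)) * ip \<Omega> u (mode L l i)"
proof -
  note ibp = H2_star_ibp[OF Ll u, folded \<Omega>_def]
  note L2 = H2_star_L2[OF u, folded \<Omega>_def]
  note m = ip_tensor_scale_x[of _ L l, folded \<Omega>_def] and m' = ip_tensor_scale_y[of _ L l, folded \<Omega>_def]
  have x: "ip \<Omega> (weak_partial \<Omega> (1, 0) u) (\<lambda>p. tcos 0 L (fst i) (fst p) * tcos (-l) l (snd i) (snd p))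
      = tfreq 0 L (fst i) * ip \<Omega> u (mode L l i)"
    using ibp(2)[OF smooth_tcos smooth_tcos, of 0 L "fst i" "-l" l "snd i"]
      m[OF L2(1) smooth_tsin smooth_tcos, of "- tfreq 0 L (fst i)" 0 L "fst i" "-l" l "snd i"]
    unfolding deriv_tcos mode_def[abs_def] by linarith
  show "ip \<Omega> (w_xx \<Omega> u) (mode L l i) = - (tfreq 0 L (fst i))\<^sup>2 * ip \<Omega> u (mode L l i)"
    using ibp(1)[OF smooth_tsin smooth_tcos, of 0 L "fst i" "-l" l "snd i"] tsin_ends[of 0 L "fst i"] Ll
      m[OF L2(2) smooth_tcos smooth_tcos, of "tfreq 0 L (fst i)" 0 L "fst i" "-l" l "snd i"] x
    unfolding deriv_tsin mode_def[abs_def] by (simp add: power2_eq_square)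
  show "ip \<Omega> (w_xy \<Omega> u) (xy_mode L l i)
      = - (tfreq 0 L (fst i) * tfreq (-l) l (snd i)) * ip \<Omega> u (mode L l i)"
    using ibp(5)[OF smooth_tcos smooth_tsin, of "-l" l "snd i" 0 L "fst i"] tsin_ends[of "-l" l "snd i"] Ll
      m'[OF L2(2) smooth_tcos smooth_tcos, of 0 L "fst i" "tfreq (-l) l (snd i)" "-l" l "snd i"] x
    unfolding deriv_tsin xy_mode_def[abs_def] by simp
qed

section \<open>Completeness of the modes\<close>

text \<open>The modes with \<open>fst i = 0\<close> are the zero function. Admitting them keeps the product formulas below
  free of exceptions; \<open>mode_span_finite\<close> discards them.\<close>

inductive_set mode_span :: "real \<Rightarrow> real \<Rightarrow> (real \<times> real \<Rightarrow> real) set" for L l where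
  gen: "mode L l i \<in> mode_span L l"
| add: "f \<in> mode_span L l \<Longrightarrow> g \<in> mode_span L l \<Longrightarrow> (\<lambda>p. f p + g p) \<in> mode_span L l"
| scale: "f \<in> mode_span L l \<Longrightarrow> (\<lambda>p. r * f p) \<in> mode_span L l"

lemma mode_zero: "fst i = 0 \<Longrightarrow> mode L l i = (\<lambda>p. 0)"
  by (auto simp: mode_def tsin_def tfreq_def)

lemma mode_span_finite:
  assumes "f \<in> mode_span L l"
  shows "\<exists>F b. finite F \<and> (\<forall>i\<in>F. fst i \<noteq> 0) \<and> f = (\<lambda>p. \<Sum>i\<in>F. b i * mode L l i p)"
  using assms
proof induction
  case (gen i)
  show ?case
  proof (cases "fst i = 0")
    case True
    then show ?thesis by (intro exI[of _ "{}"]) (simp add: mode_zero)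
  next
    case False
    then show ?thesis by (intro exI[of _ "{i}"] exI[of _ "\<lambda>i. 1"]) simp
  qed
next
  case (add f g)
  then obtain F b G c where F: "finite F" "\<forall>i\<in>F. fst i \<noteq> 0" "f = (\<lambda>p. \<Sum>i\<in>F. b i * mode L l i p)"
    and G: "finite G" "\<forall>i\<in>G. fst i \<noteq> 0" "g = (\<lambda>p. \<Sum>i\<in>G. c i * mode L l i p)" by blast
  have "f p + g p = (\<Sum>i\<in>F \<union> G. ((if i \<in> F then b i else 0) + (if i \<in> G then c i else 0)) * mode L l i p)" for p
  proof -
    have "f p = (\<Sum>i\<in>F \<union> G. (if i \<in> F then b i else 0) * mode L l i p)"
      unfolding F(3) using F(1) G(1) by (intro sum.mono_neutral_cong_left) auto
    moreover have "g p = (\<Sum>i\<in>F \<union> G. (if i \<in> G then c i else 0) * mode L l i p)"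
      unfolding G(3) using F(1) G(1) by (intro sum.mono_neutral_cong_left) auto
    ultimately show ?thesis by (simp add: distrib_right sum.distrib)
  qed
  then show ?case using F(1,2) G(1,2)
    by (intro exI[of _ "F \<union> G"] exI[of _ "\<lambda>i. (if i \<in> F then b i else 0) + (if i \<in> G then c i else 0)"]) auto
next
  case (scale f r)
  then obtain F b where "finite F" "\<forall>i\<in>F. fst i \<noteq> 0" "f = (\<lambda>p. \<Sum>i\<in>F. b i * mode L l i p)" by blast
  then show ?case
    by (intro exI[of _ F] exI[of _ "\<lambda>i. r * b i"]) (simp add: sum_distrib_left mult.assoc)
qed

lemma mode_span_L2: "f \<in> mode_span L l \<Longrightarrow> f \<in> L2 (plate L l)"
proof (induction rule: mode_span.induct)
  case (gen i) show ?case by (rule mode_L2)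
next
  case (add f g) then show ?case using L2_lin[of f _ g 1 1] by simp
next
  case (scale f r) then show ?case using L2_lin[OF _ L2_zero, of f _ r 0] by simp
qed

lemma mode_span_mult_tcos_x:
  assumes "f \<in> mode_span L l"
  shows "(\<lambda>p. tcos 0 L 1 (fst p) * f p) \<in> mode_span L l"
  using assms
proof induction
  case (gen i)
  obtain k j where i: "i = (k, j)" by (cases i)
  show ?case
  proof (cases k)
    case 0
    have "(\<lambda>p. tcos 0 L 1 (fst p) * mode L l i p) = (\<lambda>p. 0 * mode L l i p)"
      using mode_zero[of i] 0 i by simp
    then show ?thesis using mode_span.scale[OF mode_span.gen] by metis
  next
    case (Suc n)
    have "tcos 0 L 1 (fst p) * mode L l i p = 1 / 2 * mode L l (k + 1, j) p + 1 / 2 * mode L l (k - 1, j) p" for p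
    proof -
      have "tfreq 0 L k * x + tfreq 0 L 1 * x = tfreq 0 L (k + 1) * x"
        "tfreq 0 L k * x - tfreq 0 L 1 * x = tfreq 0 L (k - 1) * x" for x
        using Suc by (simp_all add: tfreq_def add_divide_distrib algebra_simps)
      then have "tsin 0 L k (fst p) * tcos 0 L 1 (fst p) = (tsin 0 L (k + 1) (fst p) + tsin 0 L (k - 1) (fst p)) / 2"
        unfolding tsin_def tcos_def sin_times_cos by simp
      then have "(tsin 0 L k (fst p) * tcos 0 L 1 (fst p)) * tcos (-l) l j (snd p)
          = (tsin 0 L (k + 1) (fst p) + tsin 0 L (k - 1) (fst p)) / 2 * tcos (-l) l j (snd p)" by simp
      then show ?thesis by (simp add: mode_def i algebra_simps add_divide_distrib)
    qed
    then show ?thesis by (simp only:) (intro mode_span.intros)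
  qed
next
  case (add f g) then show ?case using mode_span.add by (simp add: distrib_left)
next
  case (scale f r) then show ?case using mode_span.scale[of "\<lambda>p. tcos 0 L 1 (fst p) * f p"]
    by (simp add: mult.left_commute)
qed

lemma mode_span_mult_tcos_y:
  assumes "f \<in> mode_span L l"
  shows "(\<lambda>p. tcos (-l) l 1 (snd p) * f p) \<in> mode_span L l"
  using assms
proof induction
  case (gen i)
  obtain k j where i: "i = (k, j)" by (cases i)
  show ?case
  proof (cases j)
    case 0
    have "(\<lambda>p. tcos (-l) l 1 (snd p) * mode L l i p) = mode L l (k, 1)"
      using 0 by (auto simp: mode_def i tcos_def[of _ _ 0] tfreq_def[of _ _ 0])
    then show ?thesis using mode_span.gen by simp
  next
    case (Suc n)
    have "tcos (-l) l 1 (snd p) * mode L l i p = 1 / 2 * mode L l (k, j + 1) p + 1 / 2 * mode L l (k, j - 1) p" for p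
    proof -
      have "tfreq (-l) l j * x + tfreq (-l) l 1 * x = tfreq (-l) l (j + 1) * x"
        "tfreq (-l) l j * x - tfreq (-l) l 1 * x = tfreq (-l) l (j - 1) * x" for x
        using Suc by (simp_all add: tfreq_def add_divide_distrib algebra_simps)
      then have "tcos (-l) l j (snd p) * tcos (-l) l 1 (snd p) = (tcos (-l) l (j - 1) (snd p) + tcos (-l) l (j + 1) (snd p)) / 2"
        unfolding tcos_def cos_times_cos by simp
      then have "tsin 0 L k (fst p) * (tcos (-l) l j (snd p) * tcos (-l) l 1 (snd p))
          = tsin 0 L k (fst p) * ((tcos (-l) l (j - 1) (snd p) + tcos (-l) l (j + 1) (snd p)) / 2)" by simp
      then show ?thesis by (simp add: mode_def i algebra_simps add_divide_distrib)
    qed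
    then show ?thesis by (simp only:) (intro mode_span.intros)
  qed
next
  case (add f g) then show ?case using mode_span.add by (simp add: distrib_left)
next
  case (scale f r) then show ?case using mode_span.scale[of "\<lambda>p. tcos (-l) l 1 (snd p) * f p"]
    by (simp add: mult.left_commute)
qed

lemma ip_le_measure:
  assumes "\<Omega> \<in> sets borel" "emeasure lborel \<Omega> < \<infinity>" "v \<in> L2 \<Omega>" "\<And>p. p \<in> \<Omega> \<Longrightarrow> \<bar>v p\<bar> \<le> C"
  shows "ip \<Omega> v v \<le> C\<^sup>2 * measure lborel \<Omega>"
proof -
  have "ip \<Omega> v v \<le> (LINT p|lborel. C\<^sup>2 * indicator \<Omega> p)"
    unfolding ip_def set_lebesgue_integral_def
  proof (rule integral_mono)
    show "integrable lborel (\<lambda>p. indicator \<Omega> p *\<^sub>R (v p * v p))"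
      using L2_mult_integrable[OF assms(3,3)] by (simp add: set_integrable_def)
    show "integrable lborel (\<lambda>p. C\<^sup>2 * indicator \<Omega> p)"
      using assms by (intro integrable_mult_right integrable_real_indicator) auto
    show "indicator \<Omega> p *\<^sub>R (v p * v p) \<le> C\<^sup>2 * indicator \<Omega> p" for p
    proof (cases "p \<in> \<Omega>")
      case True
      have "\<bar>v p\<bar>\<^sup>2 \<le> C\<^sup>2" by (rule power_mono[OF assms(4)[OF True]]) simp
      then show ?thesis using True by (simp add: power2_eq_square)
    qed simp
  qed
  also have "\<dots> = C\<^sup>2 * measure lborel \<Omega>" using assms(1) by simp
  finally show ?thesis .
qed

text \<open>The functions whose product with every combination of modes is again a combination of modes
  form an algebra containing \<open>cos (\<pi>x/L)\<close> and \<open>cos (\<pi>(y + l)/2l)\<close>. These two separate points, so the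
  Stone-Weierstrass theorem applies.\<close>

lemma mode_span_multipliers_dense:
  fixes g :: "real \<times> real \<Rightarrow> real"
  assumes Ll: "0 < L" "0 < l" and g: "continuous_on ({0..L} \<times> {-l..l}) g" and "\<eta> > 0"
  obtains h where "\<And>f. f \<in> mode_span L l \<Longrightarrow> (\<lambda>p. h p * f p) \<in> mode_span L l"
    and "\<And>p. p \<in> {0..L} \<times> {-l..l} \<Longrightarrow> \<bar>g p - h p\<bar> < \<eta>"
proof -
  define S where "S = {0..L} \<times> {-l..l}"
  define R where "R = {g. continuous_on S g \<and> (\<forall>f\<in>mode_span L l. (\<lambda>p. g p * f p) \<in> mode_span L l)}"
  have cx: "(\<lambda>p. tcos 0 L 1 (fst p)) \<in> R"
    unfolding R_def using mode_span_mult_tcos_x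
    by (auto simp: tcos_def intro!: continuous_intros)
  have cy: "(\<lambda>p. tcos (-l) l 1 (snd p)) \<in> R"
    unfolding R_def using mode_span_mult_tcos_y
    by (auto simp: tcos_def intro!: continuous_intros)
  have inj: "tcos a b 1 x \<noteq> tcos a b 1 y" if "a < b" "x \<in> {a..b}" "y \<in> {a..b}" "x \<noteq> y" for a b x y
  proof
    assume eq: "tcos a b 1 x = tcos a b 1 y"
    have *: "0 \<le> tfreq a b 1 * (z - a)" "tfreq a b 1 * (z - a) \<le> pi" if "z \<in> {a..b}" for z
      using that \<open>a < b\<close> by (auto simp: tfreq_def field_simps)
    have "tfreq a b 1 * (x - a) = tfreq a b 1 * (y - a)"
      by (rule cos_inj_pi[OF *[OF that(2)] *[OF that(3)] eq[unfolded tcos_def]])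
    then show False using that by (simp add: tfreq_def)
  qed
  interpret function_ring_on R S
  proof
    show "compact S" by (simp add: S_def compact_Times)
    show "continuous_on S f" if "f \<in> R" for f using that by (simp add: R_def)
    show "(\<lambda>x. f x + g x) \<in> R" if "f \<in> R" "g \<in> R" for f g
    proof -
      have "(\<lambda>p. (f p + g p) * k p) \<in> mode_span L l" if k: "k \<in> mode_span L l" for k
        using mode_span.add[of "\<lambda>p. f p * k p" L l "\<lambda>p. g p * k p"] \<open>f \<in> R\<close> \<open>g \<in> R\<close> k
        by (simp add: R_def distrib_right)
      then show ?thesis using that by (auto simp: R_def intro: continuous_on_add)
    qed
    show "(\<lambda>x. f x * g x) \<in> R" if "f \<in> R" "g \<in> R" for f g
      using that by (auto simp: R_def mult.assoc intro: continuous_on_mult)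
    show "(\<lambda>x. c) \<in> R" for c by (auto simp: R_def intro: mode_span.scale)
    show "\<exists>f\<in>R. f x \<noteq> f y" if "x \<in> S" "y \<in> S" "x \<noteq> y" for x y
    proof (cases "fst x = fst y")
      case True
      then have "snd x \<noteq> snd y" using that by (simp add: prod_eq_iff)
      then show ?thesis using that Ll inj[of "-l" l "snd x" "snd y"] by (intro bexI[OF _ cy]) (auto simp: S_def)
    next
      case False
      then show ?thesis using that Ll inj[of 0 L "fst x" "fst y"] by (intro bexI[OF _ cx]) (auto simp: S_def)
    qed
  qed
  obtain h where "h \<in> R" "\<forall>x\<in>S. \<bar>g x - h x\<bar> < \<eta>"
    using Stone_Weierstrass_basic[of g \<eta>] g \<open>\<eta> > 0\<close> by (auto simp: S_def)
  then show ?thesis by (intro that[of h]) (auto simp: R_def S_def)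
qed

text \<open>The modes vanish for \<open>x = 0\<close> and \<open>x = L\<close>, so their span contains no constants and the previous
  lemma does not apply to it directly. It does show that \<open>s g\<close>, for \<open>s = sin (\<pi>x/L)\<close> and \<open>g\<close> continuous,
  is a uniform limit of combinations of modes, and \<open>u\<close> is the limit in \<open>L\<^sup>2\<close> of such products with
  \<open>g = u s / (s\<^sup>2 + \<delta>)\<close> as \<open>\<delta>\<close> tends to \<open>0\<close>.\<close>

lemma mode_span_dense:
  fixes L l :: real
  defines "\<Omega> \<equiv> plate L l"
  assumes Ll: "0 < L" "0 < l" and u: "u \<in> L2 \<Omega>" and cont: "continuous_on (closure \<Omega>) u'"
    and eq: "AE p in lborel. p \<in> \<Omega> \<longrightarrow> u' p = u p" and \<epsilon>: "\<epsilon> > 0"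
  obtains f where "f \<in> mode_span L l" "ip \<Omega> (\<lambda>p. u p - f p) (\<lambda>p. u p - f p) < \<epsilon>"
proof -
  have cl: "closure \<Omega> = {0..L} \<times> {-l..l}"
    using Ll by (simp add: \<Omega>_def plate_def closure_Times)
  note meas = plate_measure[of L l, folded \<Omega>_def]
  \<comment> \<open>The representative is continuous on the closed plate only; composing it with the projection
    onto the plate extends it to the whole plane.\<close>
  define clamp where "clamp p = (max 0 (min L (fst p)), max (-l) (min l (snd p)))" for p :: "real \<times> real"
  define U where "U p = u' (clamp p)" for p
  have clampcl: "clamp p \<in> closure \<Omega>" for p using Ll by (auto simp: cl clamp_def)
  have clamp\<Omega>: "clamp p = p" if "p \<in> \<Omega>" for p
    using that by (auto simp: clamp_def \<Omega>_def plate_def)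
  have U: "continuous_on UNIV U"
    unfolding U_def
  proof (rule continuous_on_compose2[OF cont])
    show "continuous_on UNIV clamp" unfolding clamp_def[abs_def] by (intro continuous_intros)
    show "clamp ` UNIV \<subseteq> closure \<Omega>" using clampcl by auto
  qed
  have "compact (u' ` closure \<Omega>)" by (intro compact_continuous_image cont) (simp add: cl compact_Times)
  then obtain M where M: "\<forall>y\<in>u' ` closure \<Omega>. norm y \<le> M" using compact_imp_bounded bounded_pos by blast
  have UM: "\<bar>U p\<bar> \<le> M" for p using M clampcl by (auto simp: U_def)
  define s where "s p = tsin 0 L 1 (fst p)" for p :: "real \<times> real"
  have s: "continuous_on UNIV s" unfolding s_def tsin_def by (intro continuous_intros)
  have spos: "s p > 0" if "p \<in> \<Omega>" for p
  proof -
    have "0 < tfreq 0 L 1 * (fst p - 0)" "tfreq 0 L 1 * (fst p - 0) < pi"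
      using that Ll by (auto simp: \<Omega>_def plate_def tfreq_def field_simps)
    then show ?thesis by (simp add: s_def tsin_def sin_gt_zero)
  qed
  define \<delta> where "\<delta> n = inverse (real (Suc n))" for n
  have \<delta>: "\<delta> n > 0" for n by (simp add: \<delta>_def)
  have den: "(s p)\<^sup>2 + \<delta> n > 0" for n p using \<delta>[of n] by (simp add: add_nonneg_pos)
  define g where "g n p = U p * s p / ((s p)\<^sup>2 + \<delta> n)" for n p
  have g: "continuous_on UNIV (g n)" for n
    unfolding g_def using den by (intro continuous_intros U s) (metis less_irrefl)
  define D where "D n p = U p - s p * g n p" for n p
  have D: "continuous_on UNIV (D n)" for n
    unfolding D_def by (intro continuous_intros U s g)
  have Deq: "D n p = U p * (\<delta> n / ((s p)\<^sup>2 + \<delta> n))" for n p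
    using den[of p n] by (simp add: D_def g_def field_simps power2_eq_square)
  have "(\<lambda>n. ip \<Omega> (\<lambda>p. 1) (\<lambda>p. (D n p)\<^sup>2)) \<longlonglongrightarrow> ip \<Omega> (\<lambda>p. 1) (\<lambda>p. 0)"
  proof (rule ip_tendsto[OF meas L2_one[OF meas]])
    show "(\<lambda>p. (D n p)\<^sup>2) \<in> borel_measurable borel" for n
      using borel_measurable_continuous_onI[OF D] by measurable
    show "\<bar>(D n p)\<^sup>2\<bar> \<le> M\<^sup>2" for n p
    proof -
      have "\<delta> n / ((s p)\<^sup>2 + \<delta> n) \<le> 1" "0 \<le> \<delta> n / ((s p)\<^sup>2 + \<delta> n)"
        using den[of p n] \<delta>[of n] by auto
      then have "\<bar>\<delta> n / ((s p)\<^sup>2 + \<delta> n)\<bar> \<le> 1" by linarith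
      moreover have "0 \<le> M" using UM[of p] by linarith
      ultimately have "\<bar>D n p\<bar> \<le> M * 1"
        unfolding Deq abs_mult by (intro mult_mono UM abs_ge_zero)
      then have "\<bar>D n p\<bar>\<^sup>2 \<le> M\<^sup>2" by (intro power_mono) auto
      then show ?thesis by simp
    qed
    fix p assume "p \<in> \<Omega>"
    then have "(s p)\<^sup>2 \<noteq> 0" using spos by fastforce
    then have "(\<lambda>n. (U p * (\<delta> n / ((s p)\<^sup>2 + \<delta> n)))\<^sup>2) \<longlonglongrightarrow> (U p * (0 / ((s p)\<^sup>2 + 0)))\<^sup>2"
      unfolding \<delta>_def by (intro tendsto_intros LIMSEQ_inverse_real_of_nat) simp
    then show "(\<lambda>n. (D n p)\<^sup>2) \<longlonglongrightarrow> 0" by (simp add: Deq)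
  qed simp
  then have "(\<lambda>n. ip \<Omega> (D n) (D n)) \<longlonglongrightarrow> 0"
    by (simp add: ip_def power2_eq_square set_lebesgue_integral_def)
  then have "\<forall>\<^sub>F n in sequentially. ip \<Omega> (D n) (D n) < \<epsilon> / 8"
    using \<epsilon> by (intro order_tendstoD) auto
  then obtain n where n: "ip \<Omega> (D n) (D n) < \<epsilon> / 8" by (auto simp: eventually_sequentially)
  define P where "P = measure lborel \<Omega> + 1"
  have P: "P > 0" using measure_nonneg[of lborel \<Omega>] unfolding P_def by linarith
  define \<eta> where "\<eta> = sqrt (\<epsilon> / (8 * P))"
  have \<eta>: "\<eta> > 0" using \<epsilon> P by (simp add: \<eta>_def)
  have \<eta>2: "\<eta>\<^sup>2 * measure lborel \<Omega> \<le> \<epsilon> / 8"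
  proof -
    have "\<eta>\<^sup>2 = \<epsilon> / (8 * P)" using \<epsilon> P by (simp add: \<eta>_def)
    then have "\<eta>\<^sup>2 * P = \<epsilon> / 8" using P by simp
    moreover have "\<eta>\<^sup>2 * measure lborel \<Omega> \<le> \<eta>\<^sup>2 * P" by (intro mult_left_mono) (auto simp: P_def)
    ultimately show ?thesis by simp
  qed
  obtain h where h: "\<And>f. f \<in> mode_span L l \<Longrightarrow> (\<lambda>p. h p * f p) \<in> mode_span L l"
    "\<And>p. p \<in> {0..L} \<times> {-l..l} \<Longrightarrow> \<bar>g n p - h p\<bar> < \<eta>"
    using mode_span_multipliers_dense[OF Ll continuous_on_subset[OF g] \<eta>] by blast
  define f where "f p = h p * mode L l (1, 0) p" for p
  have f: "f \<in> mode_span L l" unfolding f_def by (rule h(1)[OF mode_span.gen])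
  have fs: "f p = h p * s p" for p
    by (simp add: f_def mode_def s_def tcos_def tfreq_def)
  have fL2: "f \<in> L2 \<Omega>" unfolding \<Omega>_def by (rule mode_span_L2[OF f])
  have cL2: "v \<in> L2 \<Omega>" if "continuous_on UNIV v" for v
    unfolding \<Omega>_def plate_def by (rule continuous_on_rectangle_L2[OF that])
  have sg: "(\<lambda>p. s p * g n p) \<in> L2 \<Omega>" by (intro cL2 continuous_intros s g)
  have diff: "(\<lambda>p. v p - w p) \<in> L2 \<Omega>" if "v \<in> L2 \<Omega>" "w \<in> L2 \<Omega>" for v w
    using L2_lin[OF that, of 1 "-1"] by simp
  have "ip \<Omega> (\<lambda>p. s p * g n p - f p) (\<lambda>p. s p * g n p - f p) \<le> \<eta>\<^sup>2 * measure lborel \<Omega>"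
  proof (rule ip_le_measure[OF meas diff[OF sg fL2]])
    fix p assume p: "p \<in> \<Omega>"
    have "\<bar>g n p - h p\<bar> \<le> \<eta>" using p h(2)[of p] by (force simp: \<Omega>_def plate_def)
    moreover have "\<bar>s p\<bar> \<le> 1" by (simp add: s_def tsin_def)
    ultimately have "\<bar>s p\<bar> * \<bar>g n p - h p\<bar> \<le> 1 * \<eta>" by (intro mult_mono) auto
    then show "\<bar>s p * g n p - f p\<bar> \<le> \<eta>" by (simp add: fs abs_mult[symmetric] algebra_simps)
  qed
  moreover have "ip \<Omega> (\<lambda>p. U p - f p) (\<lambda>p. U p - f p) \<le> 2 * ip \<Omega> (\<lambda>p. U p - s p * g n p) (\<lambda>p. U p - s p * g n p)
      + 2 * ip \<Omega> (\<lambda>p. s p * g n p - f p) (\<lambda>p. s p * g n p - f p)"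
    by (rule ip_diff_le[OF cL2[OF U] sg fL2])
  moreover have "(\<lambda>p. U p - s p * g n p) = D n" by (simp add: D_def fun_eq_iff)
  ultimately have "ip \<Omega> (\<lambda>p. U p - f p) (\<lambda>p. U p - f p) < \<epsilon>" using n \<eta>2 \<epsilon> by simp
  moreover have "ip \<Omega> (\<lambda>p. u p - f p) (\<lambda>p. u p - f p) = ip \<Omega> (\<lambda>p. U p - f p) (\<lambda>p. U p - f p)"
  proof -
    have "AE p in lborel. p \<in> \<Omega> \<longrightarrow> u p - f p = U p - f p"
      using eq by eventually_elim (auto simp: U_def clamp\<Omega>)
    then show ?thesis by (intro ip_cong_AE diff u fL2 cL2[OF U])
  qed
  ultimately show ?thesis using that f by simp
qed

section \<open>The energy on the complement of the first modes\<close>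

text \<open>Expanding in modes turns both sides into weighted sums of squared Fourier coefficients:
  the bending energy \<open>u\<^sub>x\<^sub>x\<close> bounds the modes constant in \<open>y\<close>, among which only those with \<open>k \<ge> m\<close>
  occur; the twisting energy \<open>u\<^sub>x\<^sub>y\<close> bounds all others. The last assumption says that the plate is
  thin enough for the second bound to be the larger one.\<close>

lemma plate_form_lower_bound:
  fixes L l d K \<nu> \<kappa> :: real and m :: nat
  defines "\<Omega> \<equiv> plate L l"
  assumes Ll: "0 < L" "0 < l" and D: "d ^ 3 * K / 12 > 0" and \<nu>: "0 < \<nu>" "\<nu> < 1" and \<kappa>: "\<kappa> > 0"
    and u: "u \<in> H2_star L l" and orth: "\<And>k. 1 \<le> k \<Longrightarrow> k < m \<Longrightarrow> ip \<Omega> u (mode L l (k, 0)) = 0"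
    and thin: "(\<kappa> + 1 - \<nu>\<^sup>2) * (tfreq 0 L m) ^ 4 \<le> 2 * (1 - \<nu>) * (tfreq 0 L 1 * tfreq (-l) l 1)\<^sup>2"
  shows "d ^ 3 * K / 12 * ((\<kappa> + 1 - \<nu>\<^sup>2) * (tfreq 0 L m) ^ 4) * ip \<Omega> u u \<le> plate_form d K \<nu> \<kappa> \<Omega> u u"
proof -
  define A B \<Lambda> where "A = \<kappa> + 1 - \<nu>\<^sup>2" and "B = 2 * (1 - \<nu>)" and "\<Lambda> = A * (tfreq 0 L m) ^ 4"
  have "\<nu>\<^sup>2 < 1" using \<nu> by (simp add: power_less_one_iff)
  then have A: "A > 0" using \<kappa> by (simp add: A_def)
  have B: "B > 0" using \<nu> by (simp add: B_def)
  have \<Lambda>0: "\<Lambda> \<ge> 0" using A by (simp add: \<Lambda>_def)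
  note L2 = H2_star_L2[OF u, folded \<Omega>_def]
  define X Y where "X = ip \<Omega> (w_xx \<Omega> u) (w_xx \<Omega> u)" and "Y = ip \<Omega> (w_xy \<Omega> u) (w_xy \<Omega> u)"
  \<comment> \<open>Completing the square in \<open>u\<^sub>y\<^sub>y\<close> costs \<open>\<nu>\<^sup>2 u\<^sub>x\<^sub>x\<^sup>2\<close>, whence the constant \<open>A\<close>.\<close>
  have energy: "d ^ 3 * K / 12 * (A * X + B * Y) \<le> plate_form d K \<nu> \<kappa> \<Omega> u u"
  proof -
    let ?v = "\<lambda>p. \<nu> * w_xx \<Omega> u p + 1 * w_yy \<Omega> u p"
    have vL2: "?v \<in> L2 \<Omega>" by (rule L2_lin[OF L2(4,6)])
    have "ip \<Omega> ?v ?v = \<nu> * ip \<Omega> (w_xx \<Omega> u) ?v + 1 * ip \<Omega> (w_yy \<Omega> u) ?v"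
      by (rule ip_lin[OF L2(4,6) vL2])
    also have "ip \<Omega> (w_xx \<Omega> u) ?v = \<nu> * X + ip \<Omega> (w_xx \<Omega> u) (w_yy \<Omega> u)"
      using ip_lin[OF L2(4,6,4), of \<nu> 1] ip_commute[of \<Omega> "w_xx \<Omega> u" ?v] ip_commute[of \<Omega> "w_xx \<Omega> u" "w_yy \<Omega> u"]
      by (simp add: X_def)
    also have "ip \<Omega> (w_yy \<Omega> u) ?v = \<nu> * ip \<Omega> (w_xx \<Omega> u) (w_yy \<Omega> u) + ip \<Omega> (w_yy \<Omega> u) (w_yy \<Omega> u)"
      using ip_lin[OF L2(4,6,6), of \<nu> 1] ip_commute[of \<Omega> "w_yy \<Omega> u" ?v] by simp
    finally have "0 \<le> \<nu>\<^sup>2 * X + 2 * \<nu> * ip \<Omega> (w_xx \<Omega> u) (w_yy \<Omega> u) + ip \<Omega> (w_yy \<Omega> u) (w_yy \<Omega> u)"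
      using ip_nonneg[of \<Omega> ?v] by (simp add: power2_eq_square algebra_simps)
    then have "A * X + B * Y \<le> (1 + \<kappa>) * X + \<nu> * ip \<Omega> (w_xx \<Omega> u) (w_yy \<Omega> u)
      + \<nu> * ip \<Omega> (w_yy \<Omega> u) (w_xx \<Omega> u) + ip \<Omega> (w_yy \<Omega> u) (w_yy \<Omega> u) + 2 * (1 - \<nu>) * Y"
      using ip_commute[of \<Omega> "w_yy \<Omega> u" "w_xx \<Omega> u"] by (simp add: A_def B_def algebra_simps)
    then show ?thesis
      unfolding plate_form_eq[OF u u, folded \<Omega>_def] X_def Y_def using D by (intro mult_left_mono) auto
  qed
  obtain u' where u': "continuous_on (closure \<Omega>) u'" "AE p in lborel. p \<in> \<Omega> \<longrightarrow> u' p = u p"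
    using u unfolding H2_star_def \<Omega>_def by blast
  have eps: "\<Lambda> * ip \<Omega> u u \<le> A * X + B * Y + \<Lambda> * \<epsilon>" if \<epsilon>: "\<epsilon> > 0" for \<epsilon>
  proof -
    obtain f where f: "f \<in> mode_span L l" "ip \<Omega> (\<lambda>p. u p - f p) (\<lambda>p. u p - f p) < \<epsilon>"
      using mode_span_dense[OF Ll, folded \<Omega>_def, OF L2(1) u' \<epsilon>] by blast
    obtain F b where F: "finite F" "\<And>i. i \<in> F \<Longrightarrow> fst i \<noteq> 0" and fb: "f = (\<lambda>p. \<Sum>i\<in>F. b i * mode L l i p)"
      using mode_span_finite[OF f(1)] by blast
    define N where "N i = ip \<Omega> (mode L l i) (mode L l i)" for i
    have mode_orth: "ip \<Omega> (mode L l i) (mode L l j) = 0" if "i \<in> F" "j \<in> F" "i \<noteq> j" for i j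
      using mode_orthogonal[OF Ll F(2)] that by (simp add: \<Omega>_def)
    have N: "N i > 0" if "i \<in> F" for i
      using mode_orthogonal[OF Ll F(2)[OF that], of i] Ll by (simp add: N_def \<Omega>_def)
    have Npos: "ip \<Omega> (mode L l i) (mode L l i) > 0" if "i \<in> F" for i using N[OF that] by (simp add: N_def)
    have ML2: "mode L l i \<in> L2 \<Omega>" for i by (simp add: \<Omega>_def mode_L2)
    define q where "q i = (ip \<Omega> u (mode L l i))\<^sup>2 / N i" for i
    have q0: "q i \<ge> 0" if "i \<in> F" for i using N[OF that] by (simp add: q_def)
    have approx: "ip \<Omega> u u \<le> \<epsilon> + (\<Sum>i\<in>F. q i)"
    proof -
      have "ip \<Omega> u u \<le> ip \<Omega> (\<lambda>p. u p - f p) (\<lambda>p. u p - f p) + (\<Sum>i\<in>F. q i)"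
        unfolding fb q_def N_def
        by (rule best_approximation[OF F(1) ML2 L2(1) mode_orth Npos])
      then show ?thesis using f(2) by linarith
    qed
    have xx: "(\<Sum>i\<in>F. (tfreq 0 L (fst i)) ^ 4 * q i) \<le> X"
    proof -
      have "(\<Sum>i\<in>F. (ip \<Omega> (w_xx \<Omega> u) (mode L l i))\<^sup>2 / N i) \<le> X"
        unfolding X_def N_def
        by (rule bessel_inequality[OF F(1) ML2 L2(4) mode_orth Npos])
      moreover have "(ip \<Omega> (w_xx \<Omega> u) (mode L l i))\<^sup>2 / N i = (tfreq 0 L (fst i)) ^ 4 * q i" for i
        proof -
        have "(ip \<Omega> (w_xx \<Omega> u) (mode L l i))\<^sup>2 = ((tfreq 0 L (fst i))\<^sup>2)\<^sup>2 * (ip \<Omega> u (mode L l i))\<^sup>2"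
          unfolding fourier_coefficients(1)[OF Ll u, of i, folded \<Omega>_def] by (simp add: power_mult_distrib)
        then show ?thesis by (simp add: q_def)
      qed
      ultimately show ?thesis by (simp only:)
    qed
    define G where "G = {i \<in> F. snd i \<noteq> 0}"
    have G: "finite G" "\<And>i. i \<in> G \<Longrightarrow> fst i \<noteq> 0" "\<And>i. i \<in> G \<Longrightarrow> snd i \<noteq> 0" "G \<subseteq> F"
      using F by (auto simp: G_def)
    have xy: "(\<Sum>i\<in>G. (tfreq 0 L (fst i) * tfreq (-l) l (snd i))\<^sup>2 * q i) \<le> Y"
    proof -
      have NG: "ip \<Omega> (xy_mode L l i) (xy_mode L l i) = N i" if "i \<in> G" for i
        using xy_mode_orthogonal[OF Ll G(2,3)[OF that], of i] mode_orthogonal[OF Ll G(2)[OF that], of i] G(3)[OF that]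
        by (simp add: N_def \<Omega>_def)
      have "(\<Sum>i\<in>G. (ip \<Omega> (w_xy \<Omega> u) (xy_mode L l i))\<^sup>2 / ip \<Omega> (xy_mode L l i) (xy_mode L l i)) \<le> Y"
        unfolding Y_def
      proof (rule bessel_inequality[OF G(1) _ L2(5)])
        show "ip \<Omega> (xy_mode L l i) (xy_mode L l j) = 0" if "i \<in> G" "i \<noteq> j" for i j
          using xy_mode_orthogonal[OF Ll G(2,3)[OF that(1)]] that by (simp add: \<Omega>_def)
        show "0 < ip \<Omega> (xy_mode L l i) (xy_mode L l i)" if "i \<in> G" for i
          using NG[OF that] N[of i] G(4) that by auto
      qed (simp add: \<Omega>_def mode_L2)
      moreover have "(ip \<Omega> (w_xy \<Omega> u) (xy_mode L l i))\<^sup>2 / ip \<Omega> (xy_mode L l i) (xy_mode L l i)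
          = (tfreq 0 L (fst i) * tfreq (-l) l (snd i))\<^sup>2 * q i" if "i \<in> G" for i
        unfolding fourier_coefficients(2)[OF Ll u, of i, folded \<Omega>_def] NG[OF that]
        by (simp add: q_def power_mult_distrib)
      ultimately show ?thesis by (simp only: cong: sum.cong)
    qed
    have tf: "tfreq a b i \<le> tfreq a b j" "0 \<le> tfreq a b i" if "i \<le> j" "a < b" for a b i j
      using that by (auto simp: tfreq_def intro!: divide_right_mono mult_right_mono)
    have weight: "\<Lambda> * q i \<le> A * ((tfreq 0 L (fst i)) ^ 4 * q i)
        + (if snd i \<noteq> 0 then B * ((tfreq 0 L (fst i) * tfreq (-l) l (snd i))\<^sup>2 * q i) else 0)" if i: "i \<in> F" for i
    proof (cases "snd i = 0")
      case True
      show ?thesis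
      proof (cases "fst i < m")
        case lt: True
        obtain k where k: "i = (k, 0)" using True by (cases i) auto
        then have "q i = 0" using orth[of k] lt F(2)[OF i] by (simp add: q_def)
        then show ?thesis using True by simp
      next
        case False
        then have "\<Lambda> \<le> A * (tfreq 0 L (fst i)) ^ 4"
          unfolding \<Lambda>_def using A tf[of m "fst i" 0 L] Ll by (intro mult_left_mono power_mono) auto
        then have "\<Lambda> * q i \<le> A * (tfreq 0 L (fst i)) ^ 4 * q i" using q0[OF i] by (rule mult_right_mono)
        then show ?thesis using True by (simp add: mult.assoc)
      qed
    next
      case False
      have "1 \<le> fst i" "1 \<le> snd i" using F(2)[OF i] False by auto
      then have "tfreq 0 L 1 * tfreq (-l) l 1 \<le> tfreq 0 L (fst i) * tfreq (-l) l (snd i)"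
        using Ll by (intro mult_mono tf(1) tf(2)[OF order_refl]) auto
      moreover have "0 \<le> tfreq 0 L 1 * tfreq (-l) l 1"
        using Ll by (intro mult_nonneg_nonneg tf(2)[OF order_refl]) auto
      ultimately have "tfreq 0 L 1 * tfreq (-l) l 1 \<le> tfreq 0 L (fst i) * tfreq (-l) l (snd i)"
        "0 \<le> tfreq 0 L 1 * tfreq (-l) l 1" by auto
      then have "(tfreq 0 L 1 * tfreq (-l) l 1)\<^sup>2 \<le> (tfreq 0 L (fst i) * tfreq (-l) l (snd i))\<^sup>2"
        by (rule power_mono)
      then have "B * (tfreq 0 L 1 * tfreq (-l) l 1)\<^sup>2 \<le> B * (tfreq 0 L (fst i) * tfreq (-l) l (snd i))\<^sup>2"
        using B by (intro mult_left_mono) auto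
      then have "\<Lambda> \<le> B * (tfreq 0 L (fst i) * tfreq (-l) l (snd i))\<^sup>2"
        using thin unfolding \<Lambda>_def A_def B_def by linarith
      then have "\<Lambda> * q i \<le> B * (tfreq 0 L (fst i) * tfreq (-l) l (snd i))\<^sup>2 * q i" using q0[OF i] by (rule mult_right_mono)
      moreover have "0 \<le> A * ((tfreq 0 L (fst i)) ^ 4 * q i)" using A q0[OF i] by simp
      ultimately show ?thesis using False by (simp add: mult.assoc)
    qed
    have split: "(\<Sum>i\<in>G. z i) = (\<Sum>i\<in>F. if snd i \<noteq> 0 then z i else 0)" for z :: "nat \<times> nat \<Rightarrow> real"
      unfolding G_def by (rule sum.inter_filter[OF F(1)])
    have "\<Lambda> * (\<Sum>i\<in>F. q i) \<le> (\<Sum>i\<in>F. A * ((tfreq 0 L (fst i)) ^ 4 * q i)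
        + (if snd i \<noteq> 0 then B * ((tfreq 0 L (fst i) * tfreq (-l) l (snd i))\<^sup>2 * q i) else 0))"
      unfolding sum_distrib_left by (rule sum_mono[OF weight])
    also have "\<dots> = A * (\<Sum>i\<in>F. (tfreq 0 L (fst i)) ^ 4 * q i)
        + B * (\<Sum>i\<in>G. (tfreq 0 L (fst i) * tfreq (-l) l (snd i))\<^sup>2 * q i)"
      by (simp only: sum.distrib sum_distrib_left split if_distrib[of "(*) B"] mult_zero_right)
    also have "\<dots> \<le> A * X + B * Y" using xx xy A B by (intro add_mono mult_left_mono) auto
    finally have "\<Lambda> * (\<Sum>i\<in>F. q i) \<le> A * X + B * Y" .
    moreover have "\<Lambda> * ip \<Omega> u u \<le> \<Lambda> * (\<epsilon> + (\<Sum>i\<in>F. q i))" using approx \<Lambda>0 by (rule mult_left_mono)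
    ultimately show ?thesis by (simp add: distrib_left)
  qed
  have *: "\<Lambda> * ip \<Omega> u u \<le> A * X + B * Y"
  proof (rule field_le_epsilon)
    fix e :: real assume "e > 0"
    have "\<Lambda> * (e / (\<Lambda> + 1)) \<le> e" using \<open>e > 0\<close> \<Lambda>0 by (simp add: field_simps)
    moreover have "e / (\<Lambda> + 1) > 0" using \<open>e > 0\<close> \<Lambda>0 by simp
    ultimately show "\<Lambda> * ip \<Omega> u u \<le> A * X + B * Y + e"
      using eps[of "e / (\<Lambda> + 1)"] by linarith
  qed
  have "d ^ 3 * K / 12 * (\<Lambda> * ip \<Omega> u u) \<le> d ^ 3 * K / 12 * (A * X + B * Y)"
    using * D by (intro mult_left_mono) auto
  with energy show ?thesis by (simp add: \<Lambda>_def A_def mult.assoc)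
qed

section \<open>Separated eigenfunctions\<close>

lemma smooth_tensor_sobolev_H:
  fixes a b c d :: real
  assumes "smooth f" "smooth g"
  shows "(\<lambda>p. f (fst p) * g (snd p)) \<in> sobolev_H k ({a<..<b} \<times> {c<..<d})"
  using assms
proof (induction k arbitrary: f g)
  case 0
  then show ?case by (simp add: continuous_on_rectangle_L2 Ck_continuous[OF Ck_tensor])
next
  case (Suc k)
  have "(\<lambda>p. f (fst p) * g (snd p)) \<in> L2 ({a<..<b} \<times> {c<..<d})"
    by (intro continuous_on_rectangle_L2 Ck_continuous[OF Ck_tensor] Suc.prems)
  moreover have "\<exists>v\<in>sobolev_H k ({a<..<b} \<times> {c<..<d}).
      has_weak_partial ({a<..<b} \<times> {c<..<d}) e (\<lambda>p. f (fst p) * g (snd p)) v" if "e \<in> Basis" for e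
  proof (cases "e = (1, 0)")
    case True
    show ?thesis unfolding True
      by (rule bexI, rule smooth_tensor_has_weak_partial(1)[OF Suc.prems],
        rule Suc.IH[OF smooth_has_deriv(2)[OF Suc.prems(1)] Suc.prems(2)])
  next
    case False
    then have e: "e = (0, 1)" using that by (auto simp: Basis_real_prod)
    show ?thesis unfolding e
      by (rule bexI, rule smooth_tensor_has_weak_partial(2)[OF Suc.prems],
        rule Suc.IH[OF Suc.prems(1) smooth_has_deriv(2)[OF Suc.prems(2)]])
  qed
  ultimately show ?case by simp
qed

lemma smooth_tensor_H2_star:
  assumes "smooth f" "smooth g" "f 0 = 0" "f L = 0"
  shows "(\<lambda>p. f (fst p) * g (snd p)) \<in> H2_star L l"
  unfolding H2_star_def
proof (intro CollectI conjI exI)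
  show "(\<lambda>p. f (fst p) * g (snd p)) \<in> sobolev_H 2 (plate L l)"
    unfolding plate_def by (rule smooth_tensor_sobolev_H[OF assms(1,2)])
  show "continuous_on (closure (plate L l)) (\<lambda>p. f (fst p) * g (snd p))"
    by (rule continuous_on_subset[OF Ck_continuous[OF Ck_tensor[OF assms(1,2)]]]) simp
qed (use assms in auto)

lemma weak_partial_tensor_AE:
  assumes f: "smooth f" and g: "smooth g" and v: "v \<in> L2 (plate L l)"
    and eq: "AE p in lborel. p \<in> plate L l \<longrightarrow> v p = f (fst p) * g (snd p)"
  shows "AE p in lborel. p \<in> plate L l \<longrightarrow> weak_partial (plate L l) (1, 0) v p = deriv f (fst p) * g (snd p)"
    and "AE p in lborel. p \<in> plate L l \<longrightarrow> weak_partial (plate L l) (0, 1) v p = f (fst p) * deriv g (snd p)"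
proof -
  note df = smooth_has_deriv(2)[OF f] and dg = smooth_has_deriv(2)[OF g]
  note L2 = tensor_L2_plate[OF f g, of L l] tensor_L2_plate[OF df g, of L l] tensor_L2_plate[OF f dg, of L l]
  note cong = has_weak_partial_cong_AE[of 0 L "-l" l, folded plate_def]
  note spec = weak_partial_spec(3)[of 0 L "-l" l, folded plate_def]
  note wp = smooth_tensor_has_weak_partial[OF f g, of 0 L "-l" l, folded plate_def]
  show "AE p in lborel. p \<in> plate L l \<longrightarrow> weak_partial (plate L l) (1, 0) v p = deriv f (fst p) * g (snd p)"
    by (rule spec[OF cong[OF wp(1) in_Basis_real_prod(1) L2(1) v AE_eq_sym[OF eq]] L2(2)])
  show "AE p in lborel. p \<in> plate L l \<longrightarrow> weak_partial (plate L l) (0, 1) v p = f (fst p) * deriv g (snd p)"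
    by (rule spec[OF cong[OF wp(2) in_Basis_real_prod(2) L2(1) v AE_eq_sym[OF eq]] L2(3)])
qed

lemma second_partials_tensor_AE:
  fixes L l :: real
  defines "\<Omega> \<equiv> plate L l"
  assumes f: "smooth f" and g: "smooth g" and u: "(\<lambda>p. f (fst p) * g (snd p)) \<in> H2_star L l"
  shows "AE p in lborel. p \<in> \<Omega> \<longrightarrow> w_xx \<Omega> (\<lambda>p. f (fst p) * g (snd p)) p = deriv (deriv f) (fst p) * g (snd p)"
    and "AE p in lborel. p \<in> \<Omega> \<longrightarrow> w_xy \<Omega> (\<lambda>p. f (fst p) * g (snd p)) p = deriv f (fst p) * deriv g (snd p)"
    and "AE p in lborel. p \<in> \<Omega> \<longrightarrow> w_yy \<Omega> (\<lambda>p. f (fst p) * g (snd p)) p = f (fst p) * deriv (deriv g) (snd p)"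
proof -
  note df = smooth_has_deriv(2)[OF f] and dg = smooth_has_deriv(2)[OF g]
  note L2 = H2_star_L2[OF u]
  have refl: "AE p in lborel. p \<in> plate L l \<longrightarrow> f (fst p) * g (snd p) = f (fst p) * g (snd p)" by simp
  note first = weak_partial_tensor_AE[OF f g L2(1) refl]
  show "AE p in lborel. p \<in> \<Omega> \<longrightarrow> w_xx \<Omega> (\<lambda>p. f (fst p) * g (snd p)) p = deriv (deriv f) (fst p) * g (snd p)"
    unfolding w_xx_def \<Omega>_def by (rule weak_partial_tensor_AE(1)[OF df g L2(2) first(1)])
  show "AE p in lborel. p \<in> \<Omega> \<longrightarrow> w_xy \<Omega> (\<lambda>p. f (fst p) * g (snd p)) p = deriv f (fst p) * deriv g (snd p)"
    unfolding w_xy_def \<Omega>_def by (rule weak_partial_tensor_AE(2)[OF df g L2(2) first(1)])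
  show "AE p in lborel. p \<in> \<Omega> \<longrightarrow> w_yy \<Omega> (\<lambda>p. f (fst p) * g (snd p)) p = f (fst p) * deriv (deriv g) (snd p)"
    unfolding w_yy_def \<Omega>_def by (rule weak_partial_tensor_AE(2)[OF f dg L2(3) first(2)])
qed

lemma ip_tensor_lin:
  assumes "z \<in> L2 (plate L l)" "smooth g" "smooth h1" "smooth h2"
  shows "ip (plate L l) z (\<lambda>p. g (fst p) * (r * h1 (snd p) + t * h2 (snd p)))
    = r * ip (plate L l) z (\<lambda>p. g (fst p) * h1 (snd p)) + t * ip (plate L l) z (\<lambda>p. g (fst p) * h2 (snd p))"
proof -
  have "(\<lambda>p. g (fst p) * (r * h1 (snd p) + t * h2 (snd p)))
      = (\<lambda>p :: real \<times> real. r * (g (fst p) * h1 (snd p)) + t * (g (fst p) * h2 (snd p)))"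
    by (rule ext) (simp add: algebra_simps)
  then show ?thesis
    using ip_lin[OF tensor_L2_plate[OF assms(2,3)] tensor_L2_plate[OF assms(2,4)] assms(1), of r t]
    by (simp add: ip_commute[of "plate L l" z])
qed

text \<open>Green's formula for \<open>u = sin (k\<pi>x/L) \<phi>(y)\<close>. The conditions on \<open>\<phi>\<close> at \<open>y = \<plusminus>l\<close> are the natural
  boundary conditions on the free edges; they are used one after the other, each time a
  \<open>y\<close>-derivative is moved away from the test function.\<close>

lemma separated_eigenfunction:
  fixes L l d K \<nu> \<kappa> \<Lambda> :: real and k :: nat
  defines "a \<equiv> tfreq 0 L k"
  assumes Ll: "0 < L" "0 < l" and \<phi>: "smooth \<phi>"
    and d1: "\<And>y. (\<phi> has_real_derivative \<phi>1 y) (at y)" and d2: "\<And>y. (\<phi>1 has_real_derivative \<phi>2 y) (at y)"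
    and d3: "\<And>y. (\<phi>2 has_real_derivative \<phi>3 y) (at y)" and d4: "\<And>y. (\<phi>3 has_real_derivative \<phi>4 y) (at y)"
    and moment: "\<And>y. y \<in> {-l, l} \<Longrightarrow> \<phi>2 y = \<nu> * a\<^sup>2 * \<phi> y"
    and shear: "\<And>y. y \<in> {-l, l} \<Longrightarrow> \<phi>3 y = (2 - \<nu>) * a\<^sup>2 * \<phi>1 y"
    and ode: "\<And>y. \<phi>4 y - 2 * a\<^sup>2 * \<phi>2 y + (1 + \<kappa>) * a ^ 4 * \<phi> y = \<Lambda> * \<phi> y"
  shows "(\<lambda>p. tsin 0 L k (fst p) * \<phi> (snd p)) \<in> plate_eigenspace L d K \<nu> \<kappa> l (d ^ 3 * K / 12 * \<Lambda>)"
proof -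
  let ?\<Omega> = "plate L l" and ?u = "\<lambda>p. tsin 0 L k (fst p) * \<phi> (snd p)"
  let ?s = "tsin 0 L k" and ?c = "tcos 0 L k"
  have s: "smooth ?s" and c: "smooth ?c" by (rule smooth_tsin smooth_tcos)+
  have sm: "smooth \<phi>1" "smooth \<phi>2" "smooth \<phi>3" "smooth \<phi>4"
    using smooth_has_derivI[OF \<phi> d1] smooth_has_derivI[OF _ d2] smooth_has_derivI[OF _ d3]
      smooth_has_derivI[OF _ d4] by blast+
  have ends: "?s 0 = 0" "?s L = 0" using tsin_ends Ll by auto
  have u: "?u \<in> H2_star L l" by (rule smooth_tensor_H2_star[OF s \<phi> ends])
  have der: "deriv \<phi> = \<phi>1" "deriv \<phi>1 = \<phi>2" "deriv \<phi>2 = \<phi>3"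
    using DERIV_imp_deriv[OF d1] DERIV_imp_deriv[OF d2] DERIV_imp_deriv[OF d3] by (auto simp: fun_eq_iff)
  have ds: "deriv ?s = (\<lambda>x. a * ?c x)" by (simp add: deriv_tsin a_def)
  have dds: "deriv (\<lambda>x. a * ?c x) = (\<lambda>x. - a\<^sup>2 * ?s x)"
  proof
    fix x show "deriv (\<lambda>x. a * ?c x) x = - a\<^sup>2 * ?s x"
      using DERIV_cmult[OF smooth_has_deriv(1)[OF c], of a x]
      by (intro DERIV_imp_deriv) (simp add: deriv_tcos a_def power2_eq_square mult.assoc)
  qed
  have as: "smooth (\<lambda>x. a * ?c x)" by (intro smooth_mult smooth_const c)
  have asn: "smooth (\<lambda>x. - a\<^sup>2 * ?s x)" by (intro smooth_mult smooth_const s)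
  have "plate_form d K \<nu> \<kappa> ?\<Omega> ?u v = d ^ 3 * K / 12 * \<Lambda> * (LINT p:?\<Omega>|lborel. ?u p * v p)"
    if v: "v \<in> H2_star L l" for v
  proof -
    note vL2 = H2_star_L2[OF v] and ibp = H2_star_ibp[OF Ll v] and uL2 = H2_star_L2[OF u]
    define I where "I z h = ip ?\<Omega> z (\<lambda>p. ?s (fst p) * h (snd p))" for z and h :: "real \<Rightarrow> real"
    have I_lin: "I z (\<lambda>y. r * h1 y + t * h2 y) = r * I z h1 + t * I z h2"
      if "z \<in> L2 ?\<Omega>" "smooth h1" "smooth h2" for z h1 h2 r t
      unfolding I_def by (rule ip_tensor_lin[OF that(1) s that(2,3)])
    have xx: "I (w_xx ?\<Omega> v) h = - a\<^sup>2 * I v h" if h: "smooth h" for h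
    proof -
      have "I (w_xx ?\<Omega> v) h = ip ?\<Omega> v (\<lambda>p. (- a\<^sup>2 * ?s (fst p)) * h (snd p))"
        unfolding I_def ibp(1)[OF s h ends] ds ibp(2)[OF as h] dds by simp
      then show ?thesis unfolding ip_tensor_scale_x[OF vL2(1) s h] I_def .
    qed
    have xy: "ip ?\<Omega> (w_xy ?\<Omega> v) (\<lambda>p. (a * ?c (fst p)) * h (snd p)) = a\<^sup>2 * I (weak_partial ?\<Omega> (0, 1) v) h"
      if h: "smooth h" for h
      unfolding ibp_xy_x[OF Ll v as h] dds ip_tensor_scale_x[OF vL2(3) s h] I_def by simp
    define Q where "Q y = 1 * \<phi>2 y + (- \<nu> * a\<^sup>2) * \<phi> y" for y
    have dQ: "(Q has_real_derivative 1 * \<phi>3 y + (- \<nu> * a\<^sup>2) * \<phi>1 y) (at y)" for y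
      unfolding Q_def by (intro DERIV_add DERIV_cmult d3 d1)
    have Q: "smooth Q" unfolding Q_def by (intro smooth_add smooth_mult smooth_const sm \<phi>)
    define R where "R y = ((2 - \<nu>) * a\<^sup>2) * \<phi>1 y + (-1) * \<phi>3 y" for y
    have dR: "(R has_real_derivative ((2 - \<nu>) * a\<^sup>2) * \<phi>2 y + (-1) * \<phi>4 y) (at y)" for y
      unfolding R_def by (intro DERIV_add DERIV_cmult d2 d4)
    have R: "smooth R" unfolding R_def by (intro smooth_add smooth_mult smooth_const sm)
    have yy: "I (w_yy ?\<Omega> v) \<phi>2 - \<nu> * a\<^sup>2 * I (w_yy ?\<Omega> v) \<phi>
        = - I (weak_partial ?\<Omega> (0, 1) v) \<phi>3 + \<nu> * a\<^sup>2 * I (weak_partial ?\<Omega> (0, 1) v) \<phi>1"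
    proof -
      have "I (w_yy ?\<Omega> v) Q = - I (weak_partial ?\<Omega> (0, 1) v) (deriv Q)"
        unfolding I_def by (rule ibp(3)[OF s Q]) (use moment in \<open>auto simp: Q_def\<close>)
      moreover have "deriv Q = (\<lambda>y. 1 * \<phi>3 y + (- \<nu> * a\<^sup>2) * \<phi>1 y)"
        by (rule ext, rule DERIV_imp_deriv[OF dQ])
      moreover have "I (w_yy ?\<Omega> v) Q = 1 * I (w_yy ?\<Omega> v) \<phi>2 + (- \<nu> * a\<^sup>2) * I (w_yy ?\<Omega> v) \<phi>"
        unfolding Q_def[abs_def] by (rule I_lin[OF vL2(6) sm(2) \<phi>])
      ultimately show ?thesis using I_lin[OF vL2(3) sm(3,1), of 1 "- \<nu> * a\<^sup>2"] by simp
    qed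
    have y: "(2 - \<nu>) * a\<^sup>2 * I (weak_partial ?\<Omega> (0, 1) v) \<phi>1 - I (weak_partial ?\<Omega> (0, 1) v) \<phi>3
        = I v \<phi>4 - (2 - \<nu>) * a\<^sup>2 * I v \<phi>2"
    proof -
      have "I (weak_partial ?\<Omega> (0, 1) v) R = - I v (deriv R)"
        unfolding I_def by (rule ibp(4)[OF s R]) (use shear in \<open>auto simp: R_def\<close>)
      moreover have "deriv R = (\<lambda>y. ((2 - \<nu>) * a\<^sup>2) * \<phi>2 y + (-1) * \<phi>4 y)"
        by (rule ext, rule DERIV_imp_deriv[OF dR])
      moreover have "I (weak_partial ?\<Omega> (0, 1) v) R
          = ((2 - \<nu>) * a\<^sup>2) * I (weak_partial ?\<Omega> (0, 1) v) \<phi>1 + (-1) * I (weak_partial ?\<Omega> (0, 1) v) \<phi>3"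
        unfolding R_def[abs_def] by (rule I_lin[OF vL2(3) sm(1,3)])
      ultimately show ?thesis using I_lin[OF vL2(1) sm(2,4), of "(2 - \<nu>) * a\<^sup>2" "-1"] by simp
    qed
    have ode': "I v \<phi>4 - 2 * a\<^sup>2 * I v \<phi>2 + (1 + \<kappa>) * a ^ 4 * I v \<phi> = \<Lambda> * I v \<phi>"
    proof -
      have "\<phi>4 = (\<lambda>y. (2 * a\<^sup>2) * \<phi>2 y + (\<Lambda> - (1 + \<kappa>) * a ^ 4) * \<phi> y)"
      proof
        fix y show "\<phi>4 y = (2 * a\<^sup>2) * \<phi>2 y + (\<Lambda> - (1 + \<kappa>) * a ^ 4) * \<phi> y"
          using ode[of y] by (simp add: algebra_simps)
      qed
      then have "I v \<phi>4 = (2 * a\<^sup>2) * I v \<phi>2 + (\<Lambda> - (1 + \<kappa>) * a ^ 4) * I v \<phi>"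
        using I_lin[OF vL2(1) sm(2) \<phi>] by simp
      then show ?thesis by (simp add: algebra_simps)
    qed
    note sp = second_partials_tensor_AE[OF s \<phi> u, unfolded ds dds der]
    have ip_u: "ip ?\<Omega> F z = ip ?\<Omega> z (\<lambda>p. g (fst p) * h (snd p))"
      if "F \<in> L2 ?\<Omega>" "z \<in> L2 ?\<Omega>" "smooth g" "smooth h"
        "AE p in lborel. p \<in> ?\<Omega> \<longrightarrow> F p = g (fst p) * h (snd p)" for F z g h
    proof -
      have "ip ?\<Omega> F z = ip ?\<Omega> (\<lambda>p. g (fst p) * h (snd p)) z"
        by (rule ip_cong_AE[OF that(1) tensor_L2_plate[OF that(3,4)] that(2) that(2) that(5)]) simp
      then show ?thesis by (simp add: ip_commute)
    qed
    have uxx: "ip ?\<Omega> (w_xx ?\<Omega> ?u) z = - a\<^sup>2 * I z \<phi>" if "z \<in> L2 ?\<Omega>" for z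
      unfolding ip_u[OF uL2(4) that asn \<phi> sp(1)] ip_tensor_scale_x[OF that s \<phi>] I_def ..
    have uyy: "ip ?\<Omega> (w_yy ?\<Omega> ?u) z = I z \<phi>2" if "z \<in> L2 ?\<Omega>" for z
      unfolding ip_u[OF uL2(6) that s sm(2) sp(3)] I_def ..
    have uxy: "ip ?\<Omega> (w_xy ?\<Omega> ?u) (w_xy ?\<Omega> v) = a\<^sup>2 * I (weak_partial ?\<Omega> (0, 1) v) \<phi>1"
      unfolding ip_u[OF uL2(5) vL2(5) as sm(1) sp(2)] by (rule xy[OF sm(1)])
    have "plate_form d K \<nu> \<kappa> ?\<Omega> ?u v = d ^ 3 * K / 12 *
      ((1 + \<kappa>) * (- a\<^sup>2 * I (w_xx ?\<Omega> v) \<phi>) + \<nu> * (- a\<^sup>2 * I (w_yy ?\<Omega> v) \<phi>)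
        + \<nu> * I (w_xx ?\<Omega> v) \<phi>2 + I (w_yy ?\<Omega> v) \<phi>2
        + 2 * (1 - \<nu>) * (a\<^sup>2 * I (weak_partial ?\<Omega> (0, 1) v) \<phi>1))"
      unfolding plate_form_eq[OF u v] uxx[OF vL2(4)] uxx[OF vL2(6)] uyy[OF vL2(4)] uyy[OF vL2(6)] uxy ..
    also have "(1 + \<kappa>) * (- a\<^sup>2 * I (w_xx ?\<Omega> v) \<phi>) + \<nu> * (- a\<^sup>2 * I (w_yy ?\<Omega> v) \<phi>)
        + \<nu> * I (w_xx ?\<Omega> v) \<phi>2 + I (w_yy ?\<Omega> v) \<phi>2
        + 2 * (1 - \<nu>) * (a\<^sup>2 * I (weak_partial ?\<Omega> (0, 1) v) \<phi>1)
      = (1 + \<kappa>) * a ^ 4 * I v \<phi> - \<nu> * a\<^sup>2 * I v \<phi>2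
        + (I (w_yy ?\<Omega> v) \<phi>2 - \<nu> * a\<^sup>2 * I (w_yy ?\<Omega> v) \<phi>)
        + 2 * (1 - \<nu>) * (a\<^sup>2 * I (weak_partial ?\<Omega> (0, 1) v) \<phi>1)"
      unfolding xx[OF \<phi>] xx[OF sm(2)] by (simp add: algebra_simps power4_eq_xxxx power2_eq_square)
    also have "\<dots> = (1 + \<kappa>) * a ^ 4 * I v \<phi> - \<nu> * a\<^sup>2 * I v \<phi>2
        + ((2 - \<nu>) * a\<^sup>2 * I (weak_partial ?\<Omega> (0, 1) v) \<phi>1 - I (weak_partial ?\<Omega> (0, 1) v) \<phi>3)"
      unfolding yy by (simp add: algebra_simps)
    also have "\<dots> = \<Lambda> * I v \<phi>" unfolding y using ode' by (simp add: algebra_simps)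
    finally show ?thesis
      by (simp add: I_def ip_def mult_ac)
  qed
  then show ?thesis using u unfolding plate_eigenspace_def by simp
qed

text \<open>The differential equation for \<open>\<phi>\<close> has the characteristic roots \<open>\<plusminus>\<alpha>\<close> and \<open>\<plusminus>\<beta>\<close>, where
  \<open>\<alpha>\<^sup>2 = a\<^sup>2 (1 + t)\<close>, \<open>\<beta>\<^sup>2 = a\<^sup>2 (1 - t)\<close> and the eigenvalue is \<open>D (\<kappa> + t\<^sup>2) a\<^sup>4\<close>. Among its even solutions the
  combination of \<open>cosh (\<alpha>y)\<close> and \<open>cosh (\<beta>y)\<close> that satisfies the bending moment condition at \<open>y = \<plusminus>l\<close> is
  unique up to a factor; the following quantity is what is left of the shear condition, with
  \<open>q = 1 - \<nu>\<close>.\<close>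

definition shear_defect :: "real \<Rightarrow> real \<Rightarrow> real \<Rightarrow> real \<Rightarrow> real" where
  "shear_defect a q t l =
     (t - q)\<^sup>2 * sqrt (1 + t) * cosh (a * sqrt (1 - t) * l) * sinh (a * sqrt (1 + t) * l)
   - (t + q)\<^sup>2 * sqrt (1 - t) * cosh (a * sqrt (1 + t) * l) * sinh (a * sqrt (1 - t) * l)"

text \<open>For \<open>t > q\<close> both coefficients of the profile are nonnegative, so that it is positive and the
  eigenfunction does not vanish.\<close>

lemma plate_eigenvalue_of_root:
  fixes L l d K \<nu> \<kappa> t :: real and k :: nat
  defines "a \<equiv> tfreq 0 L k" and "q \<equiv> 1 - \<nu>"
  assumes Ll: "0 < L" "0 < l" and k: "1 \<le> k" and q: "0 < q" and t: "q < t" "t < 1"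
    and root: "shear_defect a q t l = 0"
  shows "plate_eigenvalue L d K \<nu> \<kappa> l (d ^ 3 * K / 12 * ((\<kappa> + t\<^sup>2) * a ^ 4))"
proof -
  define \<alpha> \<beta> A B where "\<alpha> = a * sqrt (1 + t)" and "\<beta> = a * sqrt (1 - t)"
    and "A = (t - q) * cosh (\<beta> * l)" and "B = (t + q) * cosh (\<alpha> * l)"
  have a: "a > 0" using k Ll by (simp add: a_def tfreq_def)
  have t0: "t > 0" using q t by simp
  have \<alpha>2: "\<alpha>\<^sup>2 = a\<^sup>2 * (1 + t)" and \<beta>2: "\<beta>\<^sup>2 = a\<^sup>2 * (1 - t)"
    using t0 t by (simp_all add: \<alpha>_def \<beta>_def power_mult_distrib)
  have AB: "A \<ge> 0" "B > 0" using t t0 q by (simp_all add: A_def B_def)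
  define \<phi> where "\<phi> y = A * cosh (\<alpha> * y) + B * cosh (\<beta> * y)" for y
  define \<phi>1 where "\<phi>1 y = A * \<alpha> * sinh (\<alpha> * y) + B * \<beta> * sinh (\<beta> * y)" for y
  define \<phi>2 where "\<phi>2 y = A * \<alpha>\<^sup>2 * cosh (\<alpha> * y) + B * \<beta>\<^sup>2 * cosh (\<beta> * y)" for y
  define \<phi>3 where "\<phi>3 y = A * \<alpha>\<^sup>2 * \<alpha> * sinh (\<alpha> * y) + B * \<beta>\<^sup>2 * \<beta> * sinh (\<beta> * y)" for y
  define \<phi>4 where "\<phi>4 y = A * \<alpha>\<^sup>2 * \<alpha>\<^sup>2 * cosh (\<alpha> * y) + B * \<beta>\<^sup>2 * \<beta>\<^sup>2 * cosh (\<beta> * y)" for y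
  have eig: "(\<lambda>p. tsin 0 L k (fst p) * \<phi> (snd p))
      \<in> plate_eigenspace L d K \<nu> \<kappa> l (d ^ 3 * K / 12 * ((\<kappa> + t\<^sup>2) * a ^ 4))"
    unfolding a_def
  proof (rule separated_eigenfunction[OF Ll, where ?\<phi>1.0 = \<phi>1 and ?\<phi>2.0 = \<phi>2 and ?\<phi>3.0 = \<phi>3 and ?\<phi>4.0 = \<phi>4],
      unfold a_def[symmetric])
    show "smooth \<phi>" unfolding \<phi>_def
      by (intro smooth_add smooth_mult smooth_const smooth_cosh)
    show "(\<phi> has_real_derivative \<phi>1 y) (at y)" for y
      unfolding \<phi>_def \<phi>1_def by (auto intro!: derivative_eq_intros)
    show "(\<phi>1 has_real_derivative \<phi>2 y) (at y)" for y
      unfolding \<phi>1_def \<phi>2_def by (auto intro!: derivative_eq_intros simp: power2_eq_square)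
    show "(\<phi>2 has_real_derivative \<phi>3 y) (at y)" for y
      unfolding \<phi>2_def \<phi>3_def by (auto intro!: derivative_eq_intros)
    show "(\<phi>3 has_real_derivative \<phi>4 y) (at y)" for y
      unfolding \<phi>3_def \<phi>4_def by (auto intro!: derivative_eq_intros simp: power2_eq_square)
    have "\<phi>2 l = \<nu> * a\<^sup>2 * \<phi> l"
      unfolding \<phi>2_def \<phi>_def \<alpha>2 \<beta>2 A_def B_def q_def by (simp add: algebra_simps)
    then show "\<phi>2 y = \<nu> * a\<^sup>2 * \<phi> y" if "y \<in> {-l, l}" for y
      using that by (auto simp: \<phi>2_def \<phi>_def)
    have "\<phi>3 l - (2 - \<nu>) * a\<^sup>2 * \<phi>1 l = a\<^sup>2 * (A * \<alpha> * (t - q) * sinh (\<alpha> * l) - B * \<beta> * (t + q) * sinh (\<beta> * l))"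
      unfolding \<phi>3_def \<phi>1_def \<alpha>2 \<beta>2 q_def by (simp add: algebra_simps)
    also have "A * \<alpha> * (t - q) * sinh (\<alpha> * l) - B * \<beta> * (t + q) * sinh (\<beta> * l) = a * shear_defect a q t l"
      unfolding A_def B_def shear_defect_def \<alpha>_def \<beta>_def by (simp add: algebra_simps power2_eq_square)
    finally have "\<phi>3 l = (2 - \<nu>) * a\<^sup>2 * \<phi>1 l" using root by simp
    then show "\<phi>3 y = (2 - \<nu>) * a\<^sup>2 * \<phi>1 y" if "y \<in> {-l, l}" for y
      using that by (auto simp: \<phi>3_def \<phi>1_def algebra_simps)
    show "\<phi>4 y - 2 * a\<^sup>2 * \<phi>2 y + (1 + \<kappa>) * a ^ 4 * \<phi> y = (\<kappa> + t\<^sup>2) * a ^ 4 * \<phi> y" for y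
      unfolding \<phi>4_def \<phi>2_def \<phi>_def \<alpha>2 \<beta>2 by (simp add: algebra_simps power2_eq_square power4_eq_xxxx)
  qed
  have "\<phi> y > 0" for y
    unfolding \<phi>_def using AB by (intro add_nonneg_pos mult_nonneg_nonneg mult_pos_pos) (auto simp: less_imp_le)
  then have pos: "tsin 0 L k (fst p) * \<phi> (snd p) > 0" if "p \<in> box (0, -l) (L / real k, l)" for p
  proof -
    have "0 < fst p" "fst p < L / real k" using that by (cases p, auto simp: mem_box Basis_real_prod)+
    then have "0 < a * (fst p - 0)" "a * (fst p - 0) < pi"
      using a k Ll by (auto simp: a_def tfreq_def field_simps)
    then have "tsin 0 L k (fst p) > 0" by (simp add: tsin_def a_def sin_gt_zero)
    then show ?thesis using \<open>\<And>y. \<phi> y > 0\<close> by simp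
  qed
  have "\<not> (AE p in lborel. p \<in> plate L l \<longrightarrow> tsin 0 L k (fst p) * \<phi> (snd p) = 0)"
  proof
    assume zero: "AE p in lborel. p \<in> plate L l \<longrightarrow> tsin 0 L k (fst p) * \<phi> (snd p) = 0"
    have sub: "p \<in> plate L l" if "p \<in> box (0, -l) (L / real k, l)" for p
    proof -
      have "L / real k \<le> L" using k Ll by (simp add: field_simps)
      then show ?thesis using that by (cases p) (auto simp: plate_def mem_box Basis_real_prod)
    qed
    have "AE p in lborel. p \<notin> box (0, -l) (L / real k, l)"
      using zero
    proof eventually_elim
      case (elim p)
      show ?case
      proof
        assume p: "p \<in> box (0, -l) (L / real k, l)"
        show False using pos[OF p] elim sub[OF p] by linarith
      qed
    qed
    then have "box (0, -l) (L / real k, l) \<in> null_sets lborel"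
      by (subst AE_iff_null_sets) auto
    then have "measure lborel (box (0, -l) (L / real k, l)) = 0"
      by (simp add: null_sets_def measure_def)
    then show False using k Ll by (simp add: measure_lborel_box_eq Basis_real_prod)
  qed
  then show ?thesis unfolding plate_eigenvalue_def by (rule bexI[OF _ eig])
qed

lemma sinh_over_tendsto: "((\<lambda>l. sinh (c * l) / l) \<longlongrightarrow> (c::real)) (at_right 0)"
proof -
  have "((\<lambda>l. sinh (c * l)) has_real_derivative c) (at 0)"
    by (auto intro!: derivative_eq_intros)
  then have "((\<lambda>l. sinh (c * l) / l) \<longlongrightarrow> c) (at 0)"
    by (simp add: has_field_derivative_iff)
  then show ?thesis by (rule filterlim_mono) (auto simp: at_within_le_at)
qed

text \<open>The limit of the defect per unit width is a polynomial in \<open>t\<close> whose only zero in \<open>(0, 1)\<close> is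
  \<open>sqrt (1 - \<nu>\<^sup>2)\<close>; this is where the constant \<open>\<kappa> + 1 - \<nu>\<^sup>2\<close> of the beam comes from.\<close>

lemma shear_defect_tendsto:
  assumes "0 < t" "t < 1"
  shows "((\<lambda>l. shear_defect a (1 - \<nu>) t l / l) \<longlongrightarrow> 2 * a * t * (t\<^sup>2 - (1 - \<nu>\<^sup>2))) (at_right 0)"
proof -
  let ?q = "1 - \<nu>"
  have cosh: "((\<lambda>l. cosh (c * l)) \<longlongrightarrow> 1) (at_right 0)" for c :: real
  proof -
    have "isCont (\<lambda>l. cosh (c * l)) 0" by (intro continuous_intros)
    then have "((\<lambda>l. cosh (c * l)) \<longlongrightarrow> 1) (at 0)" by (simp add: isCont_def)
    then show ?thesis by (rule filterlim_mono) (auto simp: at_within_le_at)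
  qed
  have "((\<lambda>l. (t - ?q)\<^sup>2 * sqrt (1 + t) * cosh (a * sqrt (1 - t) * l) * (sinh (a * sqrt (1 + t) * l) / l)
     - (t + ?q)\<^sup>2 * sqrt (1 - t) * cosh (a * sqrt (1 + t) * l) * (sinh (a * sqrt (1 - t) * l) / l))
     \<longlongrightarrow> (t - ?q)\<^sup>2 * sqrt (1 + t) * 1 * (a * sqrt (1 + t)) - (t + ?q)\<^sup>2 * sqrt (1 - t) * 1 * (a * sqrt (1 - t))) (at_right 0)"
    by (intro tendsto_intros cosh sinh_over_tendsto)
  moreover have "(t - ?q)\<^sup>2 * sqrt (1 + t) * 1 * (a * sqrt (1 + t)) - (t + ?q)\<^sup>2 * sqrt (1 - t) * 1 * (a * sqrt (1 - t))
      = 2 * a * t * (t\<^sup>2 - (1 - \<nu>\<^sup>2))"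
  proof -
    have *: "x * sqrt z * 1 * (a * sqrt z) = x * a * z" if "z \<ge> 0" for x z
    proof -
      have "x * sqrt z * 1 * (a * sqrt z) = x * a * (sqrt z * sqrt z)" by simp
      then show ?thesis using that by simp
    qed
    have "(t - ?q)\<^sup>2 * sqrt (1 + t) * 1 * (a * sqrt (1 + t)) = (t - ?q)\<^sup>2 * a * (1 + t)"
      "(t + ?q)\<^sup>2 * sqrt (1 - t) * 1 * (a * sqrt (1 - t)) = (t + ?q)\<^sup>2 * a * (1 - t)"
      using assms by (intro *; simp)+
    then show ?thesis by (simp add: power2_eq_square algebra_simps)
  qed
  ultimately show ?thesis
    by (simp add: shear_defect_def diff_divide_distrib)
qed

text \<open>On either side of \<open>sqrt (1 - \<nu>\<^sup>2)\<close> the defect has opposite signs for small \<open>l\<close>, so it has a zero in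
  any neighbourhood of that point.\<close>

lemma plate_eigenvalue_near:
  fixes L d K \<nu> \<kappa> \<epsilon> :: real and k :: nat
  assumes L: "0 < L" and \<nu>: "0 < \<nu>" "\<nu> < 1" and k: "1 \<le> k" and \<epsilon>: "\<epsilon> > 0"
  shows "\<forall>\<^sub>F l in at_right 0. \<exists>\<mu>. \<bar>\<mu> - d ^ 3 * K / 12 * ((\<kappa> + 1 - \<nu>\<^sup>2) * (tfreq 0 L k) ^ 4)\<bar> < \<epsilon>
    \<and> plate_eigenvalue L d K \<nu> \<kappa> l \<mu>"
proof -
  define a q t0 where "a = tfreq 0 L k" and "q = 1 - \<nu>" and "t0 = sqrt (1 - \<nu>\<^sup>2)"
  define \<mu> where "\<mu> t = d ^ 3 * K / 12 * ((\<kappa> + t\<^sup>2) * a ^ 4)" for t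
  have a: "a > 0" using k L by (simp add: a_def tfreq_def)
  have q0: "q > 0" using \<nu> by (simp add: q_def)
  have \<nu>2: "\<nu>\<^sup>2 < 1" "0 < \<nu>\<^sup>2" using \<nu> by (simp_all add: power_less_one_iff)
  have t02: "t0\<^sup>2 = 1 - \<nu>\<^sup>2" using \<nu>2 by (simp add: t0_def)
  have t01: "t0 < 1" using \<nu>2 by (simp add: t0_def)
  have "q\<^sup>2 < t0\<^sup>2"
    unfolding t02 using mult_strict_left_mono[OF \<nu>(2,1)] by (simp add: q_def power2_eq_square algebra_simps)
  moreover have "0 \<le> t0" using \<nu>2 by (simp add: t0_def)
  ultimately have qt0: "q < t0" by (rule power_less_imp_less_base)
  have "isCont \<mu> t0" unfolding \<mu>_def by (intro continuous_intros)
  then have "\<forall>\<^sub>F t in at t0. dist (\<mu> t) (\<mu> t0) < \<epsilon>" using \<epsilon> unfolding isCont_def tendsto_iff by blast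
  moreover have "\<forall>\<^sub>F t in at t0. q < t" "\<forall>\<^sub>F t in at t0. t < 1"
    using qt0 t01 by (auto intro: order_tendstoD tendsto_ident_at)
  ultimately have "\<forall>\<^sub>F t in at t0. dist (\<mu> t) (\<mu> t0) < \<epsilon> \<and> q < t \<and> t < 1"
    by eventually_elim auto
  then obtain r where r: "r > 0" "\<And>t. t \<noteq> t0 \<Longrightarrow> dist t t0 < r \<Longrightarrow> dist (\<mu> t) (\<mu> t0) < \<epsilon> \<and> q < t \<and> t < 1"
    unfolding eventually_at by auto
  define t1 t2 where "t1 = t0 - r / 2" and "t2 = t0 + r / 2"
  have good: "dist (\<mu> t) (\<mu> t0) < \<epsilon> \<and> q < t \<and> t < 1" if "t \<in> {t1..t2}" for t
  proof (cases "t = t0")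
    case True then show ?thesis using \<epsilon> qt0 t01 by simp
  next
    case False
    then show ?thesis using that r(1) by (intro r(2)) (auto simp: t1_def t2_def dist_real_def abs_if field_simps)
  qed
  have t12: "t1 < t0" "t0 < t2" "t1 \<le> t2" using r(1) by (auto simp: t1_def t2_def)
  have g1: "0 < t1" "t1 < 1" and g2: "0 < t2" "t2 < 1"
    using good[of t1] good[of t2] t12 q0 by auto
  have "t1\<^sup>2 < t0\<^sup>2" "t0\<^sup>2 < t2\<^sup>2"
    using t12 g1 by (auto intro!: power_strict_mono)
  then have "2 * a * t1 * (t1\<^sup>2 - (1 - \<nu>\<^sup>2)) < 0" "0 < 2 * a * t2 * (t2\<^sup>2 - (1 - \<nu>\<^sup>2))"
    unfolding t02[symmetric] using a g1 g2 by (auto intro!: mult_pos_neg mult_pos_pos)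
  then have "\<forall>\<^sub>F l in at_right 0. shear_defect a q t1 l / l < 0" "\<forall>\<^sub>F l in at_right 0. 0 < shear_defect a q t2 l / l"
    using order_tendstoD[OF shear_defect_tendsto[OF g1]] order_tendstoD[OF shear_defect_tendsto[OF g2]]
    unfolding q_def by blast+
  then show ?thesis using eventually_at_right_less[of 0]
  proof eventually_elim
    case (elim l)
    then have sgn: "shear_defect a q t1 l \<le> 0" "0 \<le> shear_defect a q t2 l"
      by (auto simp: divide_less_0_iff zero_less_divide_iff)
    have "\<exists>t\<ge>t1. t \<le> t2 \<and> shear_defect a q t l = 0"
      by (rule IVT'[OF sgn t12(3)]) (auto simp: shear_defect_def intro!: continuous_intros)
    then obtain t where t: "t \<in> {t1..t2}" "shear_defect a q t l = 0" by auto
    have "plate_eigenvalue L d K \<nu> \<kappa> l (\<mu> t)"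
      unfolding \<mu>_def a_def
      by (rule plate_eigenvalue_of_root[OF L elim(3) k])
        (use q0 good[OF t(1)] t(2) in \<open>auto simp: a_def q_def\<close>)
    moreover have \<mu>0: "\<mu> t0 = d ^ 3 * K / 12 * ((\<kappa> + 1 - \<nu>\<^sup>2) * (tfreq 0 L k) ^ 4)"
      by (simp add: \<mu>_def t02 a_def)
    ultimately show ?case
      unfolding \<mu>0[symmetric] using good[OF t(1)] by (intro exI[of _ "\<mu> t"]) (simp add: dist_real_def)
  qed
qed

section \<open>The Rayleigh quotient on a span of eigenfunctions\<close>

text \<open>Gaussian elimination: an unknown that occurs in the last equation is eliminated from the others.\<close>

lemma underdetermined_system:
  fixes A :: "nat \<Rightarrow> 'i \<Rightarrow> real"
  assumes "finite J" "card J > n"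
  shows "\<exists>c. (\<exists>i\<in>J. c i \<noteq> 0) \<and> (\<forall>k<n. (\<Sum>i\<in>J. c i * A k i) = 0)"
  using assms
proof (induction n arbitrary: J A)
  case 0
  then have "J \<noteq> {}" by auto
  then show ?case by (intro exI[of _ "\<lambda>i. 1"]) auto
next
  case (Suc n)
  show ?case
  proof (cases "\<forall>i\<in>J. A n i = 0")
    case True
    obtain c where "\<exists>i\<in>J. c i \<noteq> 0" "\<forall>k<n. (\<Sum>i\<in>J. c i * A k i) = 0"
      using Suc.IH[of J A] Suc.prems by auto
    then show ?thesis using True by (intro exI[of _ c]) (auto simp: less_Suc_eq)
  next
    case False
    then obtain j where j: "j \<in> J" "A n j \<noteq> 0" by blast
    define J' where "J' = J - {j}"
    have J': "finite J'" "card J' > n" "J = insert j J'" "j \<notin> J'"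
      using Suc.prems j by (auto simp: J'_def)
    from Suc.IH[OF J'(1,2), of "\<lambda>k i. A k i - A k j * A n i / A n j"]
    obtain c where c: "\<exists>i\<in>J'. c i \<noteq> 0" "\<And>k. k < n \<Longrightarrow> (\<Sum>i\<in>J'. c i * (A k i - A k j * A n i / A n j)) = 0"
      by blast
    define e where "e = (\<Sum>i\<in>J'. c i * A n i)"
    define c' where "c' = c(j := - e / A n j)"
    have sum: "(\<Sum>i\<in>J. c' i * A k i) = (\<Sum>i\<in>J'. c i * (A k i - A k j * A n i / A n j))" for k
    proof -
      have "(\<Sum>i\<in>J. c' i * A k i) = - e / A n j * A k j + (\<Sum>i\<in>J'. c' i * A k i)"
        using J' by (simp add: c'_def)
      also have "(\<Sum>i\<in>J'. c' i * A k i) = (\<Sum>i\<in>J'. c i * A k i)"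
        using J'(4) by (intro sum.cong) (auto simp: c'_def)
      also have "- e / A n j * A k j = - (\<Sum>i\<in>J'. c i * (A k j * A n i / A n j))"
        by (simp add: e_def sum_distrib_left sum_divide_distrib mult_ac)
      finally show ?thesis by (simp add: right_diff_distrib sum_subtractf)
    qed
    have "(\<Sum>i\<in>J. c' i * A k i) = 0" if "k < Suc n" for k
    proof (cases "k = n")
      case True
      then show ?thesis unfolding sum using j by simp
    next
      case False
      then show ?thesis unfolding sum using c(2) that by simp
    qed
    moreover have "\<exists>i\<in>J. c' i \<noteq> 0" using c(1) J' by (auto simp: c'_def)
    ultimately show ?thesis by blast
  qed
qed

lemma ip_sum_sum:
  assumes "finite J" "\<And>i. i \<in> J \<Longrightarrow> u i \<in> L2 \<Omega>"
  shows "ip \<Omega> (\<lambda>x. \<Sum>i\<in>J. c i * u i x) (\<lambda>x. \<Sum>i\<in>J. e i * u i x)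
    = (\<Sum>i\<in>J. \<Sum>j\<in>J. c i * e j * ip \<Omega> (u i) (u j))"
proof -
  let ?v = "\<lambda>x. \<Sum>i\<in>J. e i * u i x"
  have v: "?v \<in> L2 \<Omega>" by (rule L2_sum[OF assms])
  have *: "ip \<Omega> (u i) ?v = (\<Sum>j\<in>J. e j * ip \<Omega> (u i) (u j))" if "i \<in> J" for i
  proof -
    have "ip \<Omega> ?v (u i) = (\<Sum>j\<in>J. e j * ip \<Omega> (u j) (u i))"
      by (rule ip_sum[OF assms assms(2)[OF that]])
    then show ?thesis by (simp add: ip_commute[of \<Omega> ?v "u i"] ip_commute[of \<Omega> "u _" "u i"])
  qed
  have "ip \<Omega> (\<lambda>x. \<Sum>i\<in>J. c i * u i x) ?v = (\<Sum>i\<in>J. c i * ip \<Omega> (u i) ?v)"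
    by (rule ip_sum[OF assms v])
  also have "\<dots> = (\<Sum>i\<in>J. \<Sum>j\<in>J. c i * e j * ip \<Omega> (u i) (u j))"
    by (intro sum.cong refl) (simp add: * sum_distrib_left mult.assoc)
  finally show ?thesis .
qed

lemma H2_star_sum:
  assumes "finite J" "J \<noteq> {}" "\<And>i. i \<in> J \<Longrightarrow> u i \<in> H2_star L l"
  shows "(\<lambda>x. \<Sum>i\<in>J. c i * u i x) \<in> H2_star L l
    \<and> (\<forall>w\<in>H2_star L l. plate_form d K \<nu> \<kappa> (plate L l) (\<lambda>x. \<Sum>i\<in>J. c i * u i x) w
      = (\<Sum>i\<in>J. c i * plate_form d K \<nu> \<kappa> (plate L l) (u i) w))"
  using assms
proof (induction rule: finite_ne_induct)
  case (singleton i)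
  then show ?case using H2_star_lin[of "u i" L l "u i" "c i" 0] plate_form_lin[of "u i" L l "u i" _ d K \<nu> \<kappa> "c i" 0] by simp
next
  case (insert i J)
  let ?v = "\<lambda>x. \<Sum>i\<in>J. c i * u i x"
  have v: "?v \<in> H2_star L l" and ui: "u i \<in> H2_star L l" using insert by auto
  have "plate_form d K \<nu> \<kappa> (plate L l) (\<lambda>x. c i * u i x + 1 * ?v x) w
      = c i * plate_form d K \<nu> \<kappa> (plate L l) (u i) w + 1 * plate_form d K \<nu> \<kappa> (plate L l) ?v w"
    if "w \<in> H2_star L l" for w
    by (rule plate_form_lin[OF ui v that])
  then show ?case using insert H2_star_lin[OF ui v, of "c i" 1] by simp
qed

lemma eigenspace_plate_form:
  assumes "u \<in> plate_eigenspace L d K \<nu> \<kappa> l \<mu>" "v \<in> H2_star L l"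
  shows "u \<in> H2_star L l" "plate_form d K \<nu> \<kappa> (plate L l) u v = \<mu> * ip (plate L l) u v"
  using assms by (auto simp: plate_eigenspace_def ip_def)

lemma eigenspaces_orthogonal:
  assumes "u \<in> plate_eigenspace L d K \<nu> \<kappa> l \<mu>" "v \<in> plate_eigenspace L d K \<nu> \<kappa> l \<mu>'" "\<mu> \<noteq> \<mu>'"
  shows "ip (plate L l) u v = 0"
proof -
  have uv: "u \<in> H2_star L l" "v \<in> H2_star L l" using assms by (auto simp: plate_eigenspace_def)
  have "\<mu> * ip (plate L l) u v = \<mu>' * ip (plate L l) v u"
    using eigenspace_plate_form(2)[OF assms(1) uv(2)] eigenspace_plate_form(2)[OF assms(2) uv(1)]
      plate_form_commute[of d K \<nu> \<kappa> "plate L l" u v] by simp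
  then show ?thesis using assms(3) by (simp add: ip_commute[of _ v u])
qed

lemma plate_eigenvalue_sequence_mono:
  assumes "plate_eigenvalue_sequence L d K \<nu> \<kappa> l lam" "1 \<le> i" "i \<le> j"
  shows "lam i \<le> lam j"
  using assms(3)
proof (induction rule: dec_induct)
  case (step n)
  then show ?case using assms(1,2) unfolding plate_eigenvalue_sequence_def
    by (meson order_trans)
qed simp

text \<open>One eigenfunction for each of the first \<open>m\<close> entries of the sequence, such that the whole family
  is linearly independent: an entry takes from a basis of its eigenspace the element numbered by the
  count of earlier entries with the same value. Different eigenspaces are orthogonal.\<close>

lemma independent_eigenfunctions:
  fixes lam :: "nat \<Rightarrow> real"
  assumes seq: "plate_eigenvalue_sequence L d K \<nu> \<kappa> l lam"
  obtains u where "\<And>i. 1 \<le> i \<Longrightarrow> u i \<in> plate_eigenspace L d K \<nu> \<kappa> l (lam i)"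
    and "\<And>m c. (AE x in lborel. x \<in> plate L l \<longrightarrow> (\<Sum>i\<in>{1..m}. c i * u i x) = 0) \<Longrightarrow> \<forall>i\<in>{1..m}. c i = 0"
proof -
  let ?V = "plate_eigenspace L d K \<nu> \<kappa> l" and ?\<Omega> = "plate L l"
  define n where "n \<mu> = card {j. 1 \<le> j \<and> lam j = \<mu>}" for \<mu>
  have eig: "plate_eigenvalue L d K \<nu> \<kappa> l (lam i)" if "1 \<le> i" for i
    using seq that unfolding plate_eigenvalue_sequence_def by auto
  have fin: "finite {j. 1 \<le> j \<and> lam j = \<mu>}" and dim: "has_dim_ae ?\<Omega> (?V \<mu>) (n \<mu>)"
    if "plate_eigenvalue L d K \<nu> \<kappa> l \<mu>" for \<mu>
    using seq that unfolding plate_eigenvalue_sequence_def n_def by auto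
  have "\<forall>\<mu>. \<exists>b. plate_eigenvalue L d K \<nu> \<kappa> l \<mu> \<longrightarrow> (\<forall>i<n \<mu>. b i \<in> ?V \<mu>)
      \<and> (\<forall>c. (AE x in lborel. x \<in> ?\<Omega> \<longrightarrow> (\<Sum>i<n \<mu>. c i * b i x) = 0) \<longrightarrow> (\<forall>i<n \<mu>. c i = 0))"
    using dim unfolding has_dim_ae_def by blast
  from choice[OF this] obtain b where bas: "\<forall>\<mu>. plate_eigenvalue L d K \<nu> \<kappa> l \<mu> \<longrightarrow> (\<forall>i<n \<mu>. b \<mu> i \<in> ?V \<mu>)
      \<and> (\<forall>c. (AE x in lborel. x \<in> ?\<Omega> \<longrightarrow> (\<Sum>i<n \<mu>. c i * b \<mu> i x) = 0) \<longrightarrow> (\<forall>i<n \<mu>. c i = 0))"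
    by blast
  then have b: "\<And>\<mu> i. plate_eigenvalue L d K \<nu> \<kappa> l \<mu> \<Longrightarrow> i < n \<mu> \<Longrightarrow> b \<mu> i \<in> ?V \<mu>"
    and indep: "\<And>\<mu> c i. plate_eigenvalue L d K \<nu> \<kappa> l \<mu> \<Longrightarrow>
      (AE x in lborel. x \<in> ?\<Omega> \<longrightarrow> (\<Sum>i<n \<mu>. c i * b \<mu> i x) = 0) \<Longrightarrow> i < n \<mu> \<Longrightarrow> c i = 0"
    by blast+
  define idx where "idx i = card {j. 1 \<le> j \<and> j < i \<and> lam j = lam i}" for i
  have idx_mono: "idx i < idx i'" if "1 \<le> i" "i < i'" "lam i = lam i'" for i i'
    unfolding idx_def using that by (intro psubset_card_mono) auto
  have idx_inj: "i = i'" if "1 \<le> i" "1 \<le> i'" "lam i = lam i'" "idx i = idx i'" for i i'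
    using idx_mono[of i i'] idx_mono[of i' i] that by (cases i i' rule: linorder_cases) auto
  have idx_less: "idx i < n (lam i)" if "1 \<le> i" for i
    unfolding idx_def n_def using fin[OF eig[OF that]] that by (intro psubset_card_mono) auto
  define u where "u i = b (lam i) (idx i)" for i
  have uV: "u i \<in> ?V (lam i)" if "1 \<le> i" for i
    unfolding u_def using b[OF eig[OF that] idx_less[OF that]] .
  have uL2: "u i \<in> L2 ?\<Omega>" if "1 \<le> i" for i
    using uV[OF that] H2_star_L2(1) by (auto simp: plate_eigenspace_def)
  have "\<forall>i\<in>{1..m}. c i = 0"
    if zero: "AE x in lborel. x \<in> ?\<Omega> \<longrightarrow> (\<Sum>i\<in>{1..m}. c i * u i x) = 0" for m c
  proof
    fix i0 assume i0: "i0 \<in> {1..m}"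
    define J where "J = {1..m}"
    define \<mu> where "\<mu> = lam i0"
    define e where "e i = (if lam i = \<mu> then c i else 0)" for i
    define U W where "U x = (\<Sum>i\<in>J. c i * u i x)" and "W x = (\<Sum>i\<in>J. e i * u i x)" for x
    have JL2: "u i \<in> L2 ?\<Omega>" if "i \<in> J" for i using uL2 that by (simp add: J_def)
    have J: "finite J" by (simp add: J_def)
    have U: "U \<in> L2 ?\<Omega>" and W: "W \<in> L2 ?\<Omega>"
      unfolding U_def[abs_def] W_def[abs_def] using L2_sum[OF J JL2] by auto
    have "ip ?\<Omega> W W = (\<Sum>i\<in>J. \<Sum>j\<in>J. e i * e j * ip ?\<Omega> (u i) (u j))"
      unfolding W_def[abs_def] by (rule ip_sum_sum[OF J JL2])
    also have "\<dots> = (\<Sum>i\<in>J. \<Sum>j\<in>J. e i * c j * ip ?\<Omega> (u i) (u j))"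
    proof (intro sum.cong refl)
      fix i j assume "i \<in> J" "j \<in> J"
      then have "ip ?\<Omega> (u i) (u j) = 0" if "lam i \<noteq> lam j"
        using eigenspaces_orthogonal[OF uV uV that] by (simp add: J_def)
      then show "e i * e j * ip ?\<Omega> (u i) (u j) = e i * c j * ip ?\<Omega> (u i) (u j)"
        by (auto simp: e_def)
    qed
    also have "\<dots> = ip ?\<Omega> W U"
      unfolding W_def[abs_def] U_def[abs_def] by (rule ip_sum_sum[OF J JL2, symmetric])
    also have "\<dots> = ip ?\<Omega> W (\<lambda>x. 0)"
      by (rule ip_cong_AE[OF W W U L2_zero]) (use zero in \<open>auto simp: U_def J_def\<close>)
    also have "\<dots> = 0" by (simp add: ip_def set_lebesgue_integral_def)
    finally have "AE x in lborel. x \<in> ?\<Omega> \<longrightarrow> W x = 0" by (rule ip_self_eq_0[OF W])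
    moreover define g where "g r = (\<Sum>i | i \<in> J \<and> lam i = \<mu> \<and> idx i = r. c i)" for r
    have "W x = (\<Sum>r<n \<mu>. g r * b \<mu> r x)" for x
    proof -
      have "W x = (\<Sum>i | i \<in> J \<and> lam i = \<mu>. c i * b \<mu> (idx i) x)"
        unfolding W_def e_def u_def using J by (intro sum.mono_neutral_cong_right) auto
      also have "\<dots> = (\<Sum>r<n \<mu>. \<Sum>i | i \<in> {i. i \<in> J \<and> lam i = \<mu>} \<and> idx i = r. c i * b \<mu> (idx i) x)"
      proof (rule sum.group[symmetric])
        show "idx ` {i. i \<in> J \<and> lam i = \<mu>} \<subseteq> {..<n \<mu>}" using idx_less by (auto simp: J_def)
      qed (use J in auto)
      also have "\<dots> = (\<Sum>r<n \<mu>. g r * b \<mu> r x)"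
        unfolding g_def sum_distrib_right by (intro sum.cong) auto
      finally show ?thesis .
    qed
    ultimately have "AE x in lborel. x \<in> ?\<Omega> \<longrightarrow> (\<Sum>r<n \<mu>. g r * b \<mu> r x) = 0" by simp
    then have "g (idx i0) = 0"
      using indep[of \<mu> g "idx i0"] eig[of i0] idx_less[of i0] i0 by (simp add: \<mu>_def)
    moreover have "{i. i \<in> J \<and> lam i = \<mu> \<and> idx i = idx i0} = {i0}"
      using i0 idx_inj by (auto simp: J_def \<mu>_def)
    ultimately show "c i0 = 0" by (simp add: g_def)
  qed
  then show ?thesis using that uV by blast
qed

text \<open>The form is at most \<open>lam m\<close> times the squared norm on the span of the first \<open>m\<close> eigenfunctions,
  because the difference is the squared norm of the combination with coefficients
  \<open>sqrt (lam m - lam i) * c i\<close>. By a count of dimensions the span contains a nonzero function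
  orthogonal to the \<open>m - 1\<close> lowest modes.\<close>

lemma eigenvalue_lower_bound:
  fixes L l d K \<nu> \<kappa> :: real and m :: nat and lam :: "nat \<Rightarrow> real"
  assumes Ll: "0 < L" "0 < l" and D: "d ^ 3 * K / 12 > 0" and \<nu>: "0 < \<nu>" "\<nu> < 1" and \<kappa>: "\<kappa> > 0"
    and m: "1 \<le> m" and seq: "plate_eigenvalue_sequence L d K \<nu> \<kappa> l lam"
    and thin: "(\<kappa> + 1 - \<nu>\<^sup>2) * (tfreq 0 L m) ^ 4 \<le> 2 * (1 - \<nu>) * (tfreq 0 L 1 * tfreq (-l) l 1)\<^sup>2"
  shows "d ^ 3 * K / 12 * ((\<kappa> + 1 - \<nu>\<^sup>2) * (tfreq 0 L m) ^ 4) \<le> lam m"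
proof -
  let ?\<Omega> = "plate L l"
  obtain u where uV: "\<And>i. 1 \<le> i \<Longrightarrow> u i \<in> plate_eigenspace L d K \<nu> \<kappa> l (lam i)"
    and indep: "\<And>m c. (AE x in lborel. x \<in> plate L l \<longrightarrow> (\<Sum>i\<in>{1..m}. c i * u i x) = 0) \<Longrightarrow> \<forall>i\<in>{1..m}. c i = 0"
    using independent_eigenfunctions[OF seq] by blast
  define J where "J = {1..m}"
  have J: "finite J" "J \<noteq> {}" using m by (auto simp: J_def)
  have uH: "u i \<in> H2_star L l" if "i \<in> J" for i
    using uV[of i] that by (auto simp: J_def plate_eigenspace_def)
  have uL2: "u i \<in> L2 ?\<Omega>" if "i \<in> J" for i using H2_star_L2(1)[OF uH[OF that]] .
  have "\<exists>c. (\<exists>i\<in>J. c i \<noteq> 0) \<and> (\<forall>k<m - 1. (\<Sum>i\<in>J. c i * ip ?\<Omega> (u i) (mode L l (Suc k, 0))) = 0)"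
    using m by (intro underdetermined_system) (auto simp: J_def)
  then obtain c i0 where i0: "i0 \<in> J" "c i0 \<noteq> 0"
    and c: "\<And>k. k < m - 1 \<Longrightarrow> (\<Sum>i\<in>J. c i * ip ?\<Omega> (u i) (mode L l (Suc k, 0))) = 0" by blast
  define U where "U x = (\<Sum>i\<in>J. c i * u i x)" for x
  have UH: "U \<in> H2_star L l" and Uform: "\<And>w. w \<in> H2_star L l \<Longrightarrow>
      plate_form d K \<nu> \<kappa> ?\<Omega> U w = (\<Sum>i\<in>J. c i * plate_form d K \<nu> \<kappa> ?\<Omega> (u i) w)"
    unfolding U_def[abs_def] using H2_star_sum[OF J uH] by auto
  have UL2: "U \<in> L2 ?\<Omega>" by (rule H2_star_L2(1)[OF UH])
  have "ip ?\<Omega> U (mode L l (k, 0)) = 0" if "1 \<le> k" "k < m" for k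
  proof -
    have "ip ?\<Omega> U (mode L l (k, 0)) = (\<Sum>i\<in>J. c i * ip ?\<Omega> (u i) (mode L l (k, 0)))"
      unfolding U_def[abs_def] by (rule ip_sum[OF J(1) uL2 mode_L2(1)])
    then show ?thesis using c[of "k - 1"] that by simp
  qed
  then have low: "d ^ 3 * K / 12 * ((\<kappa> + 1 - \<nu>\<^sup>2) * (tfreq 0 L m) ^ 4) * ip ?\<Omega> U U \<le> plate_form d K \<nu> \<kappa> ?\<Omega> U U"
    by (intro plate_form_lower_bound Ll D \<nu> \<kappa> UH thin)
  have "plate_form d K \<nu> \<kappa> ?\<Omega> U U = (\<Sum>i\<in>J. \<Sum>j\<in>J. lam i * (c i * c j * ip ?\<Omega> (u i) (u j)))"
  proof -
    have "plate_form d K \<nu> \<kappa> ?\<Omega> (u i) U = lam i * (\<Sum>j\<in>J. c j * ip ?\<Omega> (u i) (u j))" if i: "i \<in> J" for i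
    proof -
      have "ip ?\<Omega> U (u i) = (\<Sum>j\<in>J. c j * ip ?\<Omega> (u j) (u i))"
        unfolding U_def[abs_def] by (rule ip_sum[OF J(1) uL2 uL2[OF i]])
      then have "ip ?\<Omega> (u i) U = (\<Sum>j\<in>J. c j * ip ?\<Omega> (u i) (u j))"
        by (simp only: ip_commute[of ?\<Omega> U "u i"] ip_commute[of ?\<Omega> "u _" "u i"])
      then show ?thesis using eigenspace_plate_form(2)[OF uV UH, of i] i by (simp add: J_def)
    qed
    then show ?thesis
      unfolding Uform[OF UH] by (intro sum.cong refl) (simp add: sum_distrib_left mult_ac)
  qed
  moreover have "ip ?\<Omega> U U = (\<Sum>i\<in>J. \<Sum>j\<in>J. c i * c j * ip ?\<Omega> (u i) (u j))"
    unfolding U_def[abs_def] by (rule ip_sum_sum[OF J(1) uL2])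
  ultimately have "lam m * ip ?\<Omega> U U - plate_form d K \<nu> \<kappa> ?\<Omega> U U
      = (\<Sum>i\<in>J. \<Sum>j\<in>J. (lam m - lam i) * (c i * c j * ip ?\<Omega> (u i) (u j)))"
    by (simp only: sum_distrib_left sum_subtractf left_diff_distrib)
  also have "\<dots> = (\<Sum>i\<in>J. \<Sum>j\<in>J. (sqrt (lam m - lam i) * c i) * (sqrt (lam m - lam j) * c j) * ip ?\<Omega> (u i) (u j))"
  proof (intro sum.cong refl)
    fix i j assume ij: "i \<in> J" "j \<in> J"
    show "(lam m - lam i) * (c i * c j * ip ?\<Omega> (u i) (u j))
        = (sqrt (lam m - lam i) * c i) * (sqrt (lam m - lam j) * c j) * ip ?\<Omega> (u i) (u j)"
    proof (cases "lam i = lam j")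
      case True
      have "lam m - lam i \<ge> 0"
        using plate_eigenvalue_sequence_mono[OF seq, of i m] ij by (simp add: J_def)
      then have "sqrt (lam m - lam i) * sqrt (lam m - lam j) = lam m - lam i" using True by simp
      moreover have "(sqrt (lam m - lam i) * c i) * (sqrt (lam m - lam j) * c j) * ip ?\<Omega> (u i) (u j)
          = (sqrt (lam m - lam i) * sqrt (lam m - lam j)) * (c i * c j * ip ?\<Omega> (u i) (u j))"
        by (simp only: mult_ac)
      ultimately show ?thesis by simp
    next
      case False
      then have "ip ?\<Omega> (u i) (u j) = 0"
        using eigenspaces_orthogonal[OF uV uV False] ij by (simp add: J_def)
      then show ?thesis by simp
    qed
  qed
  also have "\<dots> = ip ?\<Omega> (\<lambda>x. \<Sum>i\<in>J. (sqrt (lam m - lam i) * c i) * u i x) (\<lambda>x. \<Sum>i\<in>J. (sqrt (lam m - lam i) * c i) * u i x)"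
    by (rule ip_sum_sum[OF J(1) uL2, symmetric])
  also have "\<dots> \<ge> 0" by (rule ip_nonneg)
  finally have "plate_form d K \<nu> \<kappa> ?\<Omega> U U \<le> lam m * ip ?\<Omega> U U" by simp
  with low have le: "d ^ 3 * K / 12 * ((\<kappa> + 1 - \<nu>\<^sup>2) * (tfreq 0 L m) ^ 4) * ip ?\<Omega> U U \<le> lam m * ip ?\<Omega> U U"
    by linarith
  have "ip ?\<Omega> U U \<noteq> 0"
  proof
    assume "ip ?\<Omega> U U = 0"
    then have "AE x in lborel. x \<in> ?\<Omega> \<longrightarrow> U x = 0" by (rule ip_self_eq_0[OF UL2])
    from indep[OF this[unfolded U_def J_def]] show False using i0 by (simp add: J_def)
  qed
  then have "ip ?\<Omega> U U > 0" using ip_nonneg[of ?\<Omega> U] by linarith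
  with le show ?thesis by simp
qed

text \<open>If \<open>lam m > M\<close>, then all eigenvalues up to \<open>M\<close> occur among the first \<open>m - 1\<close> entries, which is too
  few for \<open>m\<close> distinct ones.\<close>

lemma eigenvalue_upper_bound:
  fixes lam :: "nat \<Rightarrow> real"
  assumes seq: "plate_eigenvalue_sequence L d K \<nu> \<kappa> l lam"
    and \<mu>: "\<And>k. k \<in> {1..m} \<Longrightarrow> plate_eigenvalue L d K \<nu> \<kappa> l (\<mu> k)" "inj_on \<mu> {1..m}"
      "\<And>k. k \<in> {1..m} \<Longrightarrow> \<mu> k \<le> M"
    and m: "1 \<le> m"
  shows "lam m \<le> M"
proof (rule ccontr)
  assume M: "\<not> lam m \<le> M"
  have "\<exists>i. 1 \<le> i \<and> lam i = \<mu> k" if "k \<in> {1..m}" for k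
  proof -
    have "\<mu> k \<in> lam ` {1..}" using seq \<mu>(1)[OF that] unfolding plate_eigenvalue_sequence_def by auto
    then show ?thesis by auto
  qed
  then have "\<forall>k\<in>{1..m}. \<exists>i. 1 \<le> i \<and> lam i = \<mu> k" by blast
  from bchoice[OF this] obtain i where i: "\<And>k. k \<in> {1..m} \<Longrightarrow> 1 \<le> i k \<and> lam (i k) = \<mu> k" by blast
  have "i k < m" if "k \<in> {1..m}" for k
  proof (rule ccontr)
    assume "\<not> i k < m"
    then have "lam m \<le> lam (i k)" using plate_eigenvalue_sequence_mono[OF seq m] by simp
    then show False using i[OF that] \<mu>(3)[OF that] M by simp
  qed
  then have sub: "i ` {1..m} \<subseteq> {1..<m}" using i by fastforce
  have inj: "inj_on i {1..m}"
  proof (rule inj_onI)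
    fix k k' assume "k \<in> {1..m}" "k' \<in> {1..m}" "i k = i k'"
    then have "\<mu> k = \<mu> k'" using i[of k] i[of k'] by simp
    then show "k = k'" using inj_onD[OF \<mu>(2)] \<open>k \<in> {1..m}\<close> \<open>k' \<in> {1..m}\<close> by blast
  qed
  have "card {1..m} \<le> card {1..<m}" by (rule card_inj_on_le[OF inj sub]) simp
  then show False using m by simp
qed

section \<open>Convergence to the beam\<close>

theorem theorem4p2:
  fixes L d E1 E2 \<nu> K \<kappa> E :: real and lam :: "real \<Rightarrow> nat \<Rightarrow> real"
  assumes "L > 0" and "d > 0" and "E1 > E2" and "E2 > 0" and "0 < \<nu>" and "\<nu> < 1 / 2"
    and "K = stiffness E1 E2 \<nu>" and "\<kappa> = anisotropy E1 E2"
    and "E = (\<kappa> + 1 - \<nu>\<^sup>2) * K"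
    and "\<And>l. l > 0 \<Longrightarrow> plate_eigenvalue_sequence L d K \<nu> \<kappa> l (lam l)"
  shows "\<forall>m\<ge>1. ((\<lambda>l. lam l m) \<longlongrightarrow> E * d^3 * pi^4 * real m ^ 4 / (12 * L^4)) (at_right 0)"
proof (intro allI impI)
  fix m :: nat assume m: "1 \<le> m"
  have L: "L > 0" and \<nu>: "0 < \<nu>" "\<nu> < 1" using assms(1,5,6) by auto
  note seq = assms(10)
  have \<kappa>: "\<kappa> > 0" using assms(3,4,8) by (simp add: anisotropy_def)
  have \<nu>2: "\<nu>\<^sup>2 < 1" using \<nu> by (simp add: power_less_one_iff)
  have "K > 0"
  proof -
    have "E2 / E1 < 1" "0 < E2 / E1" using assms(3,4) by auto
    then have "\<nu>\<^sup>2 * (E2 / E1) < 1 * 1" using \<nu>2 by (intro mult_strict_mono) auto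
    then show ?thesis using assms(4,7) by (simp add: stiffness_def nu21_def power2_eq_square)
  qed
  then have D: "d ^ 3 * K / 12 > 0" using assms(2) by simp
  define A where "A = \<kappa> + 1 - \<nu>\<^sup>2"
  have A: "A > 0" using \<kappa> \<nu>2 by (simp add: A_def)
  define \<Lambda> where "\<Lambda> k = d ^ 3 * K / 12 * (A * (tfreq 0 L k) ^ 4)" for k
  \<comment> \<open>Consecutive limits \<open>\<Lambda> k = g k\<^sup>4\<close> differ by at least \<open>g\<close>.\<close>
  define g where "g = d ^ 3 * K / 12 * (A * (pi / L) ^ 4)"
  have g: "g > 0" unfolding g_def using D A L by (intro mult_pos_pos) auto
  have \<Lambda>g: "\<Lambda> k = g * real (k ^ 4)" for k
    by (simp add: \<Lambda>_def g_def tfreq_def power_mult_distrib power_divide)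
  have gap: "\<Lambda> j + g \<le> \<Lambda> k" if "j < k" for j k
  proof -
    have "j ^ 4 < k ^ 4" using that by (intro power_strict_mono) auto
    then have "real (j ^ 4) + 1 \<le> real (k ^ 4)" by linarith
    then have "g * (real (j ^ 4) + 1) \<le> g * real (k ^ 4)" using g by (intro mult_left_mono) auto
    then show ?thesis by (simp add: \<Lambda>g distrib_left)
  qed
  have lower: "\<forall>\<^sub>F l in at_right 0. \<Lambda> m \<le> lam l m"
  proof -
    have "((\<lambda>l. A * (tfreq 0 L m) ^ 4 * l\<^sup>2) \<longlongrightarrow> A * (tfreq 0 L m) ^ 4 * 0\<^sup>2) (at_right 0)"
      by (intro tendsto_intros)
    moreover have "A * (tfreq 0 L m) ^ 4 * 0\<^sup>2 < 2 * (1 - \<nu>) * (tfreq 0 L 1 * (pi / 2))\<^sup>2"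
      using \<nu> L by (simp add: tfreq_def)
    ultimately have "\<forall>\<^sub>F l in at_right 0. A * (tfreq 0 L m) ^ 4 * l\<^sup>2 < 2 * (1 - \<nu>) * (tfreq 0 L 1 * (pi / 2))\<^sup>2"
      by (rule order_tendstoD)
    then show ?thesis using eventually_at_right_less[of 0]
    proof eventually_elim
      case (elim l)
      have "tfreq (-l) l 1 = (pi / 2) / l" by (simp add: tfreq_def)
      then have "2 * (1 - \<nu>) * (tfreq 0 L 1 * tfreq (-l) l 1)\<^sup>2 = 2 * (1 - \<nu>) * (tfreq 0 L 1 * (pi / 2))\<^sup>2 / l\<^sup>2"
        by (simp add: power_mult_distrib power_divide)
      moreover have "A * (tfreq 0 L m) ^ 4 \<le> 2 * (1 - \<nu>) * (tfreq 0 L 1 * (pi / 2))\<^sup>2 / l\<^sup>2"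
        using elim by (simp only: pos_le_divide_eq zero_less_power)
      ultimately show ?case
        unfolding \<Lambda>_def A_def
        by (intro eigenvalue_lower_bound[OF L elim(2) D \<nu> \<kappa> m seq[OF elim(2)]]) linarith
    qed
  qed
  have upper: "\<forall>\<^sub>F l in at_right 0. lam l m \<le> \<Lambda> m + \<epsilon>" if "\<epsilon> > 0" for \<epsilon>
  proof -
    \<comment> \<open>The bound \<open>g / 2\<close> keeps the eigenvalues found for different \<open>k\<close> apart.\<close>
    define \<epsilon>' where "\<epsilon>' = min \<epsilon> (g / 2)"
    have \<epsilon>': "\<epsilon>' > 0" "\<epsilon>' \<le> \<epsilon>" "\<epsilon>' \<le> g / 2" using that g by (auto simp: \<epsilon>'_def)
    have "\<forall>\<^sub>F l in at_right 0. \<forall>k\<in>{1..m}. \<exists>\<mu>. \<bar>\<mu> - \<Lambda> k\<bar> < \<epsilon>' \<and> plate_eigenvalue L d K \<nu> \<kappa> l \<mu>"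
      unfolding \<Lambda>_def A_def
      by (intro eventually_ball_finite ballI plate_eigenvalue_near L \<nu> \<epsilon>'(1)) auto
    then show ?thesis using eventually_at_right_less[of 0]
    proof eventually_elim
      case (elim l)
      from bchoice[OF elim(1)] obtain \<mu> where \<mu>: "\<And>k. k \<in> {1..m} \<Longrightarrow> \<bar>\<mu> k - \<Lambda> k\<bar> < \<epsilon>' \<and> plate_eigenvalue L d K \<nu> \<kappa> l (\<mu> k)"
        by blast
      have less: "\<mu> j < \<mu> k" if "j \<in> {1..m}" "k \<in> {1..m}" "j < k" for j k
        using \<mu>[OF that(1)] \<mu>[OF that(2)] gap[OF that(3)] \<epsilon>'(3) by linarith
      have inj: "inj_on \<mu> {1..m}"
      proof (rule inj_onI)
        fix j k assume "j \<in> {1..m}" "k \<in> {1..m}" "\<mu> j = \<mu> k"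
        then show "j = k" using less[of j k] less[of k j] by (cases j k rule: linorder_cases) auto
      qed
      have bnd: "\<mu> k \<le> \<Lambda> m + \<epsilon>" if "k \<in> {1..m}" for k
      proof -
        have "\<Lambda> k \<le> \<Lambda> m" using gap[of k m] that g by (cases "k = m") auto
        then show ?thesis using \<mu>[OF that] \<epsilon>'(2) by linarith
      qed
      show ?case by (rule eigenvalue_upper_bound[OF seq[OF elim(2)] conjunct2[OF \<mu>] inj bnd m])
    qed
  qed
  have "((\<lambda>l. lam l m) \<longlongrightarrow> \<Lambda> m) (at_right 0)"
    unfolding tendsto_iff
  proof (intro allI impI)
    fix e :: real assume "e > 0"
    then have "\<forall>\<^sub>F l in at_right 0. lam l m \<le> \<Lambda> m + e / 2" by (intro upper) simp
    then show "\<forall>\<^sub>F l in at_right 0. dist (lam l m) (\<Lambda> m) < e"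
      using lower by eventually_elim (use \<open>e > 0\<close> in \<open>simp add: dist_real_def\<close>)
  qed
  moreover have "\<Lambda> m = E * d^3 * pi^4 * real m ^ 4 / (12 * L^4)"
    by (simp add: \<Lambda>_def tfreq_def assms(9) A_def power_mult_distrib power_divide)
  ultimately show "((\<lambda>l. lam l m) \<longlongrightarrow> E * d^3 * pi^4 * real m ^ 4 / (12 * L^4)) (at_right 0)" by simp
qed

end
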